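(* Let $F \leq F' \leq \mathrm{Sym}(\Omega)$ be permutation groups such that (a) $F$ acts simply transitively on $\Omega$, and (b) $F'$ is generated by the derived subgroups $[F'_a,F'_a]$ ($a\in\Omega$) of its point stabilizers. Then the type-preserving subgroup $G(F,F')^\star$ (of index two in $G(F,F')$) is a discrete group which is simple, finitely generated and of asymptotic dimension one. Moreover, there exist infinitely many pairwise non-isomorphic groups that are generated by four elements and are simple, finitely generated and of asymptotic dimension one.
   Context: Standing notation. $\Omega$ is a finite set with $d=|\Omega|\geq 3$, $\mathcal{T}_d$ is the $d$-regular tree with vertex set $V$ and set $E$ of non-oriented edges. Fix a coloring $c:E\to\Omega$ such that for every vertex $v$ its restriction $c_v$ to the set $E(v)$ of edges containing $v$ is a bijection onto $\Omega$. For $g\in\mathrm{Aut}(\mathcal{T}_d)$ and $v\in V$, the local permutation is $\sigma(g,v)=c_{gv}\circ g_v\circ c_v^{-1}\in\mathrm{Sym}(\Omega)$, where $g_v:E(v)\to E(gv)$ is induced by $g$. For $F\leq\mathrm{Sym}(\Omega)$: $U(F)=\{g:\sigma(g,v)\in F \ \forall v\}$; $G(F)=\{g:\sigma(g,v)\in F \text{ for all but finitely many } v\}$; $\hat F$ is the subgroup of permutations preserving each $F$-orbit (here $\hat F=\mathrm{Sym}(\Omega)$ since $F$ is transitive). For $F\leq F'\leq\hat F$, $G(F,F')=G(F)\cap U(F')$. For a group $G$ acting on a tree, $G^\star$ is the subgroup preserving the natural bipartition of the vertex set. Asymptotic dimension of a finitely generated group is taken with respect to a word metric. *)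

theory Defs
  imports "HOL-Analysis.Analysis" "HOL-Algebra.Algebra"
begin

text \<open>Model of the d-regular tree with a legal colouring: vertices are the reduced words
 over the colour set Omega (no two consecutive letters equal); the neighbour of v across the
 edge of colour a is nb v a (right multiplication by the involution a in the free product
 of d copies of Z/2).  The edge between v and nb v a has colour a.\<close>

definition reduced :: "'a set \<Rightarrow> 'a list \<Rightarrow> bool" where
  "reduced \<Omega> w \<longleftrightarrow> set w \<subseteq> \<Omega> \<and> (\<forall>i. Suc i < length w \<longrightarrow> w ! i \<noteq> w ! Suc i)"

definition verts :: "'a set \<Rightarrow> 'a list set" where
  "verts \<Omega> = {w. reduced \<Omega> w}"

definition nb :: "'a list \<Rightarrow> 'a \<Rightarrow> 'a list" where
  "nb v a = (if v \<noteq> [] \<and> last v = a then butlast v else v @ [a])"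

definition adj :: "'a set \<Rightarrow> 'a list \<Rightarrow> 'a list \<Rightarrow> bool" where
  "adj \<Omega> v w \<longleftrightarrow> v \<in> verts \<Omega> \<and> (\<exists>a\<in>\<Omega>. w = nb v a)"

text \<open>Automorphisms of the tree (extended by the identity outside the vertex set, so that
 they form a group under composition).\<close>

definition Aut :: "'a set \<Rightarrow> ('a list \<Rightarrow> 'a list) set" where
  "Aut \<Omega> = {g. bij_betw g (verts \<Omega>) (verts \<Omega>)
              \<and> (\<forall>v\<in>verts \<Omega>. \<forall>w\<in>verts \<Omega>. adj \<Omega> v w \<longleftrightarrow> adj \<Omega> (g v) (g w))
              \<and> (\<forall>x. x \<notin> verts \<Omega> \<longrightarrow> g x = x)}"

text \<open>Local permutation sigma(g,v) = c_{gv} o g_v o c_v^{-1}, as an element of Bij Omega.\<close>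

definition sigma :: "'a set \<Rightarrow> ('a list \<Rightarrow> 'a list) \<Rightarrow> 'a list \<Rightarrow> 'a \<Rightarrow> 'a" where
  "sigma \<Omega> g v = (\<lambda>a\<in>\<Omega>. THE b. b \<in> \<Omega> \<and> nb (g v) b = g (nb v a))"

definition Ufin :: "'a set \<Rightarrow> ('a \<Rightarrow> 'a) set \<Rightarrow> ('a list \<Rightarrow> 'a list) set" where
  "Ufin \<Omega> F = {g \<in> Aut \<Omega>. \<forall>v\<in>verts \<Omega>. sigma \<Omega> g v \<in> F}"

definition Gfin :: "'a set \<Rightarrow> ('a \<Rightarrow> 'a) set \<Rightarrow> ('a list \<Rightarrow> 'a list) set" where
  "Gfin \<Omega> F = {g \<in> Aut \<Omega>. finite {v \<in> verts \<Omega>. sigma \<Omega> g v \<notin> F}}"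

definition G2 :: "'a set \<Rightarrow> ('a \<Rightarrow> 'a) set \<Rightarrow> ('a \<Rightarrow> 'a) set \<Rightarrow> ('a list \<Rightarrow> 'a list) set" where
  "G2 \<Omega> F F' = Gfin \<Omega> F \<inter> Ufin \<Omega> F'"

text \<open>Type-preserving subgroup: preserves the bipartition of the vertex set (parity of the
 distance to the root [], i.e. of the word length).\<close>

definition star :: "'a set \<Rightarrow> ('a list \<Rightarrow> 'a list) set \<Rightarrow> ('a list \<Rightarrow> 'a list) set" where
  "star \<Omega> H = {g \<in> H. \<forall>v\<in>verts \<Omega>. even (length (g v)) \<longleftrightarrow> even (length v)}"

definition perm_grp :: "('b \<Rightarrow> 'b) set \<Rightarrow> ('b \<Rightarrow> 'b) monoid" where
  "perm_grp H = \<lparr>carrier = H, mult = (\<circ>), one = id\<rparr>"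

text \<open>The topology on G(F,F'): the unique group topology in which U(F) (with its
 permutation topology, i.e. identity neighbourhoods the pointwise stabilisers of finite vertex
 sets) is an open subgroup; basic open sets g U(F)_A with A finite.\<close>

definition Gtop :: "'a set \<Rightarrow> ('a \<Rightarrow> 'a) set \<Rightarrow> ('a \<Rightarrow> 'a) set \<Rightarrow> ('a list \<Rightarrow> 'a list) topology" where
  "Gtop \<Omega> F F' = topology (\<lambda>S. S \<subseteq> G2 \<Omega> F F' \<and>
     (\<forall>g\<in>S. \<exists>A. finite A \<and> A \<subseteq> verts \<Omega> \<and>
        (\<lambda>h. g \<circ> h) ` {h \<in> Ufin \<Omega> F. \<forall>v\<in>A. h v = v} \<subseteq> S))"

definition is_simple :: "('c, 'd) monoid_scheme \<Rightarrow> bool" where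
  "is_simple H \<longleftrightarrow> group H \<and> carrier H \<noteq> {\<one>\<^bsub>H\<^esub>} \<and>
     (\<forall>N. N \<lhd> H \<longrightarrow> N = {\<one>\<^bsub>H\<^esub>} \<or> N = carrier H)"

definition fin_gen :: "('c, 'd) monoid_scheme \<Rightarrow> bool" where
  "fin_gen H \<longleftrightarrow> (\<exists>S. finite S \<and> S \<subseteq> carrier H \<and> generate H S = carrier H)"

definition word_len :: "('c, 'd) monoid_scheme \<Rightarrow> 'c set \<Rightarrow> 'c \<Rightarrow> nat" where
  "word_len H S x = (LEAST n. \<exists>ws. length ws = n \<and> set ws \<subseteq> S \<union> m_inv H ` S
                         \<and> foldr (\<otimes>\<^bsub>H\<^esub>) ws \<one>\<^bsub>H\<^esub> = x)"

definition word_dist :: "('c, 'd) monoid_scheme \<Rightarrow> 'c set \<Rightarrow> 'c \<Rightarrow> 'c \<Rightarrow> nat" where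
  "word_dist H S x y = word_len H S (inv\<^bsub>H\<^esub> x \<otimes>\<^bsub>H\<^esub> y)"

definition asdim_le :: "('c, 'd) monoid_scheme \<Rightarrow> 'c set \<Rightarrow> nat \<Rightarrow> bool" where
  "asdim_le H S n \<longleftrightarrow> (\<forall>R::nat. \<exists>\<U>. \<Union>\<U> = carrier H
      \<and> (\<exists>D::nat. \<forall>W\<in>\<U>. \<forall>x\<in>W. \<forall>y\<in>W. word_dist H S x y \<le> D)
      \<and> (\<forall>x\<in>carrier H. finite {W\<in>\<U>. \<exists>y\<in>W. word_dist H S x y \<le> R}
             \<and> card {W\<in>\<U>. \<exists>y\<in>W. word_dist H S x y \<le> R} \<le> n + 1))"

definition asdim_one :: "('c, 'd) monoid_scheme \<Rightarrow> bool" where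
  "asdim_one H \<longleftrightarrow> fin_gen H \<and>
     (\<forall>S. finite S \<and> S \<subseteq> carrier H \<and> generate H S = carrier H \<longrightarrow>
          asdim_le H S 1 \<and> \<not> asdim_le H S 0)"

end

theory Submission
  imports Defs "HOL-Number_Theory.Cong"
begin

text \<open>Since \<open>F\<close> is simply transitive, every \<open>\<pi> \<in> F'\<close> extends uniquely from a vertex \<open>v\<close> to an
  element of \<open>G(F,F')\<close> that fixes \<open>v\<close> and has local permutations in \<open>F\<close> elsewhere: on words,
  \<open>a w\<close> goes to \<open>\<pi>(a) f(w)\<close>, where \<open>f \<in> F\<close> and \<open>f(a) = \<pi>(a)\<close>. The copies of \<open>F'\<close> obtained in this
  way at two adjacent vertices generate the type-preserving subgroup \<open>H\<close>, by cancelling the finitely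
  many singularities of an element (vertices whose local permutation is not in \<open>F\<close>) one after the other. When \<open>\<pi>\<close> fixes the colour \<open>a\<close>, the extension is
  supported on a half-tree, so the double commutator trick puts the derived subgroups of the
  point stabilisers, hence all of \<open>F'\<close>, into any nontrivial normal subgroup of \<open>H\<close>.

  For the asymptotic dimension, colour \<open>h \<in> H\<close> by the parity of the annulus around the root that
  contains \<open>h []\<close>. A chain of short steps of one colour stays in one annulus and in one branch of the
  tree, and its singularities stay in a bounded ball, so it explores only finitely many elements
  up to translation.

  The infinite family arises from \<open>\<Omega> = {0,\<dots>,p-1}\<close> with \<open>p \<ge> 7\<close> prime, \<open>F\<close> the rotations and \<open>F'\<close>
  generated by a rotation and a 3-cycle: \<open>p\<close> is the largest prime order of an element of \<open>H\<close>,
  because a torsion element fixes a vertex and then permutes its \<open>p\<close> neighbours.\<close>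

section \<open>Automorphisms of the coloured tree\<close>

text \<open>The root and its neighbours lie in different orbits of \<open>H\<close>, and this shapes
  the argument. The translation \<open>T v\<close> carries the root to \<open>v\<close> with trivial
  local permutations, but it belongs to \<open>H\<close> only when \<open>v\<close> has even length.
  So the copies of \<open>F'\<close> are needed at two adjacent vertices, and conjugation by
  \<open>L a\<close>, which normalises \<open>H\<close> and exchanges the two vertex types, passes
  from one to the other.

  Simple transitivity is used as rigidity: beyond a ball that contains its singularities, an element
  is determined by its values near that ball. Hence pointwise stabilisers in U(F) of the ball of
  radius one are trivial, and only finitely many elements have bounded displacement of the root and
  singularities in a bounded ball.

  In the chain argument it is the singularities of the inverse that stay bounded: replacing z by z s
  adds to those of the inverse of z only the z-images of those of the inverse of s, and these lie
  near z [].

  The bound 7 comes from a commutator of two 3-cycles with one common point: it involves five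
  colours, and a further colour fixed by both is needed. Primality of p also supplies the
  isomorphism invariant.\<close>

lemma reduced_iff: "reduced \<Omega> w \<longleftrightarrow> set w \<subseteq> \<Omega> \<and> successively (\<noteq>) w"
  by (simp add: reduced_def successively_conv_nth)

lemma Nil_verts [simp]: "[] \<in> verts \<Omega>"
  by (simp add: verts_def reduced_iff)

lemma singleton_verts [simp]: "[a] \<in> verts \<Omega> \<longleftrightarrow> a \<in> \<Omega>"
  by (simp add: verts_def reduced_iff)

lemma snoc_verts: "w @ [a] \<in> verts \<Omega> \<longleftrightarrow> w \<in> verts \<Omega> \<and> a \<in> \<Omega> \<and> (w \<noteq> [] \<longrightarrow> last w \<noteq> a)"
  by (auto simp: verts_def reduced_iff successively_append_iff)

lemma Cons_verts: "a # w \<in> verts \<Omega> \<longleftrightarrow> w \<in> verts \<Omega> \<and> a \<in> \<Omega> \<and> (w \<noteq> [] \<longrightarrow> hd w \<noteq> a)"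
  by (auto simp: verts_def reduced_iff successively_Cons)

lemma append_vertsD: "v @ w \<in> verts \<Omega> \<Longrightarrow> v \<in> verts \<Omega> \<and> w \<in> verts \<Omega>"
  by (auto simp: verts_def reduced_iff successively_append_iff)

lemma verts_subset: "v \<in> verts \<Omega> \<Longrightarrow> set v \<subseteq> \<Omega>"
  by (simp add: verts_def reduced_iff)

lemma nb_snoc [simp]: "nb (v @ [a]) a = v"
  by (simp add: nb_def)

lemma nb_verts: "v \<in> verts \<Omega> \<Longrightarrow> a \<in> \<Omega> \<Longrightarrow> nb v a \<in> verts \<Omega>"
  using snoc_verts[of v a \<Omega>] append_vertsD[of "butlast v" "[last v]" \<Omega>] by (auto simp: nb_def)

lemma nb_nb: "v \<in> verts \<Omega> \<Longrightarrow> nb (nb v a) a = v"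
  by (cases v rule: rev_cases) (auto simp: nb_def snoc_verts butlast_append)

lemma nb_inj: "nb v a = nb v b \<longleftrightarrow> a = b"
  by (cases v rule: rev_cases) (auto simp: nb_def dest: arg_cong[of _ _ length])

lemma even_length_nb: "even (length (nb v a)) \<longleftrightarrow> odd (length v)"
  by (cases v rule: rev_cases) (auto simp: nb_def)

lemma length_nb: "length (nb v a) \<le> Suc (length v)" "length v \<le> Suc (length (nb v a))"
  by (cases v rule: rev_cases; auto simp: nb_def)+

lemma take_nb: "n < length v \<Longrightarrow> take n (nb v a) = take n v"
  by (cases v rule: rev_cases) (auto simp: nb_def)

lemma adj_nb: "v \<in> verts \<Omega> \<Longrightarrow> a \<in> \<Omega> \<Longrightarrow> adj \<Omega> v (nb v a)"
  by (auto simp: adj_def)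

section \<open>Automorphisms as permutations of the vertices, and the cocycle of local
  permutations\<close>

abbreviation ginv :: "('b \<Rightarrow> 'b) \<Rightarrow> 'b \<Rightarrow> 'b" where
  "ginv g \<equiv> inv_into UNIV g"

lemma Aut_iff: "g \<in> Aut \<Omega> \<longleftrightarrow> g permutes verts \<Omega> \<and>
    (\<forall>v\<in>verts \<Omega>. \<forall>w\<in>verts \<Omega>. adj \<Omega> v w \<longleftrightarrow> adj \<Omega> (g v) (g w))"
  by (auto simp: Aut_def permutes_imp_bij intro: bij_imp_permutes dest: permutes_not_in)

lemma Aut_permutes: "g \<in> Aut \<Omega> \<Longrightarrow> g permutes verts \<Omega>"
  by (simp add: Aut_iff)

lemma Aut_bij: "g \<in> Aut \<Omega> \<Longrightarrow> bij g"
  using Aut_permutes permutes_bij by blast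

lemma Aut_in_verts: "g \<in> Aut \<Omega> \<Longrightarrow> g v \<in> verts \<Omega> \<longleftrightarrow> v \<in> verts \<Omega>"
  using Aut_permutes permutes_in_image by metis

lemma Aut_inj: "g \<in> Aut \<Omega> \<Longrightarrow> g v = g w \<longleftrightarrow> v = w"
  using Aut_permutes permutes_inj injD by metis

lemma Aut_ginv: "g \<in> Aut \<Omega> \<Longrightarrow> ginv g (g v) = v" "g \<in> Aut \<Omega> \<Longrightarrow> g (ginv g v) = v"
  using Aut_permutes permutes_inverses by metis+

lemma Aut_inverse: "g \<in> Aut \<Omega> \<Longrightarrow> ginv g \<in> Aut \<Omega>"
proof -
  assume g: "g \<in> Aut \<Omega>"
  have p: "ginv g permutes verts \<Omega>"
    using permutes_inv[OF Aut_permutes[OF g]] .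
  have "adj \<Omega> v w \<longleftrightarrow> adj \<Omega> (ginv g v) (ginv g w)" if "v \<in> verts \<Omega>" "w \<in> verts \<Omega>" for v w
    using g that permutes_in_image[OF p] Aut_ginv(2)[OF g] unfolding Aut_iff by metis
  with p show ?thesis
    unfolding Aut_iff by blast
qed

lemma Aut_comp: "g \<in> Aut \<Omega> \<Longrightarrow> h \<in> Aut \<Omega> \<Longrightarrow> g \<circ> h \<in> Aut \<Omega>"
  unfolding Aut_iff by (metis comp_apply permutes_compose permutes_in_image)

lemma Aut_id: "id \<in> Aut \<Omega>"
  by (simp add: Aut_iff permutes_id)

lemma sigma_in_nb:
  assumes "g \<in> Aut \<Omega>" "v \<in> verts \<Omega>" "a \<in> \<Omega>"
  shows "sigma \<Omega> g v a \<in> \<Omega>" "g (nb v a) = nb (g v) (sigma \<Omega> g v a)"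
proof -
  have "adj \<Omega> (g v) (g (nb v a))"
    using assms adj_nb nb_verts unfolding Aut_iff by metis
  then have "\<exists>!b. b \<in> \<Omega> \<and> nb (g v) b = g (nb v a)"
    unfolding adj_def by (metis nb_inj)
  from theI'[OF this] show "sigma \<Omega> g v a \<in> \<Omega>" "g (nb v a) = nb (g v) (sigma \<Omega> g v a)"
    using assms(3) by (auto simp: sigma_def)
qed

lemma sigma_eq:
  assumes "g \<in> Aut \<Omega>" "v \<in> verts \<Omega>" "a \<in> \<Omega>" "g (nb v a) = nb (g v) b"
  shows "sigma \<Omega> g v a = b"
  using sigma_in_nb(2)[OF assms(1-3)] assms(4) nb_inj by metis

lemma sigma_extensional: "sigma \<Omega> g v \<in> extensional \<Omega>"
  by (simp add: sigma_def)

lemma sigma_eqI: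
  assumes "g \<in> Aut \<Omega>" "v \<in> verts \<Omega>" "s \<in> extensional \<Omega>"
    "\<And>a. a \<in> \<Omega> \<Longrightarrow> g (nb v a) = nb (g v) (s a)"
  shows "sigma \<Omega> g v = s"
  using assms sigma_eq[OF assms(1,2)] by (intro extensionalityI[OF sigma_extensional]) auto

lemma sigma_Bij:
  assumes "finite \<Omega>" "g \<in> Aut \<Omega>" "v \<in> verts \<Omega>"
  shows "sigma \<Omega> g v \<in> Bij \<Omega>"
proof -
  have inj: "inj_on (sigma \<Omega> g v) \<Omega>"
  proof (rule inj_onI)
    fix a b assume "a \<in> \<Omega>" "b \<in> \<Omega>" "sigma \<Omega> g v a = sigma \<Omega> g v b"
    then have "g (nb v a) = g (nb v b)"
      using sigma_in_nb(2)[OF assms(2,3)] by simp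
    then show "a = b"
      by (simp add: Aut_inj[OF assms(2)] nb_inj)
  qed
  moreover have "sigma \<Omega> g v ` \<Omega> \<subseteq> \<Omega>"
    using sigma_in_nb(1)[OF assms(2,3)] by auto
  ultimately have "bij_betw (sigma \<Omega> g v) \<Omega> \<Omega>"
    using endo_inj_surj[OF assms(1)] by (simp add: bij_betw_def)
  then show ?thesis
    by (simp add: Bij_def sigma_extensional)
qed

lemma sigma_comp:
  assumes "g \<in> Aut \<Omega>" "h \<in> Aut \<Omega>" "v \<in> verts \<Omega>"
  shows "sigma \<Omega> (g \<circ> h) v = compose \<Omega> (sigma \<Omega> g (h v)) (sigma \<Omega> h v)"
proof (rule sigma_eqI)
  show "g \<circ> h \<in> Aut \<Omega>"
    using assms Aut_comp by blast
  show "(g \<circ> h) (nb v a) = nb ((g \<circ> h) v) (compose \<Omega> (sigma \<Omega> g (h v)) (sigma \<Omega> h v) a)"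
    if "a \<in> \<Omega>" for a
    using that assms by (simp add: compose_eq Aut_in_verts sigma_in_nb)
qed (use assms in auto)

lemma sigma_id: "v \<in> verts \<Omega> \<Longrightarrow> sigma \<Omega> id v = (\<lambda>x\<in>\<Omega>. x)"
  by (rule sigma_eqI) (auto simp: Aut_id)

lemma sigma_ginv:
  assumes "finite \<Omega>" "g \<in> Aut \<Omega>" "v \<in> verts \<Omega>"
  shows "sigma \<Omega> (ginv g) (g v) = m_inv (BijGroup \<Omega>) (sigma \<Omega> g v)"
proof -
  have B: "sigma \<Omega> g v \<in> Bij \<Omega>" "sigma \<Omega> (ginv g) (g v) \<in> Bij \<Omega>"
    using sigma_Bij assms Aut_inverse Aut_in_verts by metis+
  have "ginv g \<circ> g = id"
    using Aut_bij[OF assms(2)] by (simp add: bij_is_inj)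
  then have "compose \<Omega> (sigma \<Omega> (ginv g) (g v)) (sigma \<Omega> g v) = (\<lambda>x\<in>\<Omega>. x)"
    using sigma_comp[OF Aut_inverse[OF assms(2)] assms(2,3)] sigma_id[OF assms(3)] by metis
  then show ?thesis
    using B by (intro group.inv_equality[OF group_BijGroup, symmetric]) (auto simp: BijGroup_def)
qed

text \<open>Adjacency is reflected as well as preserved because each \<open>s v\<close> is onto:
  every neighbour of \<open>g v\<close> is the image of a neighbour of \<open>v\<close>.\<close>

lemma AutI:
  assumes "g permutes verts \<Omega>" "\<And>v. v \<in> verts \<Omega> \<Longrightarrow> bij_betw (s v) \<Omega> \<Omega>"
    "\<And>v a. v \<in> verts \<Omega> \<Longrightarrow> a \<in> \<Omega> \<Longrightarrow> g (nb v a) = nb (g v) (s v a)"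
  shows "g \<in> Aut \<Omega>"
proof -
  have "adj \<Omega> v w \<longleftrightarrow> adj \<Omega> (g v) (g w)" if vw: "v \<in> verts \<Omega>" "w \<in> verts \<Omega>" for v w
  proof
    assume "adj \<Omega> v w"
    then obtain a where "a \<in> \<Omega>" "w = nb v a"
      by (auto simp: adj_def)
    then show "adj \<Omega> (g v) (g w)"
      using assms(3)[of v a] vw adj_nb[of "g v" \<Omega> "s v a"] bij_betwE[OF assms(2)[OF vw(1)]]
        permutes_in_image[OF assms(1)] by auto
  next
    assume "adj \<Omega> (g v) (g w)"
    then obtain b where b: "b \<in> \<Omega>" "g w = nb (g v) b"
      by (auto simp: adj_def)
    then obtain a where a: "a \<in> \<Omega>" "b = s v a"
      using bij_betw_imp_surj_on[OF assms(2)[OF vw(1)]] by auto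
    then have "g w = g (nb v a)"
      using b assms(3) vw by auto
    then have "w = nb v a"
      using permutes_inj[OF assms(1)] by (auto dest: injD)
    then show "adj \<Omega> v w"
      using a vw adj_nb by auto
  qed
  then show ?thesis
    using assms(1) unfolding Aut_iff by blast
qed

text \<open>Walking along \<open>z\<close> moves the image along one edge per letter, and a step
  along an edge can only append or delete a last letter. So at most the last \<open>length z\<close>
  letters of \<open>g p\<close> are lost.\<close>

lemma Aut_length:
  assumes g: "g \<in> Aut \<Omega>" and "p @ z \<in> verts \<Omega>"
  shows "length (g (p @ z)) \<le> length (g p) + length z
    \<and> length (g p) \<le> length (g (p @ z)) + length z
    \<and> take (length (g p) - length z) (g (p @ z)) = take (length (g p) - length z) (g p)"
  using assms(2)
proof (induction z rule: rev_induct)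
  case (snoc a z)
  then have pz: "p @ z \<in> verts \<Omega>" "a \<in> \<Omega>" and "nb (p @ z) a = p @ z @ [a]"
    using snoc_verts[of "p @ z" a \<Omega>] by (auto simp: nb_def)
  then obtain b where b: "g (p @ z @ [a]) = nb (g (p @ z)) b"
    using sigma_in_nb[OF g pz] by metis
  note IH = snoc.IH[OF pz(1)]
  have t: "take (length (g p) - Suc (length z)) (nb (g (p @ z)) b)
      = take (length (g p) - Suc (length z)) (g p)"
  proof (cases "length (g p) - Suc (length z) = 0")
    case False
    have "take (length (g p) - Suc (length z)) (g (p @ z)) = take (length (g p) - Suc (length z)) (g p)"
      using arg_cong[OF conjunct2[OF conjunct2[OF IH]], of "take (length (g p) - Suc (length z))"]
      by (simp add: min_def split: if_splits)
    moreover have "length (g p) - Suc (length z) < length (g (p @ z))"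
      using IH False by linarith
    ultimately show ?thesis
      by (simp add: take_nb)
  qed simp
  show ?case
    using IH t length_nb[of "g (p @ z)" b] by (auto simp: b)
qed simp

lemma Aut_length_Nil:
  assumes "g \<in> Aut \<Omega>" "v \<in> verts \<Omega>"
  shows "length (g v) \<le> length (g []) + length v" "length (g []) \<le> length (g v) + length v"
  using Aut_length[OF assms(1), of "[]" v] assms(2) by auto

lemma Aut_parity:
  assumes g: "g \<in> Aut \<Omega>" and "v \<in> verts \<Omega>"
  shows "even (length (g v)) \<longleftrightarrow> (even (length v) \<longleftrightarrow> even (length (g [])))"
  using assms(2)
proof (induction v rule: rev_induct)
  case (snoc a v)
  then have v: "v \<in> verts \<Omega>" "a \<in> \<Omega>" and "nb v a = v @ [a]"
    by (auto simp: nb_def snoc_verts)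
  then obtain b where "g (v @ [a]) = nb (g v) b"
    using sigma_in_nb[OF g v] by metis
  then show ?case
    using snoc.IH[OF v(1)] by (auto simp: even_length_nb)
qed simp

text \<open>An automorphism maps the half-tree behind an edge onto the half-tree behind the image
  edge. Here both edges point away from the root, so the image words keep the prefix.\<close>

lemma Aut_extend:
  assumes g: "g \<in> Aut \<Omega>" and "v @ e # w \<in> verts \<Omega>" "g (v @ [e]) = g v @ [c]"
  shows "\<exists>w'. g (v @ e # w) = g v @ c # w'"
proof -
  \<comment> \<open>The induction also records that the last edge of the path is mapped to an edge
    pointing away from the root. The next image cannot return to \<open>g u'\<close>, by
    injectivity, so it must append a letter.\<close>
  have "\<exists>u' e' w'. v @ e # w = u' @ [e'] \<and> g (u' @ [e']) = g u' @ [last (g (u' @ [e']))]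
      \<and> g (u' @ [e']) = g v @ c # w'"
    using assms(2)
  proof (induction w rule: rev_induct)
    case Nil
    then show ?case
      using assms(3) by (intro exI[of _ v] exI[of _ e] exI[of _ "[]"]) auto
  next
    case (snoc f w)
    have w: "v @ e # w \<in> verts \<Omega>"
      using append_vertsD[of "v @ e # w" "[f]"] snoc.prems by auto
    then obtain u e' w' where IH: "v @ e # w = u @ [e']" "g (u @ [e']) = g u @ [last (g (u @ [e']))]"
        "g (u @ [e']) = g v @ c # w'"
      using snoc.IH by blast
    define b where "b = sigma \<Omega> g (u @ [e']) f"
    have x: "(u @ [e']) @ [f] \<in> verts \<Omega>"
      using snoc.prems IH(1) by (metis append_Cons append_assoc)
    then have f: "u @ [e'] \<in> verts \<Omega>" "f \<in> \<Omega>" "nb (u @ [e']) f = u @ [e', f]"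
      using snoc_verts[of "u @ [e']" f \<Omega>] by (auto simp: nb_def)
    have b: "g (u @ [e', f]) = nb (g (u @ [e'])) b"
      using sigma_in_nb(2)[OF g f(1,2)] f(3) by (simp add: b_def)
    have "g (u @ [e', f]) \<noteq> g u"
      using Aut_inj[OF g] by auto
    then have "b \<noteq> last (g (u @ [e']))"
      using b IH(2) by (metis nb_snoc)
    then have "g (u @ [e', f]) = g (u @ [e']) @ [b]"
      using b IH(2) by (auto simp: nb_def)
    moreover have "v @ e # w @ [f] = (u @ [e']) @ [f]"
      using IH(1) by (metis append_Cons append_assoc)
    ultimately show ?case
      using IH(3) by (intro exI[of _ "u @ [e']"] exI[of _ f] exI[of _ "w' @ [b]"]) auto
  qed
  then show ?thesis
    by metis
qed

section \<open>Translations and extensions of local permutations\<close>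

lemma group_perm_grp:
  assumes "id \<in> H" "\<And>g h. g \<in> H \<Longrightarrow> h \<in> H \<Longrightarrow> g \<circ> h \<in> H" "\<And>g. g \<in> H \<Longrightarrow> ginv g \<in> H"
    "\<And>g. g \<in> H \<Longrightarrow> bij g"
  shows "group (perm_grp H)"
proof (rule groupI)
  fix g assume "g \<in> carrier (perm_grp H)"
  then show "\<exists>y\<in>carrier (perm_grp H). y \<otimes>\<^bsub>perm_grp H\<^esub> g = \<one>\<^bsub>perm_grp H\<^esub>"
    using assms(3,4) by (intro bexI[of _ "ginv g"]) (auto simp: perm_grp_def bij_is_inj)
qed (use assms in \<open>auto simp: perm_grp_def\<close>)

lemma perm_grp_simps [simp]:
  "carrier (perm_grp H) = H" "g \<otimes>\<^bsub>perm_grp H\<^esub> h = g \<circ> h" "\<one>\<^bsub>perm_grp H\<^esub> = id"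
  by (auto simp: perm_grp_def)

lemma perm_grp_inv:
  assumes "group (perm_grp H)" "g \<in> H" "ginv g \<in> H" "bij g"
  shows "m_inv (perm_grp H) g = ginv g"
  using assms by (intro group.inv_equality) (auto simp: bij_is_inj)

text \<open>Left multiplication by the involution \<open>a\<close> in the free product. It commutes
  with the right multiplications \<open>nb\<close>, hence preserves all colours, and it is extended
  by the identity as \<open>Aut\<close> requires.\<close>

definition lmul :: "'a set \<Rightarrow> 'a \<Rightarrow> 'a list \<Rightarrow> 'a list" where
  "lmul \<Omega> a w = (if w \<in> verts \<Omega> \<and> a \<in> \<Omega> then if w \<noteq> [] \<and> hd w = a then tl w else a # w else w)"

lemma lmul_verts: "v \<in> verts \<Omega> \<Longrightarrow> lmul \<Omega> a v \<in> verts \<Omega>"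
  by (cases v) (auto simp: lmul_def Cons_verts)

lemma lmul_lmul [simp]: "lmul \<Omega> a (lmul \<Omega> a v) = v"
  by (cases v) (auto simp: lmul_def Cons_verts)

lemma lmul_nb:
  assumes "v \<in> verts \<Omega>" "b \<in> \<Omega>"
  shows "lmul \<Omega> a (nb v b) = nb (lmul \<Omega> a v) b"
proof (cases v rule: rev_cases)
  case Nil
  then show ?thesis
    using assms by (auto simp: lmul_def nb_def)
next
  case (snoc u c)
  show ?thesis
  proof (cases u)
    case Nil
    then show ?thesis
      using assms snoc by (auto simp: lmul_def nb_def Cons_verts)
  next
    case (Cons d u')
    have "nb v b \<in> verts \<Omega>" "u \<in> verts \<Omega>"
      using assms nb_verts snoc snoc_verts by metis+
    then show ?thesis
      using assms snoc Cons by (auto simp: lmul_def nb_def)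
  qed
qed

lemma lmul_permutes: "lmul \<Omega> a permutes verts \<Omega>"
proof (rule bij_imp_permutes)
  show "bij_betw (lmul \<Omega> a) (verts \<Omega>) (verts \<Omega>)"
    by (rule bij_betw_byWitness[where f' = "lmul \<Omega> a"]) (auto simp: lmul_verts)
qed (auto simp: lmul_def)

lemma lmul_Aut: "lmul \<Omega> a \<in> Aut \<Omega>"
  by (rule AutI[OF lmul_permutes, of _ "\<lambda>_ x. x"]) (auto simp: lmul_nb bij_betw_def)

lemma sigma_lmul: "v \<in> verts \<Omega> \<Longrightarrow> sigma \<Omega> (lmul \<Omega> a) v = (\<lambda>x\<in>\<Omega>. x)"
  by (rule sigma_eqI) (auto simp: lmul_nb lmul_Aut)

lemma ginv_lmul: "ginv (lmul \<Omega> a) = lmul \<Omega> a"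
  by (rule inv_equality) auto

text \<open>Left multiplication by the word \<open>x\<close>: for a vertex \<open>x\<close>, the
  colour-preserving automorphism that carries the root to \<open>x\<close>.\<close>

definition transl :: "'a set \<Rightarrow> 'a list \<Rightarrow> 'a list \<Rightarrow> 'a list" where
  "transl \<Omega> x = foldr (lmul \<Omega>) x"

lemma transl_simps [simp]: "transl \<Omega> [] = id" "transl \<Omega> (a # x) = lmul \<Omega> a \<circ> transl \<Omega> x"
  by (auto simp: transl_def)

lemma transl_Aut: "transl \<Omega> x \<in> Aut \<Omega>"
  by (induction x) (simp_all only: transl_simps Aut_id Aut_comp lmul_Aut)

lemma transl_Nil: "x \<in> verts \<Omega> \<Longrightarrow> transl \<Omega> x [] = x"
  by (induction x) (auto simp: Cons_verts lmul_def)

lemma sigma_transl: "v \<in> verts \<Omega> \<Longrightarrow> sigma \<Omega> (transl \<Omega> x) v = (\<lambda>x\<in>\<Omega>. x)"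
proof (induction x)
  case (Cons a x)
  then have "transl \<Omega> x v \<in> verts \<Omega>"
    by (simp add: Aut_in_verts[OF transl_Aut])
  then have "sigma \<Omega> (transl \<Omega> (a # x)) v = compose \<Omega> (\<lambda>x\<in>\<Omega>. x) (\<lambda>x\<in>\<Omega>. x)"
    using Cons sigma_comp[OF lmul_Aut transl_Aut Cons.prems, of a x] by (simp only: transl_simps sigma_lmul)
  also have "\<dots> = (\<lambda>x\<in>\<Omega>. x)"
    by (auto simp: compose_def)
  finally show ?case .
qed (simp add: sigma_id)

definition locperm :: "'a set \<Rightarrow> ('a \<Rightarrow> 'a) set \<Rightarrow> ('a \<Rightarrow> 'a) \<Rightarrow> 'a list \<Rightarrow> 'a list" where
  "locperm \<Omega> F \<pi> w = (if w \<in> verts \<Omega> \<and> w \<noteq> []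
      then \<pi> (hd w) # map (THE f. f \<in> F \<and> f (hd w) = \<pi> (hd w)) (tl w) else w)"

section \<open>Calculation in the symmetric group of the colours\<close>

lemma BijGroup_simps:
  "carrier (BijGroup \<Omega>) = Bij \<Omega>" "\<one>\<^bsub>BijGroup \<Omega>\<^esub> = (\<lambda>x\<in>\<Omega>. x)"
  "f \<in> Bij \<Omega> \<Longrightarrow> g \<in> Bij \<Omega> \<Longrightarrow> f \<otimes>\<^bsub>BijGroup \<Omega>\<^esub> g = compose \<Omega> f g"
  by (auto simp: BijGroup_def)

lemma Bij_eqI: "f \<in> Bij \<Omega> \<Longrightarrow> g \<in> Bij \<Omega> \<Longrightarrow> (\<And>x. x \<in> \<Omega> \<Longrightarrow> f x = g x) \<Longrightarrow> f = g"
  by (meson Bij_imp_extensional extensionalityI)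

lemma Bij_mem: "f \<in> Bij \<Omega> \<Longrightarrow> x \<in> \<Omega> \<Longrightarrow> f x \<in> \<Omega>"
  using Bij_imp_funcset by blast

lemma Bij_inj: "f \<in> Bij \<Omega> \<Longrightarrow> x \<in> \<Omega> \<Longrightarrow> y \<in> \<Omega> \<Longrightarrow> f x = f y \<longleftrightarrow> x = y"
  by (auto simp: Bij_def bij_betw_def dest: inj_onD)

lemma Bij_m_inv:
  assumes "f \<in> Bij \<Omega>"
  shows "m_inv (BijGroup \<Omega>) f \<in> Bij \<Omega>"
    "x \<in> \<Omega> \<Longrightarrow> m_inv (BijGroup \<Omega>) f (f x) = x" "x \<in> \<Omega> \<Longrightarrow> f (m_inv (BijGroup \<Omega>) f x) = x"
proof -
  show "m_inv (BijGroup \<Omega>) f \<in> Bij \<Omega>"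
    using group.inv_closed[OF group_BijGroup, of f] assms by (simp add: BijGroup_simps)
  show "x \<in> \<Omega> \<Longrightarrow> m_inv (BijGroup \<Omega>) f (f x) = x" "x \<in> \<Omega> \<Longrightarrow> f (m_inv (BijGroup \<Omega>) f x) = x"
    using assms by (auto simp: inv_BijGroup Bij_mem Bij_def bij_betw_def f_inv_into_f inv_into_f_f)
qed

lemma Bij_compose_m_inv:
  assumes "f \<in> Bij \<Omega>"
  shows "compose \<Omega> f (m_inv (BijGroup \<Omega>) f) = (\<lambda>x\<in>\<Omega>. x)"
    "compose \<Omega> (m_inv (BijGroup \<Omega>) f) f = (\<lambda>x\<in>\<Omega>. x)"
  using assms Bij_m_inv[OF assms] by (auto intro!: Bij_eqI compose_Bij id_Bij simp: compose_eq)

locale local_action =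
  fixes \<Omega> :: "'a set" and F F' :: "('a \<Rightarrow> 'a) set"
  assumes finite_\<Omega>: "finite \<Omega>" and card_\<Omega>: "card \<Omega> \<ge> 3"
    and F_subgroup: "subgroup F (BijGroup \<Omega>)" and F'_subgroup: "subgroup F' (BijGroup \<Omega>)"
    and F_le: "F \<subseteq> F'"
    and simply_transitive: "\<forall>a\<in>\<Omega>. \<forall>b\<in>\<Omega>. \<exists>!f. f \<in> F \<and> f a = b"
begin

abbreviation "V \<equiv> verts \<Omega>"

abbreviation "G \<equiv> G2 \<Omega> F F'"

abbreviation "H \<equiv> star \<Omega> (G2 \<Omega> F F')"

abbreviation "L \<equiv> lmul \<Omega>"

abbreviation "T \<equiv> transl \<Omega>"

abbreviation "K \<equiv> locperm \<Omega> F"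

abbreviation "idO \<equiv> (\<lambda>x\<in>\<Omega>. x)"

abbreviation binv where "binv \<equiv> m_inv (BijGroup \<Omega>)"

definition tr :: "'a \<Rightarrow> 'a \<Rightarrow> 'a \<Rightarrow> 'a" where
  "tr a b = (THE f. f \<in> F \<and> f a = b)"

definition sing :: "('a list \<Rightarrow> 'a list) \<Rightarrow> 'a list set" where
  "sing g = {v \<in> V. sigma \<Omega> g v \<notin> F}"

lemma F_Bij: "f \<in> F \<Longrightarrow> f \<in> Bij \<Omega>" and F'_Bij: "f \<in> F' \<Longrightarrow> f \<in> Bij \<Omega>"
  using subgroup.subset[OF F_subgroup] subgroup.subset[OF F'_subgroup] by (auto simp: BijGroup_simps)

lemma F_id: "idO \<in> F" and F'_id: "idO \<in> F'"
  using subgroup.one_closed[OF F_subgroup] subgroup.one_closed[OF F'_subgroup]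
  by (auto simp: BijGroup_simps)

lemma F_compose: "f \<in> F \<Longrightarrow> g \<in> F \<Longrightarrow> compose \<Omega> f g \<in> F"
  and F'_compose: "f \<in> F' \<Longrightarrow> g \<in> F' \<Longrightarrow> compose \<Omega> f g \<in> F'"
  using subgroup.m_closed[OF F_subgroup, of f g] subgroup.m_closed[OF F'_subgroup, of f g]
  by (auto simp: BijGroup_simps F_Bij F'_Bij)

lemma F_inv: "f \<in> F \<Longrightarrow> binv f \<in> F" and F'_inv: "f \<in> F' \<Longrightarrow> binv f \<in> F'"
  using subgroup.m_inv_closed[OF F_subgroup] subgroup.m_inv_closed[OF F'_subgroup] by auto

lemma F_eq: "f \<in> F \<Longrightarrow> g \<in> F \<Longrightarrow> a \<in> \<Omega> \<Longrightarrow> f a = g a \<Longrightarrow> f = g"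
  using simply_transitive Bij_mem[OF F_Bij] by metis

lemma tr_F: "a \<in> \<Omega> \<Longrightarrow> b \<in> \<Omega> \<Longrightarrow> tr a b \<in> F" and tr_eq: "a \<in> \<Omega> \<Longrightarrow> b \<in> \<Omega> \<Longrightarrow> tr a b a = b"
  using theI'[of "\<lambda>f. f \<in> F \<and> f a = b"] simply_transitive by (auto simp: tr_def)

lemma tr_unique: "f \<in> F \<Longrightarrow> a \<in> \<Omega> \<Longrightarrow> tr a (f a) = f"
  using F_eq[OF tr_F] tr_eq Bij_mem[OF F_Bij] by metis

section \<open>Extending a permutation of the colours from the root to the tree\<close>

lemma K_Nil [simp]: "K \<pi> [] = []"
  by (simp add: locperm_def)

lemma K_Cons: "a # u \<in> V \<Longrightarrow> K \<pi> (a # u) = \<pi> a # map (tr a (\<pi> a)) u"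
  by (simp add: locperm_def tr_def)

lemma map_F_verts:
  assumes "f \<in> Bij \<Omega>" "w \<in> V"
  shows "map f w \<in> V"
  using assms(2)
proof (induction w)
  case (Cons a w)
  then show ?case
    using Bij_inj[OF assms(1), of "hd w" a] Bij_mem[OF assms(1)] verts_subset[of w \<Omega>]
    by (cases w) (auto simp: Cons_verts)
qed simp

lemma K_verts:
  assumes "\<pi> \<in> Bij \<Omega>" "w \<in> V"
  shows "K \<pi> w \<in> V"
proof (cases w)
  case (Cons a u)
  then have a: "a \<in> \<Omega>" "\<pi> a \<in> \<Omega>" "u \<in> V" "u \<noteq> [] \<longrightarrow> hd u \<noteq> a \<and> hd u \<in> \<Omega>"
    using assms Bij_mem[OF assms(1)] verts_subset[of u \<Omega>] by (auto simp: Cons_verts)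
  note f = F_Bij[OF tr_F[OF a(1,2)]]
  show ?thesis
    using a Cons assms map_F_verts[OF f a(3)] Bij_inj[OF f, of "hd u" a] tr_eq[OF a(1,2)]
    by (auto simp: K_Cons Cons_verts hd_map)
qed (use assms in simp)

text \<open>The choice of the element of \<open>F\<close> is a cocycle: by uniqueness, the one
  carrying \<open>a\<close> to \<open>\<pi> (\<rho> a)\<close> is the product of those for the steps
  from \<open>a\<close> to \<open>\<rho> a\<close> and from there to
  \<open>\<pi> (\<rho> a)\<close>.\<close>

lemma K_compose:
  assumes "\<pi> \<in> Bij \<Omega>" "\<rho> \<in> Bij \<Omega>"
  shows "K (compose \<Omega> \<pi> \<rho>) = K \<pi> \<circ> K \<rho>"
proof
  fix w
  consider "w \<notin> V" | "w = []" | a u where "w = a # u" "w \<in> V"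
    by (cases w) auto
  then show "K (compose \<Omega> \<pi> \<rho>) w = (K \<pi> \<circ> K \<rho>) w"
  proof cases
    case 3
    then have a: "a \<in> \<Omega>" "\<rho> a \<in> \<Omega>" "\<pi> (\<rho> a) \<in> \<Omega>" "set u \<subseteq> \<Omega>"
      using assms verts_subset[of w \<Omega>] by (auto simp: Cons_verts Bij_mem)
    define f g where "f = tr a (\<rho> a)" and "g = tr (\<rho> a) (\<pi> (\<rho> a))"
    have fg: "f \<in> F" "g \<in> F" "f a = \<rho> a" "g (\<rho> a) = \<pi> (\<rho> a)"
      using a by (auto simp: f_def g_def tr_F tr_eq)
    have "tr a (compose \<Omega> \<pi> \<rho> a) = compose \<Omega> g f"
      using tr_unique[OF F_compose[OF fg(2,1)] a(1)] a fg by (simp add: compose_eq)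
    moreover have "\<rho> a # map f u \<in> V"
      using K_verts[OF assms(2), of "a # u"] 3 by (simp add: K_Cons f_def)
    ultimately show ?thesis
      using 3 a by (auto simp: K_Cons compose_eq simp flip: f_def g_def)
  qed (auto simp: locperm_def)
qed

lemma K_id: "K idO = id"
proof
  fix w show "K idO w = id w"
  proof (cases "w \<in> V \<and> w \<noteq> []")
    case True
    then obtain a u where w: "w = a # u" "a \<in> \<Omega>" "set u \<subseteq> \<Omega>"
      using verts_subset[of w \<Omega>] by (cases w) auto
    have "tr a a = idO"
      using tr_unique[OF F_id w(2)] w by simp
    then show ?thesis
      using True w by (auto simp: K_Cons intro!: map_idI)
  qed (auto simp: locperm_def)
qed

lemma K_inv: "\<pi> \<in> Bij \<Omega> \<Longrightarrow> K (binv \<pi>) \<circ> K \<pi> = id" "\<pi> \<in> Bij \<Omega> \<Longrightarrow> K \<pi> \<circ> K (binv \<pi>) = id"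
  by (simp_all add: K_id Bij_m_inv Bij_compose_m_inv flip: K_compose)

lemma K_permutes:
  assumes "\<pi> \<in> Bij \<Omega>"
  shows "K \<pi> permutes V"
proof (rule bij_imp_permutes)
  show "bij_betw (K \<pi>) V V"
    using K_inv[OF assms, THEN fun_cong] K_verts[OF assms] K_verts[OF Bij_m_inv(1)[OF assms]]
    by (intro bij_betw_byWitness[where f' = "K (binv \<pi>)"]) auto
qed (auto simp: locperm_def)

text \<open>Below the root the word is relabelled by a single injective \<open>f\<close>, so
  appending and cancelling last letters commute with it. The condition \<open>f b = \<pi> b\<close>
  is what makes this also true for the step from \<open>[b]\<close> back to the root.\<close>

lemma K_nb:
  assumes "\<pi> \<in> Bij \<Omega>" "v \<in> V" "c \<in> \<Omega>"
  shows "K \<pi> (nb v c) = nb (K \<pi> v) ((if v = [] then \<pi> else tr (hd v) (\<pi> (hd v))) c)"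
proof (cases v)
  case Nil
  then show ?thesis
    using assms by (simp add: nb_def K_Cons)
next
  case (Cons b w)
  then have b: "b \<in> \<Omega>" "\<pi> b \<in> \<Omega>" "set w \<subseteq> \<Omega>"
    using assms verts_subset[of v \<Omega>] by (auto simp: Bij_mem)
  define f where "f = tr b (\<pi> b)"
  have f: "f \<in> Bij \<Omega>" "f b = \<pi> b"
    using b by (auto simp: f_def tr_eq tr_F F_Bij)
  have n: "nb v c \<in> V"
    by (rule nb_verts[OF assms(2,3)])
  have Kv: "K \<pi> (b # u) = f b # map f u" if "b # u \<in> V" for u
    using K_Cons[OF that] by (simp add: f(2) flip: f_def)
  have inj: "f d = f c \<longleftrightarrow> d = c" if "d \<in> \<Omega>" for d
    using Bij_inj[OF f(1) that assms(3)] .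
  have "K \<pi> (nb v c) = nb (K \<pi> v) (f c)"
  proof (cases w rule: rev_cases)
    case Nil
    then have v: "v = [b]"
      using Cons by simp
    show ?thesis
      using n assms(2) Kv[of "[]"] Kv[of "[c]"] inj[of b] b(1) by (cases "b = c") (auto simp: v nb_def)
  next
    case (snoc u d)
    then have v: "v = b # u @ [d]" and d: "d \<in> \<Omega>"
      using Cons b by auto
    show ?thesis
    proof (cases "d = c")
      case True
      then have "nb v c = b # u" "b # u \<in> V"
        using n by (auto simp: v nb_def)
      then show ?thesis
        using Kv[of u] Kv[of "u @ [d]"] assms(2) True by (simp add: v nb_def)
    next
      case False
      then have "nb v c = b # u @ [d, c]"
        by (auto simp: v nb_def)
      then show ?thesis
        using Kv[of "u @ [d, c]"] Kv[of "u @ [d]"] assms(2) False n inj[OF d] by (simp add: v nb_def)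
    qed
  qed
  then show ?thesis
    using Cons by (simp add: f_def)
qed

lemma K_Aut:
  assumes "\<pi> \<in> Bij \<Omega>"
  shows "K \<pi> \<in> Aut \<Omega>"
proof (rule AutI[OF K_permutes[OF assms], of "\<lambda>v. if v = [] then \<pi> else tr (hd v) (\<pi> (hd v))"])
  fix v assume "v \<in> V"
  then have "v \<noteq> [] \<Longrightarrow> hd v \<in> \<Omega>"
    using verts_subset[of v \<Omega>] by (cases v) auto
  then show "bij_betw (if v = [] then \<pi> else tr (hd v) (\<pi> (hd v))) \<Omega> \<Omega>"
    using assms F_Bij[OF tr_F[of "hd v" "\<pi> (hd v)"]] Bij_mem[OF assms] by (auto simp: Bij_def)
qed (use K_nb[OF assms] in auto)

lemma sigma_K:
  assumes "\<pi> \<in> Bij \<Omega>" "v \<in> V"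
  shows "sigma \<Omega> (K \<pi>) v = (if v = [] then \<pi> else tr (hd v) (\<pi> (hd v)))"
proof (rule sigma_eqI[OF K_Aut[OF assms(1)] assms(2)])
  have "v \<noteq> [] \<Longrightarrow> hd v \<in> \<Omega>"
    using verts_subset[of v \<Omega>] assms by (cases v) auto
  then show "(if v = [] then \<pi> else tr (hd v) (\<pi> (hd v))) \<in> extensional \<Omega>"
    using assms F_Bij[OF tr_F[of "hd v" "\<pi> (hd v)"]] Bij_mem[OF assms(1)] by (auto simp: Bij_def)
qed (use K_nb[OF assms] in auto)

lemma sigma_K_F:
  assumes "\<pi> \<in> Bij \<Omega>" "v \<in> V" "v \<noteq> []"
  shows "sigma \<Omega> (K \<pi>) v \<in> F"
  using assms verts_subset[of v \<Omega>] tr_F[of "hd v" "\<pi> (hd v)"] Bij_mem[OF assms(1), of "hd v"]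
  by (cases v) (simp_all add: sigma_K)

lemma K_F:
  assumes "f \<in> F" "w \<in> V"
  shows "K f w = map f w"
  using assms by (cases w) (auto simp: K_Cons Cons_verts tr_unique)

text \<open>Far from the root, the simply transitive group \<open>F\<close> leaves no freedom: the local permutation
  at a vertex is determined by its value on the edge towards the root.\<close>

lemma Aut_eqI:
  assumes g: "g \<in> Aut \<Omega>" and h: "h \<in> Aut \<Omega>"
    and near: "\<And>v. v \<in> V \<Longrightarrow> length v \<le> Suc m \<Longrightarrow> g v = h v"
    and far: "\<And>v. v \<in> V \<Longrightarrow> length v > m \<Longrightarrow> sigma \<Omega> g v \<in> F \<and> sigma \<Omega> h v \<in> F"
  shows "g = h"
proof
  fix v
  show "g v = h v"
  proof (cases "v \<in> V")
    case True
    then show ?thesis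
    proof (induction v rule: length_induct)
      case (1 v)
      show ?case
      proof (cases "length v \<le> Suc m")
        case False
        then obtain w a where wa: "v = w @ [a]" "length w > m"
          by (cases v rule: rev_cases) auto
        then obtain u b where ub: "w = u @ [b]"
          by (cases w rule: rev_cases) auto
        have V: "w \<in> V" "a \<in> \<Omega>" "u \<in> V" "b \<in> \<Omega>" "last w \<noteq> a"
          using "1.prems" ub snoc_verts[of u b \<Omega>] snoc_verts[of w a \<Omega>] unfolding wa(1) by auto
        have IH: "g w = h w" "g u = h u"
          using "1.IH" wa ub V by auto
        have "sigma \<Omega> g w b = sigma \<Omega> h w b"
          using sigma_eq[OF g V(1,4)] sigma_in_nb(2)[OF h V(1,4)] ub IH by simp
        then have "sigma \<Omega> g w = sigma \<Omega> h w"
          using F_eq far[OF V(1) wa(2)] V(4) by blast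
        moreover have "nb w a = v"
          using V wa by (auto simp: nb_def)
        ultimately show ?thesis
          using sigma_in_nb(2)[OF g V(1,2)] sigma_in_nb(2)[OF h V(1,2)] IH by simp
      qed (use near "1.prems" in auto)
    qed
  next
    case False
    then show ?thesis
      using Aut_permutes[OF g] Aut_permutes[OF h] by (simp add: permutes_not_in)
  qed
qed

lemma Aut_eqI_root:
  assumes g: "g \<in> Aut \<Omega>" and h: "h \<in> Aut \<Omega>"
    and "g [] = h []" "sigma \<Omega> g [] = sigma \<Omega> h []"
    and far: "\<And>v. v \<in> V \<Longrightarrow> v \<noteq> [] \<Longrightarrow> sigma \<Omega> g v \<in> F \<and> sigma \<Omega> h v \<in> F"
  shows "g = h"
proof (rule Aut_eqI[OF g h, of 0])
  fix v assume v: "v \<in> V" "length v \<le> Suc 0"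
  show "g v = h v"
  proof (cases v)
    case (Cons a w)
    then have "v = nb [] a" "a \<in> \<Omega>"
      using v by (auto simp: nb_def)
    then show ?thesis
      using sigma_in_nb(2)[OF g, of "[]" a] sigma_in_nb(2)[OF h, of "[]" a] assms by simp
  qed (use assms in simp)
qed (use far in auto)

section \<open>The group G(F,F'), its type-preserving subgroup, and singularities\<close>

lemma G_iff: "g \<in> G \<longleftrightarrow> g \<in> Aut \<Omega> \<and> finite (sing g) \<and> (\<forall>v\<in>V. sigma \<Omega> g v \<in> F')"
  by (auto simp: G2_def Gfin_def Ufin_def sing_def)

text \<open>Every edge changes the parity of the length, also after applying \<open>g\<close>, so
  preserving the type of the root already means preserving all types.\<close>

lemma H_iff: "g \<in> H \<longleftrightarrow> g \<in> G \<and> even (length (g []))"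
proof
  assume "g \<in> H"
  then show "g \<in> G \<and> even (length (g []))"
    using Nil_verts[of \<Omega>] unfolding star_def by fastforce
next
  assume "g \<in> G \<and> even (length (g []))"
  then show "g \<in> H"
    using Aut_parity[of g \<Omega>] unfolding star_def G_iff by blast
qed

lemma sing_comp:
  assumes "g \<in> Aut \<Omega>" "h \<in> Aut \<Omega>"
  shows "sing (g \<circ> h) \<subseteq> sing h \<union> ginv h ` sing g"
proof
  fix v assume "v \<in> sing (g \<circ> h)"
  then have v: "v \<in> V" "sigma \<Omega> (g \<circ> h) v \<notin> F"
    by (auto simp: sing_def)
  then have "sigma \<Omega> h v \<in> F \<longrightarrow> sigma \<Omega> g (h v) \<notin> F"
    using F_compose unfolding sigma_comp[OF assms v(1)] by blast
  then have "v \<in> sing h \<or> h v \<in> sing g"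
    using v Aut_in_verts[OF assms(2), of v] by (auto simp: sing_def)
  moreover have "v = ginv h (h v)"
    using Aut_ginv(1)[OF assms(2)] by simp
  ultimately show "v \<in> sing h \<union> ginv h ` sing g"
    by blast
qed

lemma sing_ginv:
  assumes "g \<in> Aut \<Omega>"
  shows "sing (ginv g) \<subseteq> g ` sing g"
proof
  fix v assume v: "v \<in> sing (ginv g)"
  define u where "u = ginv g v"
  have u: "u \<in> V" "v = g u"
    using v Aut_in_verts[OF Aut_inverse[OF assms], of v] Aut_ginv(2)[OF assms]
    by (auto simp: u_def sing_def)
  then have "sigma \<Omega> g u \<notin> F"
    using v F_inv by (auto simp: sing_def u(2) sigma_ginv[OF finite_\<Omega> assms u(1)])
  then show "v \<in> g ` sing g"
    unfolding u(2) using u(1) by (intro imageI) (simp add: sing_def)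
qed

lemma G_Aut: "g \<in> G \<Longrightarrow> g \<in> Aut \<Omega>" and H_Aut: "g \<in> H \<Longrightarrow> g \<in> Aut \<Omega>"
  by (auto simp: G_iff H_iff)

lemma G_comp: "g \<in> G \<Longrightarrow> h \<in> G \<Longrightarrow> g \<circ> h \<in> G"
  using finite_subset[OF sing_comp[of g h]]
  by (auto simp: G_iff Aut_comp sigma_comp Aut_in_verts F'_compose)

lemma G_ginv:
  assumes "g \<in> G"
  shows "ginv g \<in> G"
proof -
  have g: "g \<in> Aut \<Omega>" "finite (sing g)" "\<And>v. v \<in> V \<Longrightarrow> sigma \<Omega> g v \<in> F'"
    using assms by (auto simp: G_iff)
  have "sigma \<Omega> (ginv g) v \<in> F'" if "v \<in> V" for v
  proof -
    have "ginv g v \<in> V" "g (ginv g v) = v"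
      using that Aut_ginv(2)[OF g(1)] Aut_in_verts[OF Aut_inverse[OF g(1)]] by auto
    then show ?thesis
      using sigma_ginv[OF finite_\<Omega> g(1), of "ginv g v"] g(3) F'_inv by auto
  qed
  then show ?thesis
    using finite_subset[OF sing_ginv[OF g(1)]] g Aut_inverse by (auto simp: G_iff)
qed

lemma sing_empty [simp]: "sing id = {}" "sing (L a) = {}" "sing (T x) = {}"
  by (simp_all add: sing_def sigma_id sigma_lmul sigma_transl F_id cong: conj_cong)

lemma G_id: "id \<in> G" and G_L: "L a \<in> G" and G_T: "T x \<in> G"
  by (simp_all add: G_iff sigma_id sigma_lmul sigma_transl Aut_id lmul_Aut transl_Aut F'_id)

lemma sing_K: "\<pi> \<in> Bij \<Omega> \<Longrightarrow> sing (K \<pi>) \<subseteq> {[]}"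
  using sigma_K_F by (auto simp: sing_def)

lemma H_K: "\<pi> \<in> F' \<Longrightarrow> K \<pi> \<in> H"
  using sigma_K_F[of \<pi>] sigma_K[of \<pi> "[]"] F_le finite_subset[OF sing_K[of \<pi>]]
  by (auto simp: H_iff G_iff K_Aut F'_Bij intro: F'_Bij) (metis Nil_verts subsetD)

lemma H_comp: "g \<in> H \<Longrightarrow> h \<in> H \<Longrightarrow> g \<circ> h \<in> H"
  using Aut_parity[of g \<Omega> "h []"] Aut_in_verts[of h \<Omega> "[]"] G_Aut[of g] G_Aut[of h]
  by (simp add: H_iff G_comp)

lemma length_ginv: "g \<in> Aut \<Omega> \<Longrightarrow> length (ginv g []) = length (g [])"
  using Aut_length_Nil(2)[of "ginv g" \<Omega> "g []"] Aut_length_Nil(2)[of g \<Omega> "ginv g []"]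
  by (simp add: Aut_inverse Aut_in_verts Aut_ginv)

lemma H_ginv: "g \<in> H \<Longrightarrow> ginv g \<in> H"
  by (simp add: H_iff G_ginv length_ginv G_Aut)

lemma H_id: "id \<in> H"
  by (auto simp: H_iff G_id)

lemma group_H: "group (perm_grp H)"
  by (rule group_perm_grp) (auto simp: H_id H_comp H_ginv intro: Aut_bij H_Aut)

lemma inv_H: "g \<in> H \<Longrightarrow> m_inv (perm_grp H) g = ginv g"
  by (rule perm_grp_inv[OF group_H]) (auto simp: H_ginv intro: Aut_bij H_Aut)

text \<open>For a colour \<open>a\<close> the map \<open>L a\<close> swaps the two types and so is
  not in \<open>H\<close>, but the two changes of type cancel. This places copies of
  \<open>F'\<close> at \<open>[a]\<close> inside \<open>H\<close>.\<close>

lemma L_conj_H: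
  assumes "g \<in> H"
  shows "L a \<circ> g \<circ> L a \<in> H"
proof -
  have "L a \<circ> g \<circ> L a \<in> G"
    using assms by (intro G_comp G_L) (auto simp: H_iff)
  moreover have "even (length ((L a \<circ> g \<circ> L a) []))"
    using Aut_parity[OF lmul_Aut, of "g (L a [])" \<Omega> a] Aut_parity[OF H_Aut[OF assms], of "L a []"]
      Aut_in_verts[OF H_Aut[OF assms], of "L a []"] lmul_verts[of "[]" \<Omega> a] assms
    by (simp add: H_iff)
  ultimately show ?thesis
    by (simp add: H_iff)
qed

end

section \<open>Generators of the type-preserving subgroup\<close>

context local_action
begin

lemma finite_Bij: "finite (Bij \<Omega>)"
proof (rule finite_subset)
  show "Bij \<Omega> \<subseteq> PiE \<Omega> (\<lambda>_. \<Omega>)"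
    using Bij_mem Bij_imp_extensional by (auto simp: PiE_def)
qed (simp add: finite_PiE finite_\<Omega>)

lemma finite_F': "finite F'"
  using finite_subset[OF _ finite_Bij] F'_Bij by blast

lemma ginv_comp: "g \<in> Aut \<Omega> \<Longrightarrow> h \<in> Aut \<Omega> \<Longrightarrow> ginv (g \<circ> h) = ginv h \<circ> ginv g"
  by (rule o_inv_distrib[OF Aut_bij Aut_bij])

lemma ginv_K:
  assumes "\<pi> \<in> Bij \<Omega>"
  shows "ginv (K \<pi>) = K (binv \<pi>)"
  using K_inv[OF assms, THEN fun_cong] by (intro inv_equality) simp_all

lemma Aut_cancel: "g \<in> Aut \<Omega> \<Longrightarrow> ginv g \<circ> g = id" "g \<in> Aut \<Omega> \<Longrightarrow> g \<circ> ginv g = id"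
  by (simp_all add: fun_eq_iff Aut_ginv)

lemma sing_comp_empty:
  "g \<in> Aut \<Omega> \<Longrightarrow> h \<in> Aut \<Omega> \<Longrightarrow> sing g = {} \<Longrightarrow> sing h = {} \<Longrightarrow> sing (g \<circ> h) = {}"
  using sing_comp[of g h] by simp

lemma sing_K_F:
  assumes "f \<in> F"
  shows "sing (K f) = {}"
proof -
  have "sigma \<Omega> (K f) [] \<in> F"
    using assms sigma_K[OF F_Bij[OF assms], of "[]"] by simp
  then show ?thesis
    using sing_K[OF F_Bij[OF assms]] by (auto simp: sing_def)
qed

text \<open>The stabiliser of the root in U(F) is thus the copy of \<open>F\<close> given by
  \<open>K\<close>. It is the end point of the folding argument for elements without
  singularities.\<close>

lemma K_root_fixed:
  assumes "g \<in> Aut \<Omega>" "sing g = {}" "g [] = []"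
  shows "g = K (sigma \<Omega> g [])"
proof -
  have s: "sigma \<Omega> g v \<in> F" if "v \<in> V" for v
    using assms(2) that by (auto simp: sing_def)
  have B: "sigma \<Omega> g [] \<in> Bij \<Omega>"
    using F_Bij[OF s[OF Nil_verts]] .
  show ?thesis
    by (rule Aut_eqI_root[OF assms(1) K_Aut[OF B]])
      (use assms(3) s sigma_K_F[OF B] sigma_K[OF B Nil_verts] in auto)
qed

text \<open>\<open>M\<close> is kept abstract because it is used twice: as the subgroup generated by
  the two copies of a generating set of \<open>F'\<close>, and as a nontrivial normal subgroup of
  \<open>H\<close>.\<close>

context
  fixes a :: 'a and M :: "('a list \<Rightarrow> 'a list) set"
  assumes a: "a \<in> \<Omega>"
    and M_comp: "\<And>g h. g \<in> M \<Longrightarrow> h \<in> M \<Longrightarrow> g \<circ> h \<in> M"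
    and M_ginv: "\<And>g. g \<in> M \<Longrightarrow> ginv g \<in> M"
    and M_K: "\<And>\<pi>. \<pi> \<in> F' \<Longrightarrow> K \<pi> \<in> M"
    and M_LK: "\<And>\<pi>. \<pi> \<in> F' \<Longrightarrow> L a \<circ> K \<pi> \<circ> L a \<in> M"
begin

text \<open>Alternately rotating about the adjacent vertices \<open>[]\<close> and \<open>[a]\<close> by elements of \<open>F\<close> folds
  the path from the root to \<open>g []\<close> back to the root.\<close>

lemma M_sing_empty:
  assumes "g \<in> H" "sing g = {}"
  shows "g \<in> M"
  using assms
proof (induction "length (g [])" arbitrary: g rule: less_induct)
  case less
  have g: "g \<in> Aut \<Omega>"
    using H_Aut less.prems(1) .
  have gV: "g [] \<in> V" and even: "even (length (g []))"
    using less.prems(1) Aut_in_verts[OF g, of "[]"] by (simp_all add: H_iff)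
  show ?case
  proof (cases "g [] = []")
    case True
    have "sigma \<Omega> g [] \<in> F'"
      using less.prems(2) F_le by (auto simp: sing_def)
    then show ?thesis
      using K_root_fixed[OF g less.prems(2) True] M_K by metis
  next
    case False
    then obtain b c u where u: "g [] = b # c # u"
      using even by (cases "g []" rule: list.exhaust; cases "tl (g [])") auto
    have bc: "b \<in> \<Omega>" "c \<in> \<Omega>" "set u \<subseteq> \<Omega>"
      using verts_subset[OF gV] u by auto
    \<comment> \<open>\<open>K f\<close> turns the first letter of \<open>g []\<close> into
      \<open>a\<close>, giving \<open>a # f c # map f u\<close>. The map \<open>k\<close> below is a
      rotation about \<open>[a]\<close>: it strips this \<open>a\<close>, turns \<open>f c\<close>
      into \<open>a\<close>, and multiplies by \<open>a\<close> again, so that two letters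
      disappear.\<close>
    define f where "f = tr b a"
    have f: "f \<in> F" "f b = a"
      using tr_F tr_eq bc a by (auto simp: f_def)
    have fc: "f c \<in> \<Omega>"
      using Bij_mem[OF F_Bij[OF f(1)] bc(2)] .
    define h where "h = tr (f c) a"
    have h: "h \<in> F" "h (f c) = a"
      using tr_F tr_eq fc a by (auto simp: h_def)
    define k where "k = L a \<circ> K h \<circ> L a"
    have AK: "K f \<in> Aut \<Omega>" "K h \<in> Aut \<Omega>" "k \<in> Aut \<Omega>"
      using K_Aut F_Bij f(1) h(1) by (auto simp: k_def intro!: Aut_comp lmul_Aut)
    have 1: "K f (g []) = a # f c # map f u"
      using K_F[OF f(1) gV] u f(2) by simp
    moreover have "K f (g []) \<in> V"
      using gV AK(1) Aut_in_verts by blast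
    ultimately have V1: "a # f c # map f u \<in> V" "f c # map f u \<in> V"
      using Cons_verts by metis+
    have V2: "map h (f c # map f u) \<in> V"
      using map_F_verts[OF F_Bij[OF h(1)] V1(2)] .
    have "k (K f (g [])) = L a (map h (f c # map f u))"
      using V1 a K_F[OF h(1) V1(2)] unfolding k_def 1 by (simp add: lmul_def)
    then have 2: "k (K f (g [])) = map h (map f u)"
      using V2 h(2) a by (simp add: lmul_def)
    define g' where "g' = k \<circ> (K f \<circ> g)"
    have kH: "k \<in> H" "K f \<in> H"
      using L_conj_H H_K f(1) h(1) F_le by (auto simp: k_def)
    have "sing k = {}"
      unfolding k_def using AK sing_K_F[OF h(1)]
      by (intro sing_comp_empty Aut_comp lmul_Aut) simp_all
    then have "sing g' = {}"
      unfolding g'_def using AK g less.prems sing_K_F[OF f(1)]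
      by (intro sing_comp_empty Aut_comp) simp_all
    moreover have "g' \<in> H"
      unfolding g'_def using kH less.prems by (intro H_comp)
    moreover have "length (g' []) < length (g [])"
      using 2 u by (simp add: g'_def)
    ultimately have "g' \<in> M"
      using less.hyps by blast
    moreover have "K f \<in> M" "k \<in> M"
      using M_K M_LK f(1) h(1) F_le by (auto simp: k_def)
    ultimately have "ginv (K f) \<circ> (ginv k \<circ> g') \<in> M"
      by (intro M_comp M_ginv)
    moreover have "ginv (K f) \<circ> (ginv k \<circ> g') = g"
      by (simp add: g'_def fun_eq_iff Aut_ginv[OF AK(1)] Aut_ginv[OF AK(3)])
    ultimately show ?thesis
      by simp
  qed
qed

text \<open>The copy of \<open>F'\<close> at an arbitrary vertex is conjugate, by an element without
  singularities, to the copy at the root or to the one at \<open>[a]\<close>. For odd length,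
  \<open>T v\<close> itself has the wrong type; \<open>T v \<circ> L a\<close> has the right one and
  carries \<open>[a]\<close> to \<open>v\<close>.\<close>

lemma M_vertex:
  assumes v: "v \<in> V" and "\<pi> \<in> F'"
  shows "T v \<circ> K \<pi> \<circ> ginv (T v) \<in> M"
proof (cases "even (length v)")
  case True
  then have "T v \<in> M"
    using M_sing_empty[of "T v"] G_T transl_Nil[OF v] by (simp add: H_iff)
  then show ?thesis
    using M_K[OF assms(2)] by (intro M_comp M_ginv)
next
  case False
  define S where "S = T v \<circ> L a"
  have SA: "S \<in> Aut \<Omega>"
    unfolding S_def by (intro Aut_comp transl_Aut lmul_Aut)
  have "L a [] = [a]"
    using a by (simp add: lmul_def)
  then have "even (length (S []))"
    using Aut_parity[OF transl_Aut, of "[a]" \<Omega> v] a False transl_Nil[OF v] by (simp add: S_def)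
  then have "S \<in> H"
    unfolding S_def by (simp add: H_iff G_comp G_T G_L)
  moreover have "sing S = {}"
    unfolding S_def by (intro sing_comp_empty transl_Aut lmul_Aut) simp_all
  ultimately have "S \<in> M"
    by (rule M_sing_empty)
  then have "S \<circ> (L a \<circ> K \<pi> \<circ> L a) \<circ> ginv S \<in> M"
    using M_LK[OF assms(2)] M_comp M_ginv by metis
  moreover have "S \<circ> (L a \<circ> K \<pi> \<circ> L a) \<circ> ginv S = T v \<circ> K \<pi> \<circ> ginv (T v)"
    unfolding S_def by (simp add: ginv_comp transl_Aut lmul_Aut ginv_lmul fun_eq_iff)
  ultimately show ?thesis
    by simp
qed

text \<open>Precomposing \<open>g\<close> with the rotation \<open>k\<close> about \<open>v\<close>
  whose local permutation there is the inverse of that of \<open>g\<close> removes the singularity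
  \<open>v\<close>. Since \<open>k\<close> is regular elsewhere, the other singularities are at most
  relocated, so their number drops.\<close>

lemma H_subset_M:
  assumes "g \<in> H"
  shows "g \<in> M"
  using assms
proof (induction "card (sing g)" arbitrary: g rule: less_induct)
  case less
  have g: "g \<in> Aut \<Omega>" "finite (sing g)" "\<And>v. v \<in> V \<Longrightarrow> sigma \<Omega> g v \<in> F'"
    using less.prems by (auto simp: H_iff G_iff)
  show ?case
  proof (cases "sing g = {}")
    case True
    then show ?thesis
      using M_sing_empty less.prems by blast
  next
    case False
    then obtain v where v: "v \<in> sing g" "v \<in> V"
      by (auto simp: sing_def)
    define \<pi> where "\<pi> = sigma \<Omega> g v"
    have \<pi>: "\<pi> \<in> F'" "binv \<pi> \<in> F'" "\<pi> \<in> Bij \<Omega>" "binv \<pi> \<in> Bij \<Omega>"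
      using g(3)[OF v(2)] F'_inv F'_Bij by (auto simp: \<pi>_def)
    define k where "k = T v \<circ> K (binv \<pi>) \<circ> ginv (T v)"
    have A: "T v \<in> Aut \<Omega>" "K (binv \<pi>) \<in> Aut \<Omega>" "ginv (T v) \<in> Aut \<Omega>" "T v \<circ> K (binv \<pi>) \<in> Aut \<Omega>"
      "k \<in> Aut \<Omega>"
      unfolding k_def by (intro Aut_comp transl_Aut Aut_inverse K_Aut \<pi>(4))+
    have Tv: "T v [] = v" "ginv (T v) v = []"
      using transl_Nil[OF v(2)] Aut_ginv(1)[OF A(1), of "[]"] by simp_all
    have kv: "k v = v"
      by (simp add: k_def Tv)
    have kM: "k \<in> M"
      unfolding k_def by (rule M_vertex[OF v(2) \<pi>(2)])
    have "k \<in> G"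
      unfolding k_def using H_K[OF \<pi>(2)] by (intro G_comp G_ginv G_T) (simp add: H_iff)
    moreover have "even (length (k []))"
      using Aut_parity[OF A(5) v(2)] kv by auto
    ultimately have kH: "k \<in> H"
      by (simp add: H_iff)
    have "ginv (T v) ` {v} = {[]}"
      using Tv by simp
    have s1: "sing (T v \<circ> K (binv \<pi>)) \<subseteq> {[]}"
      using sing_comp[OF A(1,2)] sing_K[OF \<pi>(4)] by simp
    have "sing (ginv (T v)) = {}"
      using sing_ginv[OF A(1)] by simp
    then have "sing k \<subseteq> ginv (ginv (T v)) ` {[]}"
      using sing_comp[OF A(4,3)] s1 unfolding k_def by blast
    moreover have "ginv (ginv (T v)) [] = v"
      using Tv inv_inv_eq[OF Aut_bij[OF A(1)]] by simp
    ultimately have sk: "sing k \<subseteq> {v}"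
      by simp
    have sv: "sigma \<Omega> k v = binv \<pi>"
    proof -
      have "sigma \<Omega> (ginv (T v)) v = idO"
        using sigma_ginv[OF finite_\<Omega> A(1) Nil_verts]
          monoid.inv_one[OF group.is_monoid[OF group_BijGroup], of \<Omega>]
        unfolding Tv sigma_transl[OF Nil_verts] BijGroup_simps by simp
      moreover have "sigma \<Omega> (T v \<circ> K (binv \<pi>)) [] = compose \<Omega> idO (binv \<pi>)"
        using sigma_comp[OF A(1,2) Nil_verts] sigma_K[OF \<pi>(4) Nil_verts]
        unfolding K_Nil sigma_transl[OF Nil_verts] by simp
      ultimately have "sigma \<Omega> k v = compose \<Omega> (compose \<Omega> idO (binv \<pi>)) idO"
        using sigma_comp[OF A(4,3) v(2)] unfolding k_def Tv by (simp only:)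
      also have "\<dots> = binv \<pi>"
        by (rule Bij_eqI) (use \<pi>(4) Bij_mem[OF \<pi>(4)] in \<open>auto simp: compose_eq intro!: compose_Bij id_Bij\<close>)
      finally show ?thesis .
    qed
    define g' where "g' = g \<circ> k"
    \<comment> \<open>At \<open>v\<close> the local permutations cancel to the identity, which lies
      in \<open>F\<close>. At any other \<open>x\<close> the factor from \<open>k\<close> lies in
      \<open>F\<close>, so a singularity must come from \<open>g\<close> at \<open>k x\<close>, and
      \<open>k x\<close> differs from \<open>k v = v\<close>.\<close>
    have "sing g' \<subseteq> ginv k ` (sing g - {v})"
    proof
      fix x assume x: "x \<in> sing g'"
      then have xV: "x \<in> V" and "sigma \<Omega> (g \<circ> k) x \<notin> F"
        by (auto simp: sing_def g'_def)
      then have ns: "compose \<Omega> (sigma \<Omega> g (k x)) (sigma \<Omega> k x) \<notin> F"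
        using sigma_comp[OF g(1) A(5) xV] by simp
      have "x \<noteq> v"
        using ns kv sv Bij_compose_m_inv(1)[OF \<pi>(3)] F_id by (auto simp flip: \<pi>_def)
      then have "sigma \<Omega> k x \<in> F"
        using sk xV by (auto simp: sing_def)
      then have "k x \<in> sing g"
        using ns F_compose xV Aut_in_verts[OF A(5), of x] by (auto simp: sing_def)
      moreover have "k x \<noteq> v"
        using Aut_inj[OF A(5), of x v] kv \<open>x \<noteq> v\<close> by simp
      moreover have "x = ginv k (k x)"
        using Aut_ginv(1)[OF A(5)] by simp
      ultimately show "x \<in> ginv k ` (sing g - {v})"
        by blast
    qed
    then have "card (sing g') \<le> card (sing g - {v})"
      using g(2) by (meson card_image_le card_mono finite_Diff finite_imageI le_trans)
    then have "card (sing g') < card (sing g)"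
      using g(2) v(1) card_Diff1_less[of "sing g" v] by linarith
    moreover have "g' \<in> H"
      unfolding g'_def by (rule H_comp[OF less.prems kH])
    ultimately have "g' \<in> M"
      using less.hyps by blast
    then have "g' \<circ> ginv k \<in> M"
      using kM by (intro M_comp M_ginv)
    moreover have "g' \<circ> ginv k = g"
      by (simp add: g'_def fun_eq_iff Aut_ginv[OF A(5)])
    ultimately show ?thesis
      by simp
  qed
qed

end

text \<open>Stated for an arbitrary generating set \<open>A\<close> of \<open>F'\<close>, since a
  set with two elements then yields the four generators of the examples.\<close>

lemma generate_H:
  assumes a: "a \<in> \<Omega>" and A: "generate (BijGroup \<Omega>) A = F'"
  shows "generate (perm_grp H) (K ` A \<union> (\<lambda>\<pi>. L a \<circ> K \<pi> \<circ> L a) ` A) = H"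
    (is "generate ?G ?S = H")
proof
  have XF': "A \<subseteq> F'"
    using A generate.incl by fast
  interpret G: group ?G
    by (rule group_H)
  have S: "?S \<subseteq> carrier ?G"
    using XF' H_K L_conj_H by auto
  show "generate ?G ?S \<subseteq> H"
    using G.generate_incl[OF S] by simp
  have sub: "subgroup (generate ?G ?S) ?G"
    by (rule G.generate_is_subgroup[OF S])
  have comp: "g \<circ> h \<in> generate ?G ?S" if "g \<in> generate ?G ?S" "h \<in> generate ?G ?S" for g h
    using subgroup.m_closed[OF sub that] by simp
  have ginv: "ginv g \<in> generate ?G ?S" if "g \<in> generate ?G ?S" for g
    using subgroup.m_inv_closed[OF sub that] inv_H[of g] G.generate_incl[OF S] that by auto
  have KB: "K \<pi> \<in> generate ?G ?S \<and> L a \<circ> K \<pi> \<circ> L a \<in> generate ?G ?S" if "\<pi> \<in> generate (BijGroup \<Omega>) A" for \<pi>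
    using that
  proof induction
    case one
    have "L a \<circ> K idO \<circ> L a = id"
      by (simp add: K_id fun_eq_iff)
    then show ?case
      using subgroup.one_closed[OF sub] unfolding BijGroup_simps(2) by (simp only: perm_grp_simps K_id)
  next
    case (incl h)
    then show ?case
      using generate.incl[of _ ?S ?G] by blast
  next
    case (inv h)
    then have h: "h \<in> Bij \<Omega>" "K h \<in> Aut \<Omega>"
      using XF' F'_Bij K_Aut by auto
    have "ginv (L a \<circ> K h \<circ> L a) = L a \<circ> K (binv h) \<circ> L a"
      using h by (simp add: ginv_comp lmul_Aut Aut_comp ginv_lmul ginv_K comp_assoc)
    moreover have "K h \<in> generate ?G ?S" "L a \<circ> K h \<circ> L a \<in> generate ?G ?S"
      using inv generate.incl[of _ ?S ?G] by blast+
    ultimately show ?case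
      using ginv ginv_K[OF h(1)] by metis
  next
    case (eng h1 h2)
    then have h: "h1 \<in> Bij \<Omega>" "h2 \<in> Bij \<Omega>"
      using A F'_Bij by auto
    have "L a \<circ> K (compose \<Omega> h1 h2) \<circ> L a = (L a \<circ> K h1 \<circ> L a) \<circ> (L a \<circ> K h2 \<circ> L a)"
      using h by (simp add: K_compose fun_eq_iff)
    then show ?case
      using eng.IH comp unfolding BijGroup_simps(3)[OF h] by (metis K_compose[OF h])
  qed
  show "H \<subseteq> generate ?G ?S"
    using H_subset_M[OF a comp ginv] KB A by blast
qed

lemma fin_gen_H: "fin_gen (perm_grp H)"
proof -
  obtain a where a: "a \<in> \<Omega>"
    using card_\<Omega> by fastforce
  have A: "generate (BijGroup \<Omega>) F' = F'"
    using group.generateI[OF group_BijGroup F'_subgroup, of F'] by auto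
  show ?thesis
    unfolding fin_gen_def
    by (intro exI[of _ "K ` F' \<union> (\<lambda>\<pi>. L a \<circ> K \<pi> \<circ> L a) ` F'"] conjI generate_H[OF a A, simplified])
      (use finite_F' H_K L_conj_H generate_H[OF a A] in auto)
qed

end

section \<open>Index, discreteness and simplicity\<close>

lemma disjoint_support_commute:
  assumes "bij p" "bij q" "\<And>x. x \<notin> D \<Longrightarrow> p x = x" "\<And>x. x \<in> D \<Longrightarrow> q x = x"
  shows "p \<circ> q = q \<circ> p"
proof
  fix x
  have "p x \<in> D" if "x \<in> D"
    using that assms(1,3) by (metis bij_pointE)
  moreover have "q x \<notin> D" if "x \<notin> D"
    using that assms(2,4) by (metis bij_pointE)
  ultimately show "(p \<circ> q) x = (q \<circ> p) x"
    using assms(3,4) by (cases "x \<in> D") auto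
qed

text \<open>The double commutator trick: since \<open>g\<close> moves \<open>D\<close> off itself, the conjugate of \<open>h\<close> by \<open>g\<close>
  commutes with everything supported on \<open>D\<close>.\<close>

lemma double_commutator:
  assumes bij: "bij g" "bij h" "bij k"
    and h: "\<And>x. x \<notin> D \<Longrightarrow> h x = x" and k: "\<And>x. x \<notin> D \<Longrightarrow> k x = x"
    and g: "\<And>x. x \<in> D \<Longrightarrow> g x \<notin> D"
  defines "c \<equiv> g \<circ> h \<circ> ginv g \<circ> ginv h"
  shows "c \<circ> k \<circ> ginv c \<circ> ginv k = ginv h \<circ> k \<circ> h \<circ> ginv k"
proof -
  define q where "q = g \<circ> h \<circ> ginv g"
  have gi: "ginv g (g x) = x" "g (ginv g x) = x" "ginv h (h x) = x" "h (ginv h x) = x"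
    "ginv k (k x) = x" "k (ginv k x) = x" for x
    using bij by (simp_all add: bij_is_inj bij_is_surj surj_f_inv_f)
  have bq: "bij q"
    unfolding q_def by (intro bij_comp bij bij_imp_bij_inv)
  have qi: "ginv q (q x) = x" "q (ginv q x) = x" for x
    using bq by (simp_all add: bij_is_inj bij_is_surj surj_f_inv_f)
  have qD: "q x = x" if "x \<in> D" for x
  proof -
    have "ginv g x \<notin> D"
      using g[of "ginv g x"] gi that by auto
    then show ?thesis
      using h gi by (simp add: q_def)
  qed
  \<comment> \<open>\<open>q\<close> is supported on the image of \<open>D\<close> under
    \<open>g\<close>, off \<open>D\<close>, while the conjugate of \<open>k\<close> is supported in
    \<open>D\<close>. With \<open>c = q \<circ> ginv h\<close>, commuting them cancels
    \<open>q\<close> against its inverse in the commutator of \<open>c\<close> and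
    \<open>k\<close>.\<close>
  have "(ginv h \<circ> k \<circ> h) \<circ> q = q \<circ> (ginv h \<circ> k \<circ> h)"
  proof (rule disjoint_support_commute[of _ _ D])
    show "bij (ginv h \<circ> k \<circ> h)"
      by (intro bij_comp bij bij_imp_bij_inv)
    show "(ginv h \<circ> k \<circ> h) x = x" if "x \<notin> D" for x
      using h[OF that] k[OF that] gi(3)[of x] by simp
  qed (use bq qD in auto)
  then have com: "ginv h (k (h (q x))) = q (ginv h (k (h x)))" for x
    by (simp add: fun_eq_iff)
  have c: "c = q \<circ> ginv h"
    by (simp add: c_def q_def)
  have "ginv c = h \<circ> ginv q"
    unfolding c using bij bq by (simp add: o_inv_distrib bij_imp_bij_inv inv_inv_eq)
  then show ?thesis
    by (simp add: c fun_eq_iff qi flip: com)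
qed

context local_action
begin

section \<open>Parity of the image of the root, index two, and discreteness\<close>

lemma G_parity:
  assumes "g \<in> G" "h \<in> G"
  shows "even (length (g (h []))) \<longleftrightarrow> (even (length (g [])) \<longleftrightarrow> even (length (h [])))"
  using Aut_parity[OF G_Aut[OF assms(1)], of "h []"] Aut_in_verts[OF G_Aut[OF assms(2)], of "[]"]
  by auto

lemma H_index: "card (rcosets\<^bsub>perm_grp G\<^esub> H) = 2"
proof -
  define P where "P e = {g \<in> G. even (length (g [])) = e}" for e
  have coset: "H #>\<^bsub>perm_grp G\<^esub> g = P (even (length (g [])))" if g: "g \<in> G" for g
  proof
    show "H #>\<^bsub>perm_grp G\<^esub> g \<subseteq> P (even (length (g [])))"
      using g by (auto simp: r_coset_def P_def H_iff G_comp G_parity)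
  next
    show "P (even (length (g []))) \<subseteq> H #>\<^bsub>perm_grp G\<^esub> g"
    proof
      fix h assume h: "h \<in> P (even (length (g [])))"
      have "h \<circ> ginv g \<in> H"
        using h g G_parity[OF _ G_ginv[OF g], of h] length_ginv[OF G_Aut[OF g]]
        by (auto simp: P_def H_iff G_comp G_ginv)
      moreover have "h = (h \<circ> ginv g) \<circ> g"
        using Aut_cancel[OF G_Aut[OF g]] by (simp add: comp_assoc)
      ultimately show "h \<in> H #>\<^bsub>perm_grp G\<^esub> g"
        by (auto simp: r_coset_def)
    qed
  qed
  obtain a where a: "a \<in> \<Omega>"
    using card_\<Omega> by fastforce
  have odd: "length (L a []) = 1"
    using a by (simp add: lmul_def)
  have "rcosets\<^bsub>perm_grp G\<^esub> H = {P True, P False}"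
  proof
    show "rcosets\<^bsub>perm_grp G\<^esub> H \<subseteq> {P True, P False}"
    proof
      fix x assume "x \<in> rcosets\<^bsub>perm_grp G\<^esub> H"
      then obtain g where "g \<in> G" "x = P (even (length (g [])))"
        using coset by (auto simp: RCOSETS_def)
      then show "x \<in> {P True, P False}"
        by (cases "even (length (g []))") simp_all
    qed
    have "P True \<in> rcosets\<^bsub>perm_grp G\<^esub> H"
      using coset[OF G_id] G_id by (auto simp: RCOSETS_def intro!: bexI[of _ id])
    moreover have "P False \<in> rcosets\<^bsub>perm_grp G\<^esub> H"
      using coset[OF G_L[of a]] G_L[of a] odd by (auto simp: RCOSETS_def intro!: bexI[of _ "L a"])
    ultimately show "{P True, P False} \<subseteq> rcosets\<^bsub>perm_grp G\<^esub> H"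
      by blast
  qed
  moreover have "id \<in> P True" "id \<notin> P False"
    using G_id by (auto simp: P_def)
  then have "P True \<noteq> P False"
    by blast
  ultimately show ?thesis
    by simp
qed

text \<open>An element of U(F) that fixes the ball of radius one is the identity by rigidity, so
  singletons satisfy the defining condition of open sets.\<close>

lemma H_discrete:
  assumes g: "g \<in> H"
  shows "openin (subtopology (Gtop \<Omega> F F') H) {g}"
proof -
  \<comment> \<open>\<open>openin (topology op)\<close> is known to be \<open>op\<close> only once
    \<open>op\<close> satisfies \<open>istopology\<close>, so closure under intersections and unions
    is checked before the singleton is examined.\<close>
  define op where "op S \<longleftrightarrow> S \<subseteq> G \<and> (\<forall>g\<in>S. \<exists>A. finite A \<and> A \<subseteq> V \<and>
        (\<lambda>h. g \<circ> h) ` {h \<in> Ufin \<Omega> F. \<forall>v\<in>A. h v = v} \<subseteq> S)" for S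
  have op: "istopology op"
    unfolding istopology_def
  proof (intro conjI allI impI)
    fix S S' assume S: "op S" "op S'"
    show "op (S \<inter> S')"
      unfolding op_def
    proof (intro conjI ballI)
      show "S \<inter> S' \<subseteq> G"
        using S by (auto simp: op_def)
      fix g assume g: "g \<in> S \<inter> S'"
      obtain A where A: "finite A" "A \<subseteq> V" "(\<lambda>h. g \<circ> h) ` {h \<in> Ufin \<Omega> F. \<forall>v\<in>A. h v = v} \<subseteq> S"
        using S(1) g unfolding op_def by blast
      obtain A' where A': "finite A'" "A' \<subseteq> V" "(\<lambda>h. g \<circ> h) ` {h \<in> Ufin \<Omega> F. \<forall>v\<in>A'. h v = v} \<subseteq> S'"
        using S(2) g unfolding op_def by blast
      show "\<exists>A. finite A \<and> A \<subseteq> V \<and> (\<lambda>h. g \<circ> h) ` {h \<in> Ufin \<Omega> F. \<forall>v\<in>A. h v = v} \<subseteq> S \<inter> S'"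
      proof (intro exI[of _ "A \<union> A'"] conjI)
        have "{h \<in> Ufin \<Omega> F. \<forall>v\<in>A \<union> A'. h v = v} \<subseteq> {h \<in> Ufin \<Omega> F. \<forall>v\<in>A. h v = v}"
          "{h \<in> Ufin \<Omega> F. \<forall>v\<in>A \<union> A'. h v = v} \<subseteq> {h \<in> Ufin \<Omega> F. \<forall>v\<in>A'. h v = v}"
          by auto
        from this[THEN image_mono, of "\<lambda>h. g \<circ> h"]
        show "(\<lambda>h. g \<circ> h) ` {h \<in> Ufin \<Omega> F. \<forall>v\<in>A \<union> A'. h v = v} \<subseteq> S \<inter> S'"
          using A(3) A'(3) by (meson Int_greatest subset_trans)
      qed (use A A' in auto)
    qed
  next
    fix \<S> assume S: "\<forall>S\<in>\<S>. op S"
    show "op (\<Union>\<S>)"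
      unfolding op_def
    proof (intro conjI ballI)
      show "\<Union>\<S> \<subseteq> G"
        using S by (auto simp: op_def)
      fix g assume "g \<in> \<Union>\<S>"
      then obtain S' where S': "S' \<in> \<S>" "g \<in> S'"
        by blast
      then have "op S'"
        using S by blast
      then obtain A where A: "finite A" "A \<subseteq> V" "(\<lambda>h. g \<circ> h) ` {h \<in> Ufin \<Omega> F. \<forall>v\<in>A. h v = v} \<subseteq> S'"
        using S'(2) unfolding op_def by blast
      have "S' \<subseteq> \<Union>\<S>"
        using S'(1) by blast
      then show "\<exists>A. finite A \<and> A \<subseteq> V \<and> (\<lambda>h. g \<circ> h) ` {h \<in> Ufin \<Omega> F. \<forall>v\<in>A. h v = v} \<subseteq> \<Union>\<S>"
        using A by (intro exI[of _ A] conjI subset_trans[OF A(3)])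
    qed
  qed
  have "op = (\<lambda>S. S \<subseteq> G \<and> (\<forall>g\<in>S. \<exists>A. finite A \<and> A \<subseteq> V \<and>
        (\<lambda>h. g \<circ> h) ` {h \<in> Ufin \<Omega> F. \<forall>v\<in>A. h v = v} \<subseteq> S))"
    unfolding op_def ..
  then have "Gtop \<Omega> F F' = topology op"
    unfolding Gtop_def by (simp only:)
  then have openin: "openin (Gtop \<Omega> F F') = op"
    using topology_inverse'[OF op] by (simp only:)
  define A where "A = {v \<in> V. length v \<le> Suc 0}"
  have "A \<subseteq> {w. set w \<subseteq> \<Omega> \<and> length w \<le> Suc 0}"
    using verts_subset by (auto simp: A_def)
  then have fin: "finite A"
    using finite_lists_length_le[OF finite_\<Omega>] finite_subset by blast
  have "h = id" if h: "h \<in> Ufin \<Omega> F" "\<forall>v\<in>A. h v = v" for h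
  proof (rule Aut_eqI[of _ _ 0])
    show "h \<in> Aut \<Omega>"
      using h by (simp add: Ufin_def)
  qed (use h in \<open>auto simp: Ufin_def A_def Aut_id F_id sigma_id\<close>)
  then have "{h \<in> Ufin \<Omega> F. \<forall>v\<in>A. h v = v} \<subseteq> {id}"
    by blast
  then have "(\<lambda>h. g \<circ> h) ` {h \<in> Ufin \<Omega> F. \<forall>v\<in>A. h v = v} \<subseteq> {g}"
    by auto
  moreover have "g \<in> G" "A \<subseteq> V"
    using g by (auto simp: H_iff A_def)
  ultimately have "op {g}"
    using fin unfolding op_def by blast
  then show ?thesis
    using g openin by (auto simp: openin_subtopology intro!: exI[of _ "{g}"])
qed

section \<open>Normal subgroups of the type-preserving group\<close>

lemma third_colour: "\<exists>b\<in>\<Omega>. b \<noteq> x \<and> b \<noteq> y"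
proof (rule ccontr)
  assume "\<not> (\<exists>b\<in>\<Omega>. b \<noteq> x \<and> b \<noteq> y)"
  then have "card \<Omega> \<le> card {x, y}"
    by (intro card_mono) auto
  also have "card {x, y} \<le> 2"
    by (simp add: card_insert_if)
  finally show False
    using card_\<Omega> by simp
qed

text \<open>An odd vertex is the only common neighbour of two of its even neighbours. So a
  nontrivial element moves an even vertex, and even vertices can be brought to the root inside
  \<open>H\<close>.\<close>

lemma eq_id_if_even_fixed:
  assumes g: "g \<in> Aut \<Omega>" and "\<And>v. v \<in> V \<Longrightarrow> even (length v) \<Longrightarrow> g v = v"
  shows "g = id"
proof
  fix v
  consider "v \<notin> V" | "v \<in> V" "even (length v)" | "v \<in> V" "odd (length v)"
    by blast
  then show "g v = id v"
  proof cases
    case 1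
    then show ?thesis
      using Aut_permutes[OF g] by (simp add: permutes_not_in)
  next
    case 3
    then obtain w a where v: "v = w @ [a]"
      by (cases v rule: rev_cases) auto
    have wa: "w \<in> V" "a \<in> \<Omega>" "w = [] \<or> last w \<noteq> a"
      using 3 unfolding v snoc_verts by auto
    obtain b where b: "b \<in> \<Omega>" "b \<noteq> a"
      using third_colour by blast
    have vb: "v @ [b] \<in> V" "nb v b = v @ [b]" "nb w a = v"
      using 3 b wa snoc_verts[of v b \<Omega>] by (auto simp: v nb_def)
    have gw: "g w = w" "g (v @ [b]) = v @ [b]"
      using assms(2)[OF wa(1)] assms(2)[OF vb(1)] 3 v by auto
    obtain c where c: "g v = nb w c"
      using sigma_in_nb(2)[OF g wa(1,2)] vb(3) gw(1) by metis
    obtain d where d: "v @ [b] = nb (g v) d"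
      using sigma_in_nb(2)[OF g 3(1) b(1)] vb(2) gw(2) by metis
    have "length (g v) \<le> length v"
      unfolding c using length_nb(1)[of w c] by (simp add: v)
    then have "v @ [b] = g v @ [d]"
      using d by (auto simp: nb_def split: if_splits dest: arg_cong[of _ _ length])
    then show ?thesis
      by simp
  qed (use assms in auto)
qed

text \<open>For \<open>f\<close> in \<open>F\<close> the map \<open>K f\<close> relabels all letters
  alike, so it respects multiplication in the free product and carries left multiplication by
  \<open>b\<close> to that by \<open>f b\<close>.\<close>

lemma K_L:
  assumes "f \<in> F" "b \<in> \<Omega>"
  shows "K f \<circ> L b = L (f b) \<circ> K f"
proof
  fix w
  have fb: "f b \<in> \<Omega>"
    using Bij_mem[OF F_Bij[OF assms(1)] assms(2)] .
  show "(K f \<circ> L b) w = (L (f b) \<circ> K f) w"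
  proof (cases "w \<in> V")
    case True
    have "K f (L b w) = map f (L b w)" "K f w = map f w" "map f w \<in> V"
      using K_F[OF assms(1) True] K_F[OF assms(1) lmul_verts[OF True]]
        map_F_verts[OF F_Bij[OF assms(1)] True] by auto
    moreover have "map f (L b w) = L (f b) (map f w)"
    proof (cases w)
      case (Cons c u)
      then have "c \<in> \<Omega>"
        using True by (simp add: Cons_verts)
      then show ?thesis
        using Cons True \<open>map f w \<in> V\<close> fb assms Bij_inj[OF F_Bij[OF assms(1)], of c b]
        by (simp add: lmul_def)
    qed (use assms fb in \<open>simp add: lmul_def\<close>)
    ultimately show ?thesis
      by simp
  next
    case False
    then show ?thesis
      by (simp add: lmul_def locperm_def)
  qed
qed

definition commutator :: "('a \<Rightarrow> 'a) \<Rightarrow> ('a \<Rightarrow> 'a) \<Rightarrow> 'a \<Rightarrow> 'a" where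
  "commutator \<pi> \<rho> = \<pi> \<otimes>\<^bsub>BijGroup \<Omega>\<^esub> \<rho> \<otimes>\<^bsub>BijGroup \<Omega>\<^esub> binv \<pi> \<otimes>\<^bsub>BijGroup \<Omega>\<^esub> binv \<rho>"

lemma commutator_eq:
  assumes "\<pi> \<in> Bij \<Omega>" "\<rho> \<in> Bij \<Omega>"
  shows "commutator \<pi> \<rho> \<in> Bij \<Omega>"
    "K (commutator \<pi> \<rho>) = K \<pi> \<circ> K \<rho> \<circ> ginv (K \<pi>) \<circ> ginv (K \<rho>)"
  using assms by (simp_all add: commutator_def BijGroup_simps compose_Bij Bij_m_inv K_compose ginv_K)

definition normal_in_H :: "('a list \<Rightarrow> 'a list) set \<Rightarrow> bool" where
  "normal_in_H N \<longleftrightarrow> N \<subseteq> H \<and> id \<in> N \<and> (\<forall>g\<in>N. \<forall>h\<in>N. g \<circ> h \<in> N) \<and> (\<forall>g\<in>N. ginv g \<in> N)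
     \<and> (\<forall>g\<in>N. \<forall>h\<in>H. h \<circ> g \<circ> ginv h \<in> N)"

lemma normal_in_H_L:
  assumes "normal_in_H N"
  shows "normal_in_H ((\<lambda>g. L a \<circ> g \<circ> L a) ` N)"
  unfolding normal_in_H_def
proof (intro conjI ballI)
  note N = assms[unfolded normal_in_H_def]
  show "(\<lambda>g. L a \<circ> g \<circ> L a) ` N \<subseteq> H"
    using N L_conj_H by blast
  have "id = L a \<circ> id \<circ> L a"
    by (simp add: fun_eq_iff)
  then show "id \<in> (\<lambda>g. L a \<circ> g \<circ> L a) ` N"
    using N by blast
  fix g' assume "g' \<in> (\<lambda>g. L a \<circ> g \<circ> L a) ` N"
  then obtain g where g: "g \<in> N" "g' = L a \<circ> g \<circ> L a"
    by blast
  then have gA: "g \<in> Aut \<Omega>"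
    using N H_Aut by blast
  have "ginv g' = L a \<circ> ginv g \<circ> L a"
    unfolding g by (simp add: gA ginv_comp Aut_comp lmul_Aut ginv_lmul comp_assoc)
  then show "ginv g' \<in> (\<lambda>g. L a \<circ> g \<circ> L a) ` N"
    using N g by blast
  fix h
  {
    assume "h \<in> (\<lambda>g. L a \<circ> g \<circ> L a) ` N"
    then obtain k where k: "k \<in> N" "h = L a \<circ> k \<circ> L a"
      by blast
    have "g' \<circ> h = L a \<circ> (g \<circ> k) \<circ> L a"
      unfolding g k by (simp add: fun_eq_iff)
    then show "g' \<circ> h \<in> (\<lambda>g. L a \<circ> g \<circ> L a) ` N"
      using N g k by blast
  }
  assume h: "h \<in> H"
  define k where "k = L a \<circ> h \<circ> L a"
  have "k \<in> H"
    unfolding k_def by (rule L_conj_H[OF h])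
  moreover have "ginv k = L a \<circ> ginv h \<circ> L a"
    unfolding k_def by (simp add: H_Aut[OF h] ginv_comp Aut_comp lmul_Aut ginv_lmul comp_assoc)
  then have "h \<circ> g' \<circ> ginv h = L a \<circ> (k \<circ> g \<circ> ginv k) \<circ> L a"
    unfolding g k_def by (simp add: fun_eq_iff)
  ultimately show "h \<circ> g' \<circ> ginv h \<in> (\<lambda>g. L a \<circ> g \<circ> L a) ` N"
    using N g by blast
qed

context
  fixes N assumes N: "normal_in_H N" and nontrivial: "\<exists>g\<in>N. g \<noteq> id"
begin

lemma N_closed:
  shows "N \<subseteq> H" "id \<in> N" "g \<in> N \<Longrightarrow> h \<in> N \<Longrightarrow> g \<circ> h \<in> N" "g \<in> N \<Longrightarrow> ginv g \<in> N"
    "g \<in> N \<Longrightarrow> h \<in> H \<Longrightarrow> h \<circ> g \<circ> ginv h \<in> N"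
  using N unfolding normal_in_H_def by blast+

lemma moves_root: "\<exists>g\<in>N. g [] \<noteq> []"
proof -
  obtain g where g: "g \<in> N" "g \<noteq> id"
    using nontrivial by blast
  then have gA: "g \<in> Aut \<Omega>"
    using N_closed(1) H_Aut by blast
  obtain v where v: "v \<in> V" "even (length v)" "g v \<noteq> v"
    using eq_id_if_even_fixed[OF gA] g by blast
  have "T v \<in> H"
    using v transl_Nil[OF v(1)] by (simp add: H_iff G_T)
  then have "ginv (T v) \<in> H"
    by (rule H_ginv)
  then have "ginv (T v) \<circ> g \<circ> ginv (ginv (T v)) \<in> N"
    by (rule N_closed(5)[OF g(1)])
  moreover have "ginv (ginv (T v)) [] = v"
    using inv_inv_eq[OF Aut_bij[OF transl_Aut]] transl_Nil[OF v(1)] by metis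
  moreover have "ginv (T v) (g v) \<noteq> ginv (T v) v"
    using v(3) Aut_inj[OF Aut_inverse[OF transl_Aut]] by blast
  moreover have "ginv (T v) v = []"
    using Aut_ginv(1)[OF transl_Aut, of \<Omega> v "[]"] transl_Nil[OF v(1)] by simp
  ultimately show ?thesis
    by (intro bexI[of _ "ginv (T v) \<circ> g \<circ> ginv (ginv (T v))"]) auto
qed

text \<open>A rotation about \<open>[b]\<close> that fixes the colour \<open>b\<close> is supported
  on the half-tree \<open>D\<close> of words starting with \<open>b\<close>. If \<open>g\<close> in
  \<open>N\<close> moves \<open>D\<close> off itself, the double commutator trick puts commutators
  of such rotations into \<open>N\<close>.\<close>

lemma commutators_at_some:
  "\<exists>b\<in>\<Omega>. \<forall>\<pi>\<in>F'. \<forall>\<rho>\<in>F'. \<pi> b = b \<longrightarrow> \<rho> b = b \<longrightarrow> L b \<circ> K (commutator \<pi> \<rho>) \<circ> L b \<in> N"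
proof -
  obtain g where g: "g \<in> N" "g [] \<noteq> []"
    using moves_root by blast
  then have gA: "g \<in> Aut \<Omega>"
    using N_closed(1) H_Aut by blast
  define u s where "u = g []" and "s = sigma \<Omega> g []"
  have s: "s \<in> Bij \<Omega>"
    unfolding s_def using sigma_Bij[OF finite_\<Omega> gA] by simp
  \<comment> \<open>The condition on \<open>last u\<close> makes the edge from the root to
    \<open>[b]\<close> map to an edge pointing away from the root, so all of \<open>D\<close> is
    mapped to words extending \<open>u\<close>. The condition on \<open>hd u\<close> keeps these
    words out of \<open>D\<close>.\<close>
  obtain b where b: "b \<in> \<Omega>" "b \<noteq> hd u" "b \<noteq> binv s (last u)"
    using third_colour by blast
  then have sb: "s b \<noteq> last u"
    using Bij_m_inv(2)[OF s b(1)] by auto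
  have u: "u \<noteq> []"
    using g by (simp add: u_def)
  have "g [b] = nb u (s b)"
    using sigma_in_nb(2)[OF gA _ b(1), of "[]"] by (simp add: nb_def u_def s_def)
  then have gb: "g ([] @ [b]) = g [] @ [s b]"
    using sb u by (auto simp: nb_def u_def)
  define D where "D = {w \<in> V. w \<noteq> [] \<and> hd w = b}"
  have gD: "g x \<notin> D" if "x \<in> D" for x
  proof -
    obtain w where x: "x = b # w" "b # w \<in> V"
      using \<open>x \<in> D\<close> by (cases x) (auto simp: D_def)
    obtain w' where "g x = u @ s b # w'"
      using Aut_extend[OF gA _ gb, of w] x by (auto simp: u_def)
    then show ?thesis
      using u b by (auto simp: D_def hd_append)
  qed
  have supp: "(L b \<circ> K \<pi> \<circ> L b) x = x" if \<pi>: "\<pi> b = b" and x: "x \<notin> D" for \<pi> x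
  proof (cases "x \<in> V")
    case True
    then have V: "b # x \<in> V" and Lx: "L b x = b # x"
      using x b by (auto simp: D_def Cons_verts lmul_def)
    have "tr b b = idO"
      using tr_unique[OF F_id b(1)] b(1) by simp
    then have "K \<pi> (b # x) = b # x"
      using verts_subset[OF True] by (auto simp: K_Cons[OF V] \<pi> intro!: map_idI)
    then show ?thesis
      using lmul_lmul[of \<Omega> b x] by (simp add: Lx)
  next
    case False
    then show ?thesis
      by (simp add: lmul_def locperm_def)
  qed
  have "L b \<circ> K (commutator \<pi> \<rho>) \<circ> L b \<in> N"
    if "\<pi> \<in> F'" "\<rho> \<in> F'" "\<pi> b = b" "\<rho> b = b" for \<pi> \<rho>
  proof -
    have B: "\<pi> \<in> Bij \<Omega>" "\<rho> \<in> Bij \<Omega>" "binv \<pi> \<in> Bij \<Omega>"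
      using that F'_Bij F'_inv by auto
    have bb: "binv \<pi> b = b"
      using Bij_m_inv(2)[OF B(1) b(1)] that by simp
    \<comment> \<open>The double commutator produces the commutator of \<open>ginv h\<close> with
      \<open>k\<close>; starting from the inverse of \<open>\<pi>\<close> makes this the commutator
      of \<open>\<pi>\<close> and \<open>\<rho>\<close>.\<close>
    define h k where "h = L b \<circ> K (binv \<pi>) \<circ> L b" and "k = L b \<circ> K \<rho> \<circ> L b"
    have hk: "h \<in> H" "k \<in> H"
      using that L_conj_H H_K F'_inv by (auto simp: h_def k_def)
    define c where "c = g \<circ> h \<circ> ginv g \<circ> ginv h"
    have "g \<circ> (h \<circ> ginv g \<circ> ginv h) \<in> N"
      using N_closed g hk by blast
    then have "c \<in> N"
      by (simp add: c_def comp_assoc)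
    then have "c \<circ> (k \<circ> ginv c \<circ> ginv k) \<in> N"
      using N_closed hk by blast
    moreover have "c \<circ> k \<circ> ginv c \<circ> ginv k = ginv h \<circ> k \<circ> h \<circ> ginv k"
      unfolding c_def
    proof (rule double_commutator[of _ _ _ D])
      show "h x = x" "k x = x" if "x \<notin> D" for x
        unfolding h_def k_def using supp that bb \<open>\<rho> b = b\<close> by blast+
    qed (use gA hk H_Aut Aut_bij gD in auto)
    moreover have "ginv h \<circ> k \<circ> h \<circ> ginv k = L b \<circ> K (commutator \<pi> \<rho>) \<circ> L b"
    proof -
      have "ginv (K (binv \<pi>)) = K \<pi>"
        using ginv_K[OF B(1)] inv_inv_eq[OF Aut_bij[OF K_Aut[OF B(1)]]] by simp
      then have "ginv h = L b \<circ> K \<pi> \<circ> L b" "ginv k = L b \<circ> K (binv \<rho>) \<circ> L b"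
        unfolding h_def k_def
        by (simp_all add: B ginv_comp Aut_comp lmul_Aut ginv_lmul comp_assoc K_Aut ginv_K)
      then show ?thesis
        unfolding commutator_eq(2)[OF B(1,2)] ginv_K[OF B(1)] ginv_K[OF B(2)]
        by (simp add: h_def k_def fun_eq_iff)
    qed
    ultimately show ?thesis
      by (simp add: comp_assoc)
  qed
  then show ?thesis
    using b by blast
qed

text \<open>The colour \<open>c\<close> found above depends on \<open>N\<close>. For another colour
  \<open>b\<close>, conjugation by \<open>K f\<close> with \<open>f\<close> in \<open>F\<close> and
  \<open>f b = c\<close> carries the stabiliser of \<open>b\<close> to that of \<open>c\<close> and
  the vertex \<open>[b]\<close> to \<open>[c]\<close>.\<close>

lemma commutators_at_all:
  assumes b: "b \<in> \<Omega>" and "\<pi> \<in> F'" "\<rho> \<in> F'" "\<pi> b = b" "\<rho> b = b"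
  shows "L b \<circ> K (commutator \<pi> \<rho>) \<circ> L b \<in> N"
proof -
  interpret B: group "BijGroup \<Omega>"
    by (rule group_BijGroup)
  obtain c where c: "c \<in> \<Omega>"
    "\<And>\<pi> \<rho>. \<pi> \<in> F' \<Longrightarrow> \<rho> \<in> F' \<Longrightarrow> \<pi> c = c \<Longrightarrow> \<rho> c = c \<Longrightarrow> L c \<circ> K (commutator \<pi> \<rho>) \<circ> L c \<in> N"
    using commutators_at_some by blast
  define f where "f = tr b c"
  have f: "f \<in> F" "f b = c" "f \<in> Bij \<Omega>" "f \<in> F'" "binv f \<in> F'" "binv f \<in> F"
    using tr_F tr_eq b c(1) F_Bij F'_inv F_inv F_le by (auto simp: f_def)
  have fc: "binv f c = b"
    using Bij_m_inv(2)[OF f(3) b] f(2) by simp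
  define cj where "cj x = compose \<Omega> (compose \<Omega> f x) (binv f)" for x
  have cj: "cj x \<in> F'" "cj x c = c" "K (cj x) = K f \<circ> K x \<circ> ginv (K f)" if "x \<in> F'" "x b = b" for x
    using that f fc c(1) b F'_Bij
    by (auto simp: cj_def F'_compose compose_eq K_compose compose_Bij ginv_K)
  have B: "\<pi> \<in> Bij \<Omega>" "\<rho> \<in> Bij \<Omega>"
    using assms F'_Bij by auto
  have A: "K f \<in> Aut \<Omega>" "K \<pi> \<in> Aut \<Omega>" "K \<rho> \<in> Aut \<Omega>"
    using B f K_Aut by auto
  note inv_simps = Aut_ginv[OF A(1)] Aut_ginv[OF A(2)] Aut_ginv[OF A(3)]
  have "ginv (K (cj x)) = K f \<circ> ginv (K x) \<circ> ginv (K f)" if "x \<in> F'" "x b = b" for x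
    using that A(1) K_Aut[OF F'_Bij[OF that(1)]] inv_inv_eq[OF Aut_bij[OF A(1)]]
    by (simp add: cj(3) ginv_comp Aut_comp Aut_inverse comp_assoc)
  then have "K (commutator (cj \<pi>) (cj \<rho>)) = K f \<circ> K (commutator \<pi> \<rho>) \<circ> ginv (K f)"
    using assms cj[of \<pi>] cj[of \<rho>] B F'_Bij by (simp add: commutator_eq fun_eq_iff inv_simps)
  moreover have "L c \<circ> K (commutator (cj \<pi>) (cj \<rho>)) \<circ> L c \<in> N"
    using c(2) cj assms by blast
  ultimately have 1: "L c \<circ> (K f \<circ> K (commutator \<pi> \<rho>) \<circ> ginv (K f)) \<circ> L c \<in> N"
    by simp
  have Lc: "L c \<circ> K f = K f \<circ> L b"
    using K_L[OF f(1) b] f(2) by simp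
  have Lc': "ginv (K f) \<circ> L c = L b \<circ> ginv (K f)"
    using K_L[OF f(6) c(1)] fc ginv_K[OF f(3)] by simp
  have "L c \<circ> (K f \<circ> K (commutator \<pi> \<rho>) \<circ> ginv (K f)) \<circ> L c
      = (L c \<circ> K f) \<circ> K (commutator \<pi> \<rho>) \<circ> (ginv (K f) \<circ> L c)"
    by (simp only: comp_assoc)
  also have "\<dots> = K f \<circ> (L b \<circ> K (commutator \<pi> \<rho>) \<circ> L b) \<circ> ginv (K f)"
    unfolding Lc Lc' by (simp only: comp_assoc)
  finally have "K f \<circ> (L b \<circ> K (commutator \<pi> \<rho>) \<circ> L b) \<circ> ginv (K f) \<in> N"
    using 1 by simp
  then have "ginv (K f) \<circ> (K f \<circ> (L b \<circ> K (commutator \<pi> \<rho>) \<circ> L b) \<circ> ginv (K f)) \<circ> ginv (ginv (K f)) \<in> N"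
    by (rule N_closed(5)) (intro H_ginv H_K f)
  moreover have "ginv (K f) \<circ> (K f \<circ> (L b \<circ> K (commutator \<pi> \<rho>) \<circ> L b) \<circ> ginv (K f)) \<circ> ginv (ginv (K f))
      = L b \<circ> K (commutator \<pi> \<rho>) \<circ> L b"
    using inv_inv_eq[OF Aut_bij[OF A(1)]] by (simp add: fun_eq_iff inv_simps)
  ultimately show ?thesis
    by simp
qed

text \<open>The commutators for different colours \<open>b\<close> arise at different vertices
  \<open>[b]\<close>. Conjugating by \<open>L a \<circ> L b\<close>, which preserves types and maps
  \<open>[b]\<close> to \<open>[a]\<close>, collects them all at \<open>[a]\<close>, where they
  generate the copy of \<open>F'\<close>.\<close>

lemma L_K_in_N:
  assumes a: "a \<in> \<Omega>"
    and gen: "generate (BijGroup \<Omega>) (\<Union>b\<in>\<Omega>. derived (BijGroup \<Omega>) {f \<in> F'. f b = b}) = F'"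
    and "\<pi> \<in> F'"
  shows "L a \<circ> K \<pi> \<circ> L a \<in> N"
proof -
  define P where "P \<pi> \<longleftrightarrow> \<pi> \<in> Bij \<Omega> \<and> L a \<circ> K \<pi> \<circ> L a \<in> N" for \<pi>
  have P_one: "P \<one>\<^bsub>BijGroup \<Omega>\<^esub>"
  proof -
    have "L a \<circ> K idO \<circ> L a = id"
      by (simp add: K_id fun_eq_iff)
    then show ?thesis
      unfolding P_def BijGroup_simps(2) by (simp only: N_closed(2) id_Bij)
  qed
  have P_inv: "P (binv h)" if "P h" for h
  proof -
    have h: "h \<in> Bij \<Omega>"
      using that by (simp add: P_def)
    have "ginv (L a \<circ> K h \<circ> L a) = L a \<circ> K (binv h) \<circ> L a"
      using h K_Aut[OF h] by (simp add: ginv_comp lmul_Aut Aut_comp ginv_lmul ginv_K comp_assoc)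
    then show ?thesis
      using that N_closed(4) Bij_m_inv(1) unfolding P_def by metis
  qed
  have P_mult: "P (g \<otimes>\<^bsub>BijGroup \<Omega>\<^esub> h)" if "P g" "P h" for g h
  proof -
    have gh: "g \<in> Bij \<Omega>" "h \<in> Bij \<Omega>"
      using that by (auto simp: P_def)
    have "L a \<circ> K (compose \<Omega> g h) \<circ> L a = (L a \<circ> K g \<circ> L a) \<circ> (L a \<circ> K h \<circ> L a)"
      using gh by (simp add: K_compose fun_eq_iff)
    then show ?thesis
      using that N_closed(3) compose_Bij[OF gh] unfolding P_def BijGroup_simps(3)[OF gh] by metis
  qed
  have comm: "P (commutator \<pi> \<rho>)"
    if b: "b \<in> \<Omega>" and \<pi>\<rho>: "\<pi> \<in> F'" "\<rho> \<in> F'" "\<pi> b = b" "\<rho> b = b" for b \<pi> \<rho>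
  proof -
    have "even (length ((L a \<circ> L b) []))"
      using G_parity[OF G_L[of a] G_L[of b]] a b by (simp add: lmul_def)
    then have "L a \<circ> L b \<in> H"
      by (simp add: H_iff G_comp G_L)
    then have "(L a \<circ> L b) \<circ> (L b \<circ> K (commutator \<pi> \<rho>) \<circ> L b) \<circ> ginv (L a \<circ> L b) \<in> N"
      using N_closed(5) commutators_at_all[OF that] by blast
    moreover have "(L a \<circ> L b) \<circ> (L b \<circ> K (commutator \<pi> \<rho>) \<circ> L b) \<circ> ginv (L a \<circ> L b)
        = L a \<circ> K (commutator \<pi> \<rho>) \<circ> L a"
      by (simp add: ginv_comp lmul_Aut ginv_lmul fun_eq_iff)
    ultimately show ?thesis
      using commutator_eq(1) \<pi>\<rho> F'_Bij unfolding P_def by simp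
  qed
  have der: "P x" if b: "b \<in> \<Omega>" and "x \<in> derived (BijGroup \<Omega>) {f \<in> F'. f b = b}" for b x
  proof -
    have comm': "P h" if "h \<in> derived_set (BijGroup \<Omega>) {f \<in> F'. f b = b}" for h
      using that comm[OF b] by (auto simp: commutator_def)
    show ?thesis
      using that(2) unfolding derived_def
    proof induction
      case (incl h)
      then show ?case
        by (rule comm')
    next
      case (inv h)
      then show ?case
        by (rule P_inv[OF comm'])
    next
      case one
      show ?case
        by (rule P_one)
    next
      case (eng g h)
      show ?case
        by (rule P_mult[OF eng(3,4)])
    qed
  qed
  have "\<pi> \<in> generate (BijGroup \<Omega>) (\<Union>b\<in>\<Omega>. derived (BijGroup \<Omega>) {f \<in> F'. f b = b})"
    using assms(3) by (simp only: gen)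
  then have "P \<pi>"
  proof induction
    case (incl h)
    then show ?case
      by (rule UN_E) (rule der)
  next
    case (inv h)
    then have "P h"
      by (rule UN_E) (rule der)
    then show ?case
      by (rule P_inv)
  next
    case one
    show ?case
      by (rule P_one)
  next
    case (eng g h)
    show ?case
      by (rule P_mult[OF eng(3,4)])
  qed
  then show ?thesis
    by (simp add: P_def)
qed

end

text \<open>The previous lemma reaches only the copy of \<open>F'\<close> at a neighbour of the
  root. Applied to the conjugate \<open>N'\<close> of \<open>N\<close> by \<open>L a\<close>, it
  gives the copy at the root in \<open>N\<close> itself, and both copies together generate
  \<open>H\<close>.\<close>

lemma simple_H:
  assumes gen: "generate (BijGroup \<Omega>) (\<Union>b\<in>\<Omega>. derived (BijGroup \<Omega>) {f \<in> F'. f b = b}) = F'"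
  shows "is_simple (perm_grp H)"
  unfolding is_simple_def
proof (intro conjI allI impI)
  show "group (perm_grp H)"
    by (rule group_H)
  obtain a b where ab: "a \<in> \<Omega>" "b \<in> \<Omega>" "a \<noteq> b"
    using third_colour by metis
  have "T [a, b] [] = [a, b]"
    using ab by (intro transl_Nil) (simp add: Cons_verts)
  then have "T [a, b] \<in> H" "T [a, b] \<noteq> id"
    using G_T[of "[a, b]"] by (auto simp: H_iff simp del: transl_simps)
  then show "carrier (perm_grp H) \<noteq> {\<one>\<^bsub>perm_grp H\<^esub>}"
    by auto
  fix N assume "N \<lhd> perm_grp H"
  then interpret N: normal N "perm_grp H" .
  have sub: "N \<subseteq> H"
    using N.subset by simp
  have N: "normal_in_H N"
    unfolding normal_in_H_def
    using sub subgroup.one_closed[OF N.subgroup_axioms] subgroup.m_closed[OF N.subgroup_axioms]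
      subgroup.m_inv_closed[OF N.subgroup_axioms] N.inv_op_closed2 inv_H by (simp add: subset_iff)
  show "N = {\<one>\<^bsub>perm_grp H\<^esub>} \<or> N = carrier (perm_grp H)"
  proof (cases "N = {id}")
    case False
    then have nt: "\<exists>g\<in>N. g \<noteq> id"
      using N unfolding normal_in_H_def by auto
    define N' where "N' = (\<lambda>g. L a \<circ> g \<circ> L a) ` N"
    have N': "normal_in_H N'"
      unfolding N'_def by (rule normal_in_H_L[OF N])
    obtain g where g: "g \<in> N" "g \<noteq> id"
      using nt by blast
    have LL: "L a \<circ> (L a \<circ> g \<circ> L a) \<circ> L a = g" for g
      by (simp add: fun_eq_iff)
    have "L a \<circ> g \<circ> L a \<noteq> id"
    proof
      assume "L a \<circ> g \<circ> L a = id"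
      then have "g = L a \<circ> id \<circ> L a"
        using LL[of g] by metis
      then show False
        using g(2) by (simp add: fun_eq_iff)
    qed
    then have nt': "\<exists>g\<in>N'. g \<noteq> id"
      unfolding N'_def using g(1) by blast
    have LK: "L a \<circ> K \<pi> \<circ> L a \<in> N" if "\<pi> \<in> F'" for \<pi>
      using L_K_in_N[OF N nt ab(1) gen that] .
    have K: "K \<pi> \<in> N" if \<pi>: "\<pi> \<in> F'" for \<pi>
    proof -
      obtain g where "g \<in> N" "L a \<circ> K \<pi> \<circ> L a = L a \<circ> g \<circ> L a"
        using L_K_in_N[OF N' nt' ab(1) gen \<pi>] unfolding N'_def by blast
      then show ?thesis
        using LL by metis
    qed
    have "H \<subseteq> N"
    proof
      fix h assume "h \<in> H"
      then show "h \<in> N"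
        using H_subset_M[OF ab(1), of N h] N_closed(3)[OF N nt] N_closed(4)[OF N nt] K LK by blast
    qed
    then show ?thesis
      using sub by auto
  qed simp
qed

end

section \<open>Asymptotic dimension\<close>

text \<open>A metric-free sufficient condition for asymptotic dimension at most one: \<open>B\<close> plays the role
  of a ball, and the chains with steps in \<open>B\<close> inside one colour class have bounded extent.\<close>

definition two_colour_chains :: "('c, 'd) monoid_scheme \<Rightarrow> bool" where
  "two_colour_chains G \<longleftrightarrow> (\<forall>B. finite B \<and> B \<subseteq> carrier G \<longrightarrow> (\<exists>(c :: 'c \<Rightarrow> bool) Q. finite Q \<and>
     (\<forall>x\<in>carrier G. \<forall>y. (x, y) \<in> {(x, y). x \<in> carrier G \<and> y \<in> carrier G \<and> c x = c y
         \<and> inv\<^bsub>G\<^esub> x \<otimes>\<^bsub>G\<^esub> y \<in> B}\<^sup>* \<longrightarrow> inv\<^bsub>G\<^esub> x \<otimes>\<^bsub>G\<^esub> y \<in> Q)))"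

text \<open>The colouring is pulled back along the isomorphism. As the condition mentions no
  generating set, nothing has to be said about word lengths in the two groups.\<close>

lemma two_colour_chains_iso:
  assumes "group G" "group K" "\<psi> \<in> iso K G" "two_colour_chains G"
  shows "two_colour_chains K"
  unfolding two_colour_chains_def
proof (intro allI impI)
  interpret \<psi>: group_hom K G \<psi>
    using assms by (simp add: group_hom_def group_hom_axioms_def iso_def)
  have inj: "inj_on \<psi> (carrier K)"
    using assms(3) by (simp add: iso_def bij_betw_def)
  fix B assume B: "finite B \<and> B \<subseteq> carrier K"
  define E where "E c = {(x, y). x \<in> carrier G \<and> y \<in> carrier G \<and> c x = c y
         \<and> inv\<^bsub>G\<^esub> x \<otimes>\<^bsub>G\<^esub> y \<in> \<psi> ` B}" for c :: "'a \<Rightarrow> bool"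
  have "finite (\<psi> ` B) \<and> \<psi> ` B \<subseteq> carrier G"
    using B \<psi>.hom_closed by blast
  then obtain c Q where Q: "finite Q"
    "\<And>x y. x \<in> carrier G \<Longrightarrow> (x, y) \<in> (E c)\<^sup>* \<Longrightarrow> inv\<^bsub>G\<^esub> x \<otimes>\<^bsub>G\<^esub> y \<in> Q"
    using assms(4) unfolding two_colour_chains_def E_def by meson
  define E' where "E' = {(x, y). x \<in> carrier K \<and> y \<in> carrier K \<and> (c \<circ> \<psi>) x = (c \<circ> \<psi>) y
         \<and> inv\<^bsub>K\<^esub> x \<otimes>\<^bsub>K\<^esub> y \<in> B}"
  define Q' where "Q' = {x \<in> carrier K. \<psi> x \<in> Q}"
  have step: "(\<psi> x, \<psi> y) \<in> E c" if "(x, y) \<in> E'" for x y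
  proof -
    have "\<psi> (inv\<^bsub>K\<^esub> x \<otimes>\<^bsub>K\<^esub> y) = inv\<^bsub>G\<^esub> \<psi> x \<otimes>\<^bsub>G\<^esub> \<psi> y"
      using that by (simp add: E'_def)
    moreover have "\<psi> (inv\<^bsub>K\<^esub> x \<otimes>\<^bsub>K\<^esub> y) \<in> \<psi> ` B"
      using that by (intro imageI) (simp add: E'_def)
    ultimately have "inv\<^bsub>G\<^esub> \<psi> x \<otimes>\<^bsub>G\<^esub> \<psi> y \<in> \<psi> ` B"
      by metis
    then show ?thesis
      using that by (simp add: E_def E'_def)
  qed
  have "inv\<^bsub>K\<^esub> x \<otimes>\<^bsub>K\<^esub> y \<in> Q'" if x: "x \<in> carrier K" and "(x, y) \<in> E'\<^sup>*" for x y
  proof -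
    have "(\<psi> x, \<psi> y) \<in> (E c)\<^sup>* \<and> y \<in> carrier K"
      using that(2)
    proof induction
      case (step y z)
      then show ?case
        using \<open>\<And>x y. (x, y) \<in> E' \<Longrightarrow> (\<psi> x, \<psi> y) \<in> E c\<close>[of y z]
        by (auto simp: E'_def intro: rtrancl_into_rtrancl)
    qed (use x in auto)
    then show ?thesis
      using Q(2)[of "\<psi> x" "\<psi> y"] x by (simp add: Q'_def)
  qed
  moreover have "finite Q'"
    unfolding Q'_def using finite_vimage_IntI[OF Q(1) inj]
    by (rule finite_subset[rotated]) auto
  ultimately show "\<exists>(c :: _ \<Rightarrow> bool) Q. finite Q \<and> (\<forall>x\<in>carrier K. \<forall>y. (x, y) \<in> {(x, y). x \<in> carrier K
      \<and> y \<in> carrier K \<and> c x = c y \<and> inv\<^bsub>K\<^esub> x \<otimes>\<^bsub>K\<^esub> y \<in> B}\<^sup>* \<longrightarrow> inv\<^bsub>K\<^esub> x \<otimes>\<^bsub>K\<^esub> y \<in> Q)"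
    unfolding E'_def by (intro exI[of _ "c \<circ> \<psi>"] exI[of _ Q']) blast
qed

section \<open>Word metrics on a finitely generated group\<close>

context group
begin

context
  fixes S assumes S: "finite S" "S \<subseteq> carrier G" "generate G S = carrier G"
begin

abbreviation "letters \<equiv> S \<union> m_inv G ` S"

abbreviation "eval_word ws \<equiv> foldr (\<otimes>) ws \<one>"

lemma letters_closed: "letters \<subseteq> carrier G"
  using S(2) by auto

lemma eval_word_closed: "set ws \<subseteq> letters \<Longrightarrow> eval_word ws \<in> carrier G"
proof (induction ws)
  case (Cons a ws)
  then have "a \<in> carrier G" "eval_word ws \<in> carrier G"
    using letters_closed by auto
  then show ?case
    by simp
qed simp

lemma eval_word_append:
  "set us \<subseteq> letters \<Longrightarrow> set ws \<subseteq> letters \<Longrightarrow> eval_word (us @ ws) = eval_word us \<otimes> eval_word ws"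
proof (induction us)
  case (Cons a us)
  then have "a \<in> carrier G" "eval_word us \<in> carrier G" "eval_word ws \<in> carrier G"
    using letters_closed eval_word_closed by auto
  then show ?case
    using Cons by (simp add: m_assoc)
qed (simp add: eval_word_closed)

lemma word_ex: "x \<in> carrier G \<Longrightarrow> \<exists>ws. set ws \<subseteq> letters \<and> eval_word ws = x"
proof -
  assume "x \<in> carrier G"
  then have "x \<in> generate G S"
    by (simp only: S(3))
  then show ?thesis
  proof induction
    case one
    show ?case
      by (rule exI[of _ "[]"]) simp
  next
    case (incl h)
    then show ?case
      using S(2) by (intro exI[of _ "[h]"]) auto
  next
    case (inv h)
    then show ?case
      using S(2) by (intro exI[of _ "[inv h]"]) auto
  next
    case (eng g h)
    then show ?case
      by (metis eval_word_append set_append Un_least)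
  qed
qed

lemma word_len_le: "set ws \<subseteq> letters \<Longrightarrow> word_len G S (eval_word ws) \<le> length ws"
  unfolding word_len_def by (rule Least_le) auto

lemma word_len_ex:
  assumes "x \<in> carrier G"
  shows "\<exists>ws. length ws = word_len G S x \<and> set ws \<subseteq> letters \<and> eval_word ws = x"
proof -
  obtain ws where "set ws \<subseteq> letters" "eval_word ws = x"
    using word_ex[OF assms] by blast
  then have "\<exists>ws'. length ws' = length ws \<and> set ws' \<subseteq> letters \<and> eval_word ws' = x"
    by blast
  then show ?thesis
    unfolding word_len_def by (rule LeastI)
qed

lemma word_len_mult:
  assumes "x \<in> carrier G" "y \<in> carrier G"
  shows "word_len G S (x \<otimes> y) \<le> word_len G S x + word_len G S y"
proof -
  obtain us where us: "length us = word_len G S x" "set us \<subseteq> letters" "eval_word us = x"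
    using word_len_ex[OF assms(1)] by blast
  obtain ws where ws: "length ws = word_len G S y" "set ws \<subseteq> letters" "eval_word ws = y"
    using word_len_ex[OF assms(2)] by blast
  show ?thesis
    using word_len_le[of "us @ ws"] eval_word_append[OF us(2) ws(2)] us ws by simp
qed

lemma word_len_inv:
  assumes "x \<in> carrier G"
  shows "word_len G S (inv x) \<le> word_len G S x"
proof -
  have "set (rev (map (m_inv G) ws)) \<subseteq> letters \<and> eval_word (rev (map (m_inv G) ws)) = inv (eval_word ws)"
    if "set ws \<subseteq> letters" for ws
    using that
  proof (induction ws)
    case (Cons a ws)
    then have a: "inv a \<in> letters" "a \<in> carrier G"
      using S(2) by auto
    have ws: "eval_word ws \<in> carrier G"
      using Cons.prems by (intro eval_word_closed) simp
    have IH: "set (rev (map (m_inv G) ws)) \<subseteq> letters"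
      "eval_word (rev (map (m_inv G) ws)) = inv (eval_word ws)"
      using Cons by auto
    have "eval_word (rev (map (m_inv G) ws) @ [inv a]) = inv (eval_word ws) \<otimes> inv a"
      using eval_word_append[OF IH(1), of "[inv a]"] a IH(2) by simp
    then show ?case
      using IH(1) a ws by (simp add: inv_mult_group)
  qed simp
  moreover obtain ws where "length ws = word_len G S x" "set ws \<subseteq> letters" "eval_word ws = x"
    using word_len_ex[OF assms] by blast
  ultimately show ?thesis
    using word_len_le[of "rev (map (m_inv G) ws)"] by auto
qed

lemma word_len_one: "word_len G S \<one> = 0"
  using word_len_le[of "[]"] by simp

lemma finite_word_ball: "finite {x \<in> carrier G. word_len G S x \<le> n}"
proof (rule finite_subset)
  show "{x \<in> carrier G. word_len G S x \<le> n} \<subseteq> eval_word ` {ws. set ws \<subseteq> letters \<and> length ws \<le> n}"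
    using word_len_ex by fastforce
  show "finite (eval_word ` {ws. set ws \<subseteq> letters \<and> length ws \<le> n})"
    using S(1) by (intro finite_imageI finite_lists_length_le) simp
qed

text \<open>The cover consists of the chain classes: the elements joined by steps in
  \<open>B\<close> within one colour. Finiteness of \<open>Q\<close> bounds their diameters, and a
  ball of radius \<open>R\<close> meets at most one class of each of the two colours.\<close>

lemma asdim_le_1:
  assumes "two_colour_chains G"
  shows "asdim_le G S 1"
  unfolding asdim_le_def
proof
  fix R :: nat
  \<comment> \<open>Two points within \<open>R\<close> of a common centre are within
    \<open>2 * R\<close> of each other, so equal colour makes them a single step of a chain.\<close>
  define B where "B = {x \<in> carrier G. word_len G S x \<le> 2 * R}"
  define E where "E c = {(x, y). x \<in> carrier G \<and> y \<in> carrier G \<and> c x = c y \<and> inv x \<otimes> y \<in> B}"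
    for c :: "'a \<Rightarrow> bool"
  have "finite B \<and> B \<subseteq> carrier G"
    unfolding B_def using finite_word_ball by auto
  then obtain c Q where Q: "finite Q" "\<And>x y. x \<in> carrier G \<Longrightarrow> (x, y) \<in> (E c)\<^sup>* \<Longrightarrow> inv x \<otimes> y \<in> Q"
    using assms unfolding two_colour_chains_def E_def by meson
  have "sym (E c)"
  proof (rule symI)
    fix x y assume xy: "(x, y) \<in> E c"
    then have "inv y \<otimes> x = inv (inv x \<otimes> y)"
      by (auto simp: E_def inv_mult_group)
    then show "(y, x) \<in> E c"
      using xy word_len_inv[of "inv x \<otimes> y"] by (auto simp: E_def B_def)
  qed
  then have symE: "(y, x) \<in> (E c)\<^sup>*" if "(x, y) \<in> (E c)\<^sup>*" for x y
    using that sym_rtrancl symD by metis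
  have carE: "y \<in> carrier G" if "(x, y) \<in> (E c)\<^sup>*" "x \<in> carrier G" for x y
    using that by (induction) (auto simp: E_def)
  define cl where "cl x = {y. (x, y) \<in> (E c)\<^sup>*}" for x
  have cl_eq: "cl x = cl y" if "(x, y) \<in> (E c)\<^sup>*" for x y
    unfolding cl_def using that symE by (blast intro: rtrancl_trans)
  define \<U> where "\<U> = cl ` carrier G"
  have cover: "\<Union>\<U> = carrier G"
    using carE by (auto simp: \<U>_def cl_def)
  have "finite (word_len G S ` Q)"
    using Q(1) by simp
  then obtain D where "\<forall>n\<in>word_len G S ` Q. n \<le> D"
    unfolding finite_nat_set_iff_bounded_le by (rule exE)
  then have D: "word_len G S q \<le> D" if "q \<in> Q" for q
    using that by simp
  have diam: "word_dist G S x y \<le> D" if W: "W \<in> \<U>" "x \<in> W" "y \<in> W" for W x y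
  proof -
    obtain z where z: "z \<in> carrier G" "W = cl z"
      using W(1) by (auto simp: \<U>_def)
    then have "(z, x) \<in> (E c)\<^sup>*" "(z, y) \<in> (E c)\<^sup>*"
      using W by (auto simp: cl_def)
    then have "(x, y) \<in> (E c)\<^sup>*" "x \<in> carrier G"
      using symE rtrancl_trans carE z(1) by metis+
    then show ?thesis
      unfolding word_dist_def using D Q(2) by blast
  qed
  have mult: "finite {W \<in> \<U>. \<exists>y\<in>W. word_dist G S x y \<le> R}
      \<and> card {W \<in> \<U>. \<exists>y\<in>W. word_dist G S x y \<le> R} \<le> 1 + 1" if x: "x \<in> carrier G" for x
  proof -
    define Z where "Z = {W \<in> \<U>. \<exists>y\<in>W. word_dist G S x y \<le> R}"
    have "\<exists>y. \<forall>W\<in>Z. y W \<in> W \<and> word_dist G S x (y W) \<le> R"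
      by (rule bchoice) (auto simp: Z_def)
    then obtain y where y: "\<And>W. W \<in> Z \<Longrightarrow> y W \<in> W" "\<And>W. W \<in> Z \<Longrightarrow> word_dist G S x (y W) \<le> R"
      by blast
    have yc: "y W \<in> carrier G" "W = cl (y W)" if "W \<in> Z" for W
    proof -
      have "W \<in> cl ` carrier G"
        using that by (simp add: Z_def \<U>_def)
      then obtain z where z: "z \<in> carrier G" "W = cl z"
        by blast
      have "y W \<in> cl z"
        using y(1)[OF that] z(2) by simp
      then have "(z, y W) \<in> (E c)\<^sup>*"
        by (simp add: cl_def)
      then show "y W \<in> carrier G" "W = cl (y W)"
        using carE[OF _ z(1)] cl_eq[of z "y W"] z(2) by simp_all
    qed
    have "inj_on (\<lambda>W. c (y W)) Z"
    proof (rule inj_onI)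
      fix W W' assume W: "W \<in> Z" "W' \<in> Z" "c (y W) = c (y W')"
      have "inv (y W) \<otimes> y W' = inv (inv x \<otimes> y W) \<otimes> (inv x \<otimes> y W')"
        using yc(1)[OF W(1)] yc(1)[OF W(2)] x
        by (simp add: inv_mult_group m_assoc) (simp flip: m_assoc)
      then have "word_len G S (inv (y W) \<otimes> y W')
          \<le> word_len G S (inv (inv x \<otimes> y W)) + word_len G S (inv x \<otimes> y W')"
        using yc(1)[OF W(1)] yc(1)[OF W(2)] x by (simp only:) (intro word_len_mult; simp)
      also have "\<dots> \<le> R + R"
        using y(2)[OF W(1)] y(2)[OF W(2)] word_len_inv[of "inv x \<otimes> y W"] yc(1)[OF W(1)] x
        unfolding word_dist_def by (intro add_mono) auto
      finally have "(y W, y W') \<in> E c"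
        using yc(1)[OF W(1)] yc(1)[OF W(2)] W(3) by (simp add: E_def B_def)
      then have "cl (y W) = cl (y W')"
        by (intro cl_eq) simp
      then show "W = W'"
        using yc(2)[OF W(1)] yc(2)[OF W(2)] by simp
    qed
    then have "finite Z \<and> card Z \<le> card (UNIV :: bool set)"
      using card_inj_on_le[of "\<lambda>W. c (y W)" Z UNIV] inj_on_finite[of "\<lambda>W. c (y W)" Z UNIV] by simp
    then show ?thesis
      by (simp add: Z_def)
  qed
  show "\<exists>\<U>. \<Union> \<U> = carrier G \<and> (\<exists>D. \<forall>W\<in>\<U>. \<forall>x\<in>W. \<forall>y\<in>W. word_dist G S x y \<le> D) \<and>
      (\<forall>x\<in>carrier G. finite {W \<in> \<U>. \<exists>y\<in>W. word_dist G S x y \<le> R}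
        \<and> card {W \<in> \<U>. \<exists>y\<in>W. word_dist G S x y \<le> R} \<le> 1 + 1)"
    using cover diam mult by (intro exI[of _ \<U>] conjI exI[of _ D]) blast+
qed

text \<open>At scale \<open>1\<close> a cover of multiplicity one cannot separate an element from its neighbours in
  the Cayley graph, so a single bounded set would contain the whole group.\<close>

lemma not_asdim_le_0:
  assumes "infinite (carrier G)"
  shows "\<not> asdim_le G S 0"
proof
  assume "asdim_le G S 0"
  then obtain \<U> D where U: "\<Union>\<U> = carrier G"
    "\<And>W x y. W \<in> \<U> \<Longrightarrow> x \<in> W \<Longrightarrow> y \<in> W \<Longrightarrow> word_dist G S x y \<le> D"
    "\<And>x. x \<in> carrier G \<Longrightarrow> finite {W \<in> \<U>. \<exists>y\<in>W. word_dist G S x y \<le> 1}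
      \<and> card {W \<in> \<U>. \<exists>y\<in>W. word_dist G S x y \<le> 1} \<le> 0 + 1"
    unfolding asdim_le_def by meson
  have uniq: "W = W'" if "x \<in> W" "y \<in> W'" "W \<in> \<U>" "W' \<in> \<U>" "word_dist G S x y \<le> 1" for x y W W'
  proof -
    have x: "x \<in> carrier G"
      using that U(1) by blast
    have "W \<in> {W \<in> \<U>. \<exists>y\<in>W. word_dist G S x y \<le> 1}"
      using that x word_len_one by (auto simp: word_dist_def intro!: bexI[of _ x])
    moreover have "W' \<in> {W \<in> \<U>. \<exists>y\<in>W. word_dist G S x y \<le> 1}"
      using that by auto
    ultimately show ?thesis
      using U(3)[OF x] card_le_Suc0_iff_eq by (metis (no_types, lifting) One_nat_def add_0)
  qed
  have "\<one> \<in> \<Union>\<U>"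
    by (simp add: U(1))
  then obtain W where W: "W \<in> \<U>" "\<one> \<in> W"
    by (rule UnionE)
  have "eval_word ws \<in> W" if "set ws \<subseteq> letters" for ws
    using that
  proof (induction ws rule: rev_induct)
    case (snoc a ws)
    then have a: "a \<in> carrier G" "set [a] \<subseteq> letters" and ws: "eval_word ws \<in> carrier G" "eval_word ws \<in> W"
      using letters_closed eval_word_closed by auto
    have e: "eval_word (ws @ [a]) = eval_word ws \<otimes> a"
      using eval_word_append[of ws "[a]"] snoc.prems a by simp
    then obtain W' where W': "W' \<in> \<U>" "eval_word ws \<otimes> a \<in> W'"
      using a ws U(1) by (metis UnionE m_closed)
    have "inv (eval_word ws) \<otimes> (eval_word ws \<otimes> a) = a"
      using a ws by (simp flip: m_assoc)
    then have "word_dist G S (eval_word ws) (eval_word ws \<otimes> a) \<le> 1"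
      using word_len_le[OF a(2)] a(1) by (simp add: word_dist_def)
    then show ?case
      using uniq[OF ws(2) W'(2) W(1) W'(1)] W'(2) e by simp
  qed (use W in simp)
  then have "carrier G \<subseteq> W"
    using word_ex by blast
  then have "word_len G S x \<le> D" if "x \<in> carrier G" for x
    using U(2)[OF W(1,2), of x] that by (auto simp: word_dist_def)
  then have "carrier G \<subseteq> {x \<in> carrier G. word_len G S x \<le> D}"
    by blast
  then show False
    using assms finite_word_ball finite_subset by blast
qed

end

lemma asdim_oneI:
  assumes "fin_gen G" "infinite (carrier G)" "two_colour_chains G"
  shows "asdim_one G"
  using assms asdim_le_1 not_asdim_le_0 unfolding asdim_one_def by blast

end

text \<open>A change of at most \<open>m\<close> moves between annuli of width \<open>Suc m\<close>
  by at most one index, and equal parity excludes a change by exactly one.\<close>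

lemma same_div_of_parity:
  fixes a b :: nat
  assumes "a \<le> b + m" "b \<le> a + m" "even (a div Suc m) = even (b div Suc m)"
  shows "a div Suc m = b div Suc m"
proof -
  have "a div Suc m \<le> (b + Suc m) div Suc m" "b div Suc m \<le> (a + Suc m) div Suc m"
    using assms by (intro div_le_mono; simp)+
  moreover have "(b + Suc m) div Suc m = Suc (b div Suc m)" "(a + Suc m) div Suc m = Suc (a div Suc m)"
    by (rule div_add_self2[THEN trans]; simp del: add_Suc_right)+
  ultimately have "a div Suc m \<le> Suc (b div Suc m)" "b div Suc m \<le> Suc (a div Suc m)"
    by (simp_all only:)
  then show ?thesis
    using assms(3) by (metis even_Suc le_Suc_eq le_antisym)
qed

section \<open>Finiteness of balls and of chains in \<open>H\<close>\<close>

context local_action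
begin

lemma finite_ball: "finite {v \<in> V. length v \<le> n}"
proof (rule finite_subset)
  show "{v \<in> V. length v \<le> n} \<subseteq> {w. set w \<subseteq> \<Omega> \<and> length w \<le> n}"
    using verts_subset by blast
qed (rule finite_lists_length_le[OF finite_\<Omega>])

text \<open>By rigidity such an automorphism is determined by its restriction to the ball of radius
  \<open>Suc m\<close>, which it maps into a ball of radius \<open>r + Suc m\<close>.\<close>

lemma finite_bounded_Aut:
  "finite {g \<in> Aut \<Omega>. length (g []) \<le> r \<and> (\<forall>v\<in>V. length v > m \<longrightarrow> sigma \<Omega> g v \<in> F)}" (is "finite ?A")
proof -
  define D where "D = {v \<in> V. length v \<le> Suc m}"
  have "inj_on (\<lambda>g. restrict g D) ?A"
  proof (rule inj_onI)
    fix g h assume gh: "g \<in> ?A" "h \<in> ?A" "restrict g D = restrict h D"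
    have "g v = h v" if "v \<in> D" for v
      using fun_cong[OF gh(3), of v] that by simp
    then show "g = h"
      using gh(1,2) by (intro Aut_eqI[of g h m]) (auto simp: D_def)
  qed
  moreover have "(\<lambda>g. restrict g D) ` ?A \<subseteq> PiE D (\<lambda>_. {v \<in> V. length v \<le> r + Suc m})"
  proof (intro image_subsetI PiE_I)
    fix g v assume g: "g \<in> ?A" and v: "v \<in> D"
    then have "length (g v) \<le> length (g []) + length v"
      using Aut_length_Nil[of g \<Omega> v] by (auto simp: D_def)
    then show "restrict g D v \<in> {v \<in> V. length v \<le> r + Suc m}"
      using g v Aut_in_verts[of g \<Omega> v] by (auto simp: D_def)
  qed simp
  moreover have "finite (PiE D (\<lambda>_. {v \<in> V. length v \<le> r + Suc m}))"
    unfolding D_def by (intro finite_PiE finite_ball)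
  ultimately show ?thesis
    by (meson finite_imageD finite_subset)
qed

lemma infinite_H: "infinite H"
proof -
  obtain a b where ab: "a \<in> \<Omega>" "b \<in> \<Omega>" "a \<noteq> b"
    using third_colour by metis
  define w where "w n = concat (replicate n [a, b])" for n
  have w: "w n \<in> V \<and> length (w n) = 2 * n \<and> (w n \<noteq> [] \<longrightarrow> hd (w n) = a)" for n
    using ab by (induction n) (auto simp: w_def Cons_verts)
  have "T (w n) \<in> H" for n
    using w[of n] transl_Nil[of "w n" \<Omega>] G_T by (simp add: H_iff)
  moreover have "inj (\<lambda>n. T (w n))"
  proof (rule injI)
    fix m n assume "T (w m) = T (w n)"
    then have "w m = w n"
      using transl_Nil w by metis
    then show "m = n"
      using w by (metis mult_left_cancel zero_neq_numeral)
  qed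
  ultimately show ?thesis
    by (auto simp: infinite_iff_countable_subset)
qed

text \<open>Along a chain starting at \<open>x\<close>, three things persist for its current element
  \<open>y\<close>: the annulus index \<open>k\<close> of \<open>y []\<close>, the first
  \<open>n\<close> letters of \<open>y []\<close>, and a bound on the singularities of the inverse
  of \<open>ginv x \<circ> y\<close>. The first two bound the distance from \<open>x []\<close> to
  \<open>y []\<close>, and this sustains the third.\<close>

lemma two_colour_chains_H: "two_colour_chains (perm_grp H)"
  unfolding two_colour_chains_def
proof (intro allI impI)
  fix B assume "finite B \<and> B \<subseteq> carrier (perm_grp H)"
  then have B: "finite B" "B \<subseteq> H"
    by simp_all
  have "finite ((\<lambda>s. length (s [])) ` B)"
    using B(1) by simp
  then obtain \<rho> where "\<forall>n\<in>(\<lambda>s. length (s [])) ` B. n \<le> \<rho>"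
    unfolding finite_nat_set_iff_bounded_le by (rule exE)
  then have \<rho>: "length (s []) \<le> \<rho>" if "s \<in> B" for s
    using that by simp
  have "finite (sing (ginv s))" if "s \<in> B" for s
    using H_ginv[of s] B(2) that by (auto simp: H_iff G_iff)
  then have "finite (length ` (\<Union>s\<in>B. sing (ginv s)))"
    using B(1) by simp
  then obtain \<rho>' where "\<forall>n\<in>length ` (\<Union>s\<in>B. sing (ginv s)). n \<le> \<rho>'"
    unfolding finite_nat_set_iff_bounded_le by (rule exE)
  then have \<rho>': "length v \<le> \<rho>'" if "s \<in> B" "v \<in> sing (ginv s)" for s v
    using that by simp
  \<comment> \<open>Annuli are wider than any step, so that a step within one colour cannot leave
    its annulus. The radius \<open>r\<close> allows for two descents of length
    \<open>M + \<rho>\<close> from a common prefix.\<close>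
  define M where "M = Suc \<rho>"
  define r where "r = 2 * (M + \<rho>)"
  define c :: "('a list \<Rightarrow> 'a list) \<Rightarrow> bool" where "c h = even (length (h []) div M)" for h
  define Q where "Q = {z \<in> H. length (z []) \<le> r \<and> (\<forall>v\<in>sing (ginv z). length v \<le> r + \<rho>')}"
  define E where "E = {(x, y). x \<in> H \<and> y \<in> H \<and> c x = c y \<and> ginv x \<circ> y \<in> B}"
  have "Q \<subseteq> ginv ` {g \<in> Aut \<Omega>. length (g []) \<le> r \<and> (\<forall>v\<in>V. length v > r + \<rho>' \<longrightarrow> sigma \<Omega> g v \<in> F)}"
  proof
    fix z assume z: "z \<in> Q"
    then have zA: "z \<in> Aut \<Omega>"
      using H_Aut by (simp add: Q_def)
    have "z = ginv (ginv z)"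
      using inv_inv_eq[OF Aut_bij[OF zA]] by simp
    moreover have "ginv z \<in> {g \<in> Aut \<Omega>. length (g []) \<le> r \<and> (\<forall>v\<in>V. length v > r + \<rho>' \<longrightarrow> sigma \<Omega> g v \<in> F)}"
      using z zA by (fastforce simp: Q_def Aut_inverse length_ginv sing_def)
    ultimately show "z \<in> ginv ` {g \<in> Aut \<Omega>. length (g []) \<le> r
        \<and> (\<forall>v\<in>V. length v > r + \<rho>' \<longrightarrow> sigma \<Omega> g v \<in> F)}"
      by (rule image_eqI)
  qed
  then have "finite Q"
    using finite_bounded_Aut finite_surj by blast
  moreover have "ginv x \<circ> y \<in> Q" if x: "x \<in> H" and "(x, y) \<in> E\<^sup>*" for x y
  proof -
    define k where "k = length (x []) div M"
    \<comment> \<open>A step shortens the reliable part of a word of length at least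
      \<open>k * M\<close> by at most \<open>\<rho>\<close>, so these \<open>n\<close> letters
      survive every step. The subtraction truncates to 0 near the root, where the common prefix is
      the root itself.\<close>
    define n where "n = k * M - \<rho>"
    have xA: "x \<in> Aut \<Omega>"
      by (rule H_Aut[OF x])
    have close: "length ((ginv x \<circ> y) []) \<le> r"
      if y: "y \<in> H" "length (y []) div M = k" "take n (y []) = take n (x [])" for y
    proof -
      define p where "p = take n (x [])"
      have kM: "k * M \<le> length (x [])" "k * M \<le> length (y [])"
        using y(2) unfolding k_def by (metis div_times_less_eq_dividend)+
      have "length (x []) < k * M + M" "length (y []) < k * M + M"
        using dividend_less_div_times[of M "length (x [])"] dividend_less_div_times[of M "length (y [])"]
        unfolding y(2) by (simp_all add: k_def M_def)
      moreover have "length p = n"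
        using kM by (simp add: p_def n_def)
      ultimately have d: "length (drop n (x [])) \<le> M + \<rho>" "length (drop n (y [])) \<le> M + \<rho>"
        unfolding n_def by auto
      have split: "x [] = p @ drop n (x [])" "y [] = p @ drop n (y [])"
        unfolding p_def using y(3) by (metis append_take_drop_id)+
      have yV: "y [] \<in> V" "x [] \<in> V"
        using Aut_in_verts[OF H_Aut[OF y(1)], of "[]"] Aut_in_verts[OF xA, of "[]"] by simp_all
      have "length (ginv x p) \<le> length (ginv x (x [])) + length (drop n (x []))"
        using Aut_length[OF Aut_inverse[OF xA], of p "drop n (x [])"] split(1) yV by simp
      moreover have "length (ginv x (y [])) \<le> length (ginv x p) + length (drop n (y []))"
        using Aut_length[OF Aut_inverse[OF xA], of p "drop n (y [])"] split(2) yV by simp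
      ultimately show ?thesis
        using d Aut_ginv(1)[OF xA, of "[]"] by (simp add: r_def)
    qed
    have "y \<in> H \<and> length (y []) div M = k \<and> take n (y []) = take n (x [])
        \<and> (\<forall>v\<in>sing (ginv (ginv x \<circ> y)). length v \<le> r + \<rho>')"
      using that(2)
    proof induction
      case base
      have "ginv (ginv x \<circ> x) = id"
        unfolding Aut_cancel(1)[OF xA] by (rule inv_id)
      then have "sing (ginv (ginv x \<circ> x)) = {}"
        by (simp only: sing_empty)
      then show ?case
        using x by (simp only: k_def) simp
    next
      case (step y z)
      define s where "s = ginv y \<circ> z"
      have s: "s \<in> B" "z \<in> H" "c y = c z"
        using step.hyps by (auto simp: E_def s_def)
      have y: "y \<in> H" "length (y []) div M = k" "take n (y []) = take n (x [])"
        and ysing: "\<And>v. v \<in> sing (ginv (ginv x \<circ> y)) \<Longrightarrow> length v \<le> r + \<rho>'"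
        using step.IH by blast+
      have A: "y \<in> Aut \<Omega>" "s \<in> Aut \<Omega>" "ginv x \<circ> y \<in> Aut \<Omega>"
        using y s B H_Aut xA Aut_comp Aut_inverse by blast+
      have z: "z = y \<circ> s"
        by (simp add: s_def fun_eq_iff Aut_ginv[OF A(1)])
      have sV: "s [] \<in> V" "length (s []) \<le> \<rho>"
        using Aut_in_verts[OF A(2), of "[]"] \<rho>[OF s(1)] by simp_all
      note len = Aut_length[OF A(1), of "[]" "s []", simplified, OF sV(1)]
      have zk: "length (z []) div M = k"
        using same_div_of_parity[of "length (z [])" "length (y [])" \<rho>] len sV(2) s(3) y(2)
        by (simp add: z c_def M_def)
      have "k * M \<le> length (y [])"
        using y(2) by (metis div_times_less_eq_dividend)
      then have "n \<le> length (y []) - length (s [])"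
        using sV(2) by (simp add: n_def)
      then have tz: "take n (z []) = take n (y [])"
        using arg_cong[OF conjunct2[OF conjunct2[OF len]], of "take n"] by (simp add: z min_def split: if_splits)
      have "ginv x \<circ> z = (ginv x \<circ> y) \<circ> s"
        by (simp add: z comp_assoc)
      then have "ginv (ginv x \<circ> z) = ginv s \<circ> ginv (ginv x \<circ> y)"
        using ginv_comp[OF A(3,2)] by simp
      moreover have "ginv (ginv (ginv x \<circ> y)) = ginv x \<circ> y"
        by (rule inv_inv_eq[OF Aut_bij[OF A(3)]])
      ultimately have "sing (ginv (ginv x \<circ> z))
          \<subseteq> sing (ginv (ginv x \<circ> y)) \<union> (ginv x \<circ> y) ` sing (ginv s)"
        using sing_comp[OF Aut_inverse[OF A(2)] Aut_inverse[OF A(3)]] by simp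
      \<comment> \<open>New singularities are images of points within \<open>\<rho>'\<close> of the
        root, and the root itself is displaced by at most \<open>r\<close>. The bound
        \<open>r + \<rho>'\<close> therefore does not grow along the chain.\<close>
      moreover have "length ((ginv x \<circ> y) v) \<le> r + \<rho>'" if v: "v \<in> sing (ginv s)" for v
      proof -
        have "v \<in> V"
          using v by (simp add: sing_def)
        then show ?thesis
          using Aut_length_Nil(1)[OF A(3), of v] close[OF y] \<rho>'[OF s(1) v] by linarith
      qed
      ultimately have "length v \<le> r + \<rho>'" if "v \<in> sing (ginv (ginv x \<circ> z))" for v
        using that ysing by blast
      then show ?case
        using s(2) zk tz[unfolded y(3)] by blast
    qed
    then show ?thesis
      using close[of y] H_comp[OF H_ginv[OF x]] unfolding Q_def by blast
  qed
  moreover have "{(x, y). x \<in> carrier (perm_grp H) \<and> y \<in> carrier (perm_grp H) \<and> c x = c y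
      \<and> inv\<^bsub>perm_grp H\<^esub> x \<otimes>\<^bsub>perm_grp H\<^esub> y \<in> B} = E"
    using inv_H by (auto simp: E_def)
  ultimately show "\<exists>(c :: _ \<Rightarrow> bool) Q. finite Q \<and> (\<forall>x\<in>carrier (perm_grp H). \<forall>y. (x, y) \<in> {(x, y). x \<in> carrier (perm_grp H)
      \<and> y \<in> carrier (perm_grp H) \<and> c x = c y \<and> inv\<^bsub>perm_grp H\<^esub> x \<otimes>\<^bsub>perm_grp H\<^esub> y \<in> B}\<^sup>*
      \<longrightarrow> inv\<^bsub>perm_grp H\<^esub> x \<otimes>\<^bsub>perm_grp H\<^esub> y \<in> Q)"
    using inv_H by (intro exI[of _ c] exI[of _ Q]) simp
qed

lemma asdim_one_H: "asdim_one (perm_grp H)"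
  using group.asdim_oneI[OF group_H fin_gen_H] infinite_H two_colour_chains_H by simp

end

section \<open>Torsion\<close>

lemma adj_verts: "adj \<Omega> v w \<Longrightarrow> v \<in> verts \<Omega>" "adj \<Omega> v w \<Longrightarrow> w \<in> verts \<Omega>"
  by (auto simp: adj_def intro: nb_verts)

lemma adj_sym: "adj \<Omega> v w \<Longrightarrow> adj \<Omega> w v"
  by (metis adj_def nb_nb nb_verts)

lemma adj_shorter:
  assumes "adj \<Omega> v w" "length w \<le> length v"
  shows "w = butlast v"
  using assms by (auto simp: adj_def nb_def split: if_splits)

lemma adj_parity: "adj \<Omega> v w \<Longrightarrow> even (length w) \<longleftrightarrow> odd (length v)"
  by (auto simp: adj_def even_length_nb)

lemma Aut_adj: "g \<in> Aut \<Omega> \<Longrightarrow> adj \<Omega> v w \<Longrightarrow> adj \<Omega> (g v) (g w)"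
  using adj_verts unfolding Aut_iff by metis

lemma Aut_funpow: "g \<in> Aut \<Omega> \<Longrightarrow> g ^^ k \<in> Aut \<Omega>"
proof (induction k)
  case (Suc k)
  then show ?case
    using Aut_comp[of g \<Omega> "g ^^ k"] by (simp only: funpow.simps)
qed (simp only: funpow.simps Aut_id)

text \<open>A periodic path has a vertex of maximal length, and its two neighbours on the path both
  coincide with its parent.\<close>

lemma periodic_path_backtracks:
  assumes adj: "\<And>i. adj \<Omega> (P i) (P (Suc i))" and per: "\<And>i. P (i + n) = P i" and "n > 0"
  shows "\<exists>i. P i = P (i + 2)"
proof -
  have "finite ((\<lambda>i. length (P i)) ` {..<n})" "(\<lambda>i. length (P i)) ` {..<n} \<noteq> {}"
    using assms(3) by auto
  from Max_in[OF this] obtain i where i: "length (P i) = Max ((\<lambda>i. length (P i)) ` {..<n})"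
    by auto
  have "P (j mod n) = P j" for j
  proof -
    have "P (j mod n + k * n) = P (j mod n)" for k
      using per by (induction k) (simp_all add: add.assoc[symmetric] add.commute[of n])
    from this[of "j div n"] show ?thesis
      by (simp add: mod_div_mult_eq)
  qed
  moreover have "length (P (j mod n)) \<le> length (P i)" for j
    unfolding i using assms(3) by (intro Max_ge) auto
  ultimately have le: "length (P j) \<le> length (P i)" for j
    by metis
  \<comment> \<open>The predecessor of the maximal position \<open>i\<close>, shifted by one period
    so that it exists also for \<open>i = 0\<close>.\<close>
  define k where "k = i + n - 1"
  have k: "Suc k = i + n" "P (Suc k) = P i"
    using assms(3) per by (auto simp: k_def)
  have "P k = butlast (P (Suc k))"
    using le[of k] adj_sym[OF adj[of k]] unfolding k(2) by (intro adj_shorter)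
  moreover have "P (Suc (Suc k)) = butlast (P (Suc k))"
    using le[of "Suc (Suc k)"] adj[of "Suc k"] unfolding k(2) by (intro adj_shorter)
  ultimately show ?thesis
    by (intro exI[of _ k]) simp
qed

lemma verts_connected:
  assumes "v \<in> verts \<Omega>"
  shows "\<exists>p n. p 0 = [] \<and> p n = v \<and> (\<forall>i<n. adj \<Omega> (p i) (p (Suc i)))"
proof (intro exI[of _ "\<lambda>i. take i v"] exI[of _ "length v"] conjI allI impI)
  fix i assume i: "i < length v"
  have "take i v @ [v ! i] \<in> verts \<Omega>"
    using append_vertsD[of "take (Suc i) v" "drop (Suc i) v" \<Omega>] assms i
    by (simp add: take_Suc_conv_app_nth id_take_nth_drop[symmetric])
  then show "adj \<Omega> (take i v) (take (Suc i) v)"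
    using i unfolding snoc_verts adj_def take_Suc_conv_app_nth[OF i]
    by (auto simp: nb_def intro!: bexI[of _ "v ! i"])
qed simp_all

text \<open>Take a shortest path from a vertex to its image and join its translates under the powers
  of \<open>g\<close>. Torsion makes the resulting path periodic, so it backtracks, which
  contradicts minimality. Length one, an inverted edge, is excluded since \<open>g\<close> preserves
  types.\<close>

lemma torsion_fixes_vertex:
  assumes g: "g \<in> Aut \<Omega>" and even: "even (length (g []))" and "g ^^ q = id" "q > 0"
  shows "\<exists>v\<in>verts \<Omega>. g v = v"
proof (rule ccontr)
  assume nofix: "\<not> (\<exists>v\<in>verts \<Omega>. g v = v)"
  define path where "path p n \<longleftrightarrow> p 0 \<in> verts \<Omega> \<and> p n = g (p 0) \<and> (\<forall>i<n. adj \<Omega> (p i) (p (Suc i)))"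
    for p :: "nat \<Rightarrow> 'a list" and n
  have "g [] \<in> verts \<Omega>"
    using Aut_in_verts[OF g, of "[]"] by simp
  then obtain p n where "p 0 = []" "p n = g []" "\<forall>i<n. adj \<Omega> (p i) (p (Suc i))"
    using verts_connected by metis
  then have "path p n"
    by (simp add: path_def)
  then have ex: "\<exists>n p. path p n"
    by (intro exI)
  define n where "n = (LEAST n. \<exists>p. path p n)"
  obtain p where p: "path p n"
    using LeastI_ex[OF ex] unfolding n_def by (rule exE)
  have minimal: "n \<le> m" if "path p' m" for p' m
    unfolding n_def using that by (intro Least_le) blast
  have p0: "p 0 \<in> verts \<Omega>" "p n = g (p 0)" and adj: "\<And>i. i < n \<Longrightarrow> adj \<Omega> (p i) (p (Suc i))"
    using p by (auto simp: path_def)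
  have "n \<noteq> 0"
    using p0 nofix by (intro notI) auto
  moreover have "n \<noteq> 1"
  proof
    assume "n = 1"
    then have "adj \<Omega> (p 0) (g (p 0))"
      using adj[of 0] p0(2) by simp
    then show False
      using adj_parity Aut_parity[OF g p0(1)] even by metis
  qed
  ultimately have n: "n \<ge> 2"
    by simp
  define P where "P i = (g ^^ (i div n)) (p (i mod n))" for i
  \<comment> \<open>The formula includes \<open>j = n\<close>: the end of one translate is the
    beginning of the next, because \<open>p n = g (p 0)\<close>.\<close>
  have P: "P (k * n + j) = (g ^^ k) (p j)" if "j \<le> n" for k j
  proof (cases "j = n")
    case True
    then have "(k * n + j) div n = Suc k" "(k * n + j) mod n = 0"
      using n by simp_all
    then show ?thesis
      using True p0(2) by (simp add: P_def funpow_swap1)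
  next
    case False
    then show ?thesis
      using that n by (simp add: P_def)
  qed
  have decomp: "\<exists>k j. i = k * n + j \<and> j < n" for i
    using n by (intro exI[of _ "i div n"] exI[of _ "i mod n"]) simp
  have "adj \<Omega> (P i) (P (Suc i))" for i
  proof -
    obtain k j where i: "i = k * n + j" "j < n"
      using decomp by blast
    then show ?thesis
      using P[of j k] P[of "Suc j" k] Aut_adj[OF Aut_funpow[OF g] adj[of j], of k] by simp
  qed
  moreover have "P (i + q * n) = P i" for i
  proof -
    have "g ^^ (i div n + q) = g ^^ (i div n)"
      using assms(3) by (simp add: funpow_add)
    then show ?thesis
      using n by (simp add: P_def add.commute)
  qed
  moreover have "q * n > 0"
    using n assms(4) by simp
  ultimately obtain i where i: "P i = P (i + 2)"
    using periodic_path_backtracks by blast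
  obtain k j where kj: "i = k * n + j" "j < n"
    using decomp by blast
  \<comment> \<open>A backtrack inside a translate lets two edges be cut out of \<open>p\<close>. A
    backtrack where two translates meet lets the first and last edge be dropped, which gives a path
    from \<open>p 1\<close> to \<open>g (p 1)\<close>. Both are shorter by two.\<close>
  show False
  proof (cases "j + 2 \<le> n")
    case True
    then have "(g ^^ k) (p j) = (g ^^ k) (p (j + 2))"
      using i kj P[of j k] P[of "j + 2" k] by (simp add: add.assoc)
    then have pj: "p j = p (j + 2)"
      using Aut_inj[OF Aut_funpow[OF g]] by metis
    define p' where "p' i = (if i \<le> j then p i else p (i + 2))" for i
    have "path p' (n - 2)"
      unfolding path_def
    proof (intro conjI allI impI)
      show "p' 0 \<in> verts \<Omega>"
        using p0 by (simp add: p'_def)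
      show "p' (n - 2) = g (p' 0)"
      proof (cases "n - 2 \<le> j")
        case True
        then have "n - 2 = j" "j + 2 = n"
          using \<open>j + 2 \<le> n\<close> by simp_all
        then show ?thesis
          using p0(2) pj by (simp only: p'_def) simp
      next
        case False
        moreover have "n - 2 + 2 = n"
          using n by simp
        ultimately show ?thesis
          using p0(2) unfolding p'_def by (simp only: if_False) simp
      qed
      fix i assume "i < n - 2"
      then show "adj \<Omega> (p' i) (p' (Suc i))"
        using adj[of i] adj[of "i + 2"] pj True by (cases i j rule: linorder_cases) (auto simp: p'_def)
    qed
    then show False
      using minimal[of p' "n - 2"] n by simp
  next
    case False
    then have j: "j = n - 1" "j + 1 = n"
      using kj by auto
    have "P (i + 2) = P (Suc k * n + 1)"
      using kj j by (simp add: algebra_simps)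
    also have "\<dots> = (g ^^ k) (g (p 1))"
      using P[of 1 "Suc k"] n by (simp add: funpow_swap1)
    finally have "(g ^^ k) (p j) = (g ^^ k) (g (p 1))"
      using i kj P[of j k] by simp
    then have pj: "p j = g (p 1)"
      using Aut_inj[OF Aut_funpow[OF g]] by metis
    have "path (\<lambda>i. p (Suc i)) (n - 2)"
      unfolding path_def
    proof (intro conjI allI impI)
      show "p (Suc 0) \<in> verts \<Omega>"
        using adj[of 0] n by (auto dest: adj_verts)
      have "Suc (n - 2) = j"
        using j n by simp
      then show "p (Suc (n - 2)) = g (p (Suc 0))"
        using pj by simp
      fix i assume "i < n - 2"
      then show "adj \<Omega> (p (Suc i)) (p (Suc (Suc i)))"
        by (intro adj) simp
    qed
    then show False
      using minimal[of _ "n - 2"] n by fastforce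
  qed
qed

lemma funpow_mult_fixed: "(f ^^ m) x = x \<Longrightarrow> (f ^^ (m * k)) x = x"
  by (induction k) (simp_all add: funpow_add)

text \<open>An orbit in a set of fewer than \<open>q\<close> points repeats within \<open>q\<close>
  steps, giving a period \<open>m\<close> with 0 < \<open>m\<close> < \<open>q\<close>. It is
  coprime to the period \<open>q\<close>, so 1 is a period by Bezout.\<close>

lemma prime_orbit_fixed:
  assumes "inj g" "(g ^^ q) y = y" "Factorial_Ring.prime (q :: nat)" "finite S" "card S < q" "\<And>i. (g ^^ i) y \<in> S"
  shows "g y = y"
proof -
  have "\<not> inj_on (\<lambda>i. (g ^^ i) y) {..<q}"
  proof
    assume "inj_on (\<lambda>i. (g ^^ i) y) {..<q}"
    then have "q \<le> card S"
      using card_inj_on_le[of "\<lambda>i. (g ^^ i) y" "{..<q}" S] assms(4,6) by auto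
    then show False
      using assms(5) by simp
  qed
  then obtain i j where ij: "i < j" "j < q" "(g ^^ i) y = (g ^^ j) y"
    unfolding inj_on_def by (metis lessThan_iff linorder_neqE_nat)
  define m where "m = j - i"
  have m: "0 < m" "m < q" "j = i + m"
    using ij by (auto simp: m_def)
  have "(g ^^ i) y = (g ^^ i) ((g ^^ m) y)"
    using ij(3) m(3) by (simp add: funpow_add)
  then have gm: "(g ^^ m) y = y"
    using inj_fn[OF assms(1), of i] by (simp add: inj_eq)
  have "\<not> q dvd m"
    using m by (auto dest: dvd_imp_le)
  then have "gcd m q = 1"
    using assms(3) prime_imp_coprime by (metis coprime_iff_gcd_eq_1 coprime_commute)
  then obtain u w where "m * u = q * w + 1"
    using bezout_nat[of m q] m(1) by auto
  then have "(g ^^ (m * u)) y = g ((g ^^ (q * w)) y)"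
    by simp
  then show ?thesis
    using funpow_mult_fixed[OF gm, of u] funpow_mult_fixed[OF assms(2), of w] by simp
qed

text \<open>A fixed vertex has its neighbours permuted; there are fewer than \<open>q\<close> of
  them, so each is fixed. Fixedness spreads from one vertex over the whole tree: first back to the
  root, then outwards.\<close>

lemma no_large_prime_torsion:
  assumes g: "g \<in> Aut \<Omega>" and even: "even (length (g []))" and q: "g ^^ q = id" "Factorial_Ring.prime q"
    and card: "finite \<Omega>" "card \<Omega> < q"
  shows "g = id"
proof -
  have nb_fixed: "g (nb x a) = nb x a" if x: "x \<in> verts \<Omega>" "g x = x" and a: "a \<in> \<Omega>" for x a
  proof (rule prime_orbit_fixed[where q = q and S = "nb x ` \<Omega>"])
    show "inj g"
      using Aut_bij[OF g] by (rule bij_is_inj)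
    show "(g ^^ q) (nb x a) = nb x a"
      using q(1) by simp
    show "card (nb x ` \<Omega>) < q"
      using card card_image_le[OF card(1), of "nb x"] by linarith
    show "(g ^^ i) (nb x a) \<in> nb x ` \<Omega>" for i
    proof (induction i)
      case (Suc i)
      then obtain b where b: "b \<in> \<Omega>" "(g ^^ i) (nb x a) = nb x b"
        by blast
      then show ?case
        using sigma_in_nb[OF g x(1) b(1)] x(2) by auto
    qed (use a in simp)
  qed (use q card in auto)
  obtain v where v: "v \<in> verts \<Omega>" "g v = v"
    using torsion_fixes_vertex[OF g even q(1)] prime_gt_0_nat[OF q(2)] by blast
  have "g [] = []"
    using v
  proof (induction v rule: rev_induct)
    case (snoc a v)
    then show ?case
      using nb_fixed[of "v @ [a]" a] by (simp add: snoc_verts)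
  qed simp
  have "g w = w" if "w \<in> verts \<Omega>" for w
    using that
  proof (induction w rule: rev_induct)
    case (snoc a w)
    then have "w \<in> verts \<Omega>" "a \<in> \<Omega>" "nb w a = w @ [a]"
      by (auto simp: snoc_verts nb_def)
    then show ?case
      using nb_fixed[of w a] snoc.IH by simp
  qed (use \<open>g [] = []\<close> in simp)
  then have "g w = id w" for w
    using permutes_not_in[OF Aut_permutes[OF g], of w] by (cases "w \<in> verts \<Omega>") simp_all
  then show ?thesis
    by blast
qed

section \<open>Transport along isomorphisms\<close>

lemma iso_group_hom: "group G \<Longrightarrow> group K \<Longrightarrow> \<phi> \<in> iso G K \<Longrightarrow> group_hom G K \<phi>"
  by (simp add: group_hom_def group_hom_axioms_def iso_def)

lemma is_simple_iso:
  assumes "is_simple G" "group K" "\<phi> \<in> iso G K"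
  shows "is_simple K"
  unfolding is_simple_def
proof (intro conjI allI impI)
  have G: "group G" "carrier G \<noteq> {\<one>\<^bsub>G\<^esub>}" and simple: "\<And>N. N \<lhd> G \<Longrightarrow> N = {\<one>\<^bsub>G\<^esub>} \<or> N = carrier G"
    using assms(1) unfolding is_simple_def by blast+
  define \<psi> where "\<psi> = inv_into (carrier G) \<phi>"
  have \<psi>: "\<psi> \<in> iso K G"
    unfolding \<psi>_def by (rule group.iso_set_sym[OF G(1) assms(3)])
  interpret \<psi>: group_hom K G \<psi>
    by (rule iso_group_hom[OF assms(2) G(1) \<psi>])
  have inj: "inj_on \<psi> (carrier K)" and surj: "\<psi> ` carrier K = carrier G"
    using \<psi> by (auto simp: iso_def bij_betw_def)
  show "group K"
    by (rule assms(2))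
  show "carrier K \<noteq> {\<one>\<^bsub>K\<^esub>}"
    using surj G(2) by auto
  fix N assume N: "N \<lhd> K"
  have sub: "N \<subseteq> carrier K"
    using N by (meson normal_imp_subgroup subgroup.subset)
  have one: "{\<one>\<^bsub>G\<^esub>} = \<psi> ` {\<one>\<^bsub>K\<^esub>}"
    by simp
  have "\<psi> ` N = \<psi> ` {\<one>\<^bsub>K\<^esub>} \<or> \<psi> ` N = \<psi> ` carrier K"
    using simple[OF iso_normal_subgroup[OF \<psi> assms(2) G(1) N]] unfolding one surj .
  then show "N = {\<one>\<^bsub>K\<^esub>} \<or> N = carrier K"
    using inj_on_image_eq_iff[OF inj sub, of "{\<one>\<^bsub>K\<^esub>}"] inj_on_image_eq_iff[OF inj sub, of "carrier K"]
    by (metis \<psi>.G.one_closed empty_subsetI insert_subset order_refl)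
qed

lemma generate_iso:
  assumes "group G" "group K" "\<phi> \<in> iso G K" "S \<subseteq> carrier G" "generate G S = carrier G"
  shows "generate K (\<phi> ` S) = carrier K"
  using group_hom.generate_img[OF iso_group_hom[OF assms(1-3)] assms(4)] assms(3,5)
  by (simp add: iso_def bij_betw_def)

lemma fin_gen_iso:
  assumes "group G" "group K" "\<phi> \<in> iso G K" "fin_gen G"
  shows "fin_gen K"
proof -
  obtain S where "finite S" "S \<subseteq> carrier G" "generate G S = carrier G"
    using assms(4) unfolding fin_gen_def by blast
  moreover have "\<phi> ` carrier G = carrier K"
    using assms(3) by (simp add: iso_def bij_betw_def)
  ultimately show ?thesis
    using generate_iso[OF assms(1-3)] unfolding fin_gen_def
    by (intro exI[of _ "\<phi> ` S"]) blast
qed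

lemma countable_fin_gen:
  assumes "group G" "fin_gen G"
  shows "countable (carrier G)"
proof -
  obtain S where S: "finite S" "S \<subseteq> carrier G" "generate G S = carrier G"
    using assms(2) unfolding fin_gen_def by blast
  have "carrier G \<subseteq> (\<Union>n. {x \<in> carrier G. word_len G S x \<le> n})"
    by blast
  moreover have "countable (\<Union>n. {x \<in> carrier G. word_len G S x \<le> n})"
    using group.finite_word_ball[OF assms(1) S] by (intro countable_UN) (auto intro: countable_finite)
  ultimately show ?thesis
    using countable_subset by blast
qed

lemma nat_copy:
  assumes "group G" "countable (carrier G)"
  shows "\<exists>(K :: nat monoid) \<phi>. group K \<and> \<phi> \<in> iso G K"
proof -
  define \<phi> where "\<phi> = to_nat_on (carrier G)"
  define \<psi> where "\<psi> = inv_into (carrier G) \<phi>"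
  \<comment> \<open>With carrier \<open>UNIV\<close> this need not be a group, since
    \<open>\<psi>\<close> is arbitrary off the range of \<open>\<phi>\<close>. Only its restriction
    to the codes of elements of \<open>G\<close> is used.\<close>
  define K :: "nat monoid" where "K = \<lparr>carrier = UNIV, mult = (\<lambda>x y. \<phi> (\<psi> x \<otimes>\<^bsub>G\<^esub> \<psi> y)), one = \<phi> \<one>\<^bsub>G\<^esub>\<rparr>"
  have inj: "inj_on \<phi> (carrier G)"
    unfolding \<phi>_def by (rule inj_on_to_nat_on[OF assms(2)])
  then have "\<phi> \<in> hom G K"
    by (simp add: hom_def K_def \<psi>_def)
  then have "group (K\<lparr>carrier := \<phi> ` carrier G, one := \<phi> \<one>\<^bsub>G\<^esub>\<rparr>)"
    by (rule group.hom_imp_img_group[OF assms(1)])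
  moreover have "\<phi> \<in> iso G (K\<lparr>carrier := \<phi> ` carrier G, one := \<phi> \<one>\<^bsub>G\<^esub>\<rparr>)"
    using inj by (simp add: iso_def hom_def K_def \<psi>_def bij_betw_def)
  ultimately show ?thesis
    by blast
qed

lemma perm_grp_pow: "g [^]\<^bsub>perm_grp H\<^esub> (n :: nat) = g ^^ n"
proof (induction n)
  case (Suc n)
  have "g [^]\<^bsub>perm_grp H\<^esub> Suc n = g ^^ n \<circ> g"
    using Suc by simp
  then show ?case
    by (simp only: funpow_Suc_right)
qed simp

context local_action
begin

lemma nat_model:
  assumes gen: "generate (BijGroup \<Omega>) (\<Union>b\<in>\<Omega>. derived (BijGroup \<Omega>) {f \<in> F'. f b = b}) = F'"
    and tc: "generate (BijGroup \<Omega>) {t, c} = F'"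
  shows "\<exists>K :: nat monoid. group K \<and> is_simple K \<and> fin_gen K \<and> asdim_one K \<and> perm_grp H \<cong> K
    \<and> (\<exists>x1 x2 x3 x4. {x1, x2, x3, x4} \<subseteq> carrier K \<and> generate K {x1, x2, x3, x4} = carrier K)"
proof -
  obtain K :: "nat monoid" and \<phi> where K: "group K" "\<phi> \<in> iso (perm_grp H) K"
    using nat_copy[OF group_H countable_fin_gen[OF group_H fin_gen_H]] by blast
  have \<phi>: "\<phi> ` H = carrier K" "inj_on \<phi> H"
    using K(2) by (auto simp: iso_def bij_betw_def)
  obtain a where a: "a \<in> \<Omega>"
    using third_colour by blast
  define k where "k x = L a \<circ> locperm \<Omega> F x \<circ> L a" for x
  have "{t, c} \<subseteq> F'"
    using tc generate.incl[of _ "{t, c}" "BijGroup \<Omega>"] by blast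
  then have sub: "{locperm \<Omega> F t, locperm \<Omega> F c, k t, k c} \<subseteq> H"
    using H_K L_conj_H by (simp add: k_def)
  have eq: "locperm \<Omega> F ` {t, c} \<union> (\<lambda>\<pi>. L a \<circ> locperm \<Omega> F \<pi> \<circ> L a) ` {t, c}
      = {locperm \<Omega> F t, locperm \<Omega> F c, k t, k c}"
    by (auto simp: k_def)
  have "generate (perm_grp H) {locperm \<Omega> F t, locperm \<Omega> F c, k t, k c} = carrier (perm_grp H)"
    using generate_H[OF a tc] unfolding eq by simp
  from generate_iso[OF group_H K _ this] sub
  have "generate K {\<phi> (locperm \<Omega> F t), \<phi> (locperm \<Omega> F c), \<phi> (k t), \<phi> (k c)} = carrier K"
    by simp
  moreover have "{\<phi> (locperm \<Omega> F t), \<phi> (locperm \<Omega> F c), \<phi> (k t), \<phi> (k c)} \<subseteq> carrier K"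
    using sub \<phi>(1) by blast
  moreover have "infinite (carrier K)"
    using infinite_H \<phi> finite_image_iff by metis
  then have "asdim_one K"
    using group.asdim_oneI[OF K(1)] fin_gen_iso[OF group_H K fin_gen_H]
      two_colour_chains_iso[OF group_H K(1) group.iso_set_sym[OF group_H K(2)] two_colour_chains_H]
    by blast
  moreover have "perm_grp H \<cong> K"
    using K(2) by (auto simp: is_iso_def)
  ultimately show ?thesis
    using K(1) is_simple_iso[OF simple_H[OF gen] K] fin_gen_iso[OF group_H K fin_gen_H] by blast
qed

lemma H_prime_torsion:
  assumes "Factorial_Ring.prime q" "card \<Omega> < q" "g \<in> H" "g ^^ q = id"
  shows "g = id"
  using no_large_prime_torsion[OF H_Aut[OF assms(3)] _ assms(4,1) finite_\<Omega> assms(2)] assms(3)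
  by (simp add: H_iff)

end

section \<open>Rotations and 3-cycles on a prime number of colours\<close>

definition rot :: "nat \<Rightarrow> nat \<Rightarrow> nat \<Rightarrow> nat" where
  "rot p i = (\<lambda>j\<in>{..<p}. (j + i) mod p)"

definition cyc3 :: "'a set \<Rightarrow> 'a \<Rightarrow> 'a \<Rightarrow> 'a \<Rightarrow> 'a \<Rightarrow> 'a" where
  "cyc3 \<Omega> x y z = (\<lambda>w\<in>\<Omega>. if w = x then y else if w = y then z else if w = z then x else w)"

lemma Bij_finiteI:
  assumes "finite \<Omega>" "f \<in> extensional \<Omega>" "f ` \<Omega> \<subseteq> \<Omega>" "inj_on f \<Omega>"
  shows "f \<in> Bij \<Omega>"
  using assms endo_inj_surj[OF assms(1,3,4)] by (simp add: Bij_def bij_betw_def)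

lemma cyc3_apply:
  assumes "x \<in> \<Omega>" "y \<in> \<Omega>" "z \<in> \<Omega>" "distinct [x, y, z]"
  shows "cyc3 \<Omega> x y z x = y" "cyc3 \<Omega> x y z y = z" "cyc3 \<Omega> x y z z = x"
    "w \<in> \<Omega> \<Longrightarrow> w \<noteq> x \<Longrightarrow> w \<noteq> y \<Longrightarrow> w \<noteq> z \<Longrightarrow> cyc3 \<Omega> x y z w = w"
  using assms by (auto simp: cyc3_def)

lemma cyc3_cyc3:
  assumes "x \<in> \<Omega>" "y \<in> \<Omega>" "z \<in> \<Omega>" "distinct [x, y, z]" "w \<in> \<Omega>"
  shows "cyc3 \<Omega> x z y (cyc3 \<Omega> x y z w) = w"
proof -
  have d: "distinct [x, z, y]"
    using assms(4) by auto
  note a = cyc3_apply[OF assms(1-4)] cyc3_apply[OF assms(1,3,2) d]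
  consider "w = x" | "w = y" | "w = z" | "w \<noteq> x" "w \<noteq> y" "w \<noteq> z"
    by blast
  then show ?thesis
    by cases (simp_all only: a assms(5) not_False_eq_True)
qed

lemma cyc3_Bij:
  assumes "finite \<Omega>" "x \<in> \<Omega>" "y \<in> \<Omega>" "z \<in> \<Omega>" "distinct [x, y, z]"
  shows "cyc3 \<Omega> x y z \<in> Bij \<Omega>"
proof -
  have mem: "cyc3 \<Omega> x y z w \<in> \<Omega>" "cyc3 \<Omega> x z y w \<in> \<Omega>" if "w \<in> \<Omega>" for w
    using that assms(2-4) by (simp_all add: cyc3_def)
  have inv: "cyc3 \<Omega> x z y (cyc3 \<Omega> x y z w) = w" "cyc3 \<Omega> x y z (cyc3 \<Omega> x z y w) = w" if "w \<in> \<Omega>" for w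
    using that assms cyc3_cyc3[of x \<Omega> y z w] cyc3_cyc3[of x \<Omega> z y w] by auto
  have "bij_betw (cyc3 \<Omega> x y z) \<Omega> \<Omega>"
    using mem inv by (intro bij_betw_byWitness[where f' = "cyc3 \<Omega> x z y"]) auto
  then show ?thesis
    by (simp add: Bij_def cyc3_def)
qed

lemma conj_cyc3:
  assumes "g \<in> Bij \<Omega>" "finite \<Omega>" "x \<in> \<Omega>" "y \<in> \<Omega>" "z \<in> \<Omega>" "distinct [x, y, z]"
  shows "g \<otimes>\<^bsub>BijGroup \<Omega>\<^esub> cyc3 \<Omega> x y z \<otimes>\<^bsub>BijGroup \<Omega>\<^esub> m_inv (BijGroup \<Omega>) g = cyc3 \<Omega> (g x) (g y) (g z)"
proof -
  have B: "cyc3 \<Omega> x y z \<in> Bij \<Omega>" "cyc3 \<Omega> (g x) (g y) (g z) \<in> Bij \<Omega>"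
    using assms(3-6) by (intro cyc3_Bij[OF assms(2)] Bij_mem[OF assms(1)]; simp add: Bij_inj[OF assms(1)])+
  show ?thesis
    unfolding BijGroup_simps(3)[OF assms(1) B(1)] BijGroup_simps(3)[OF compose_Bij[OF assms(1) B(1)] Bij_m_inv(1)[OF assms(1)]]
  proof (rule Bij_eqI)
    show "compose \<Omega> (compose \<Omega> g (cyc3 \<Omega> x y z)) (m_inv (BijGroup \<Omega>) g) \<in> Bij \<Omega>"
      by (intro compose_Bij B assms Bij_m_inv)
    fix w assume w: "w \<in> \<Omega>"
    define u where "u = m_inv (BijGroup \<Omega>) g w"
    have u: "u \<in> \<Omega>" "w = g u"
      using Bij_mem[OF Bij_m_inv(1)[OF assms(1)] w] Bij_m_inv(3)[OF assms(1) w] by (simp_all add: u_def)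
    have "compose \<Omega> (compose \<Omega> g (cyc3 \<Omega> x y z)) (m_inv (BijGroup \<Omega>) g) w = g (cyc3 \<Omega> x y z u)"
      using w u(1) by (simp add: compose_eq flip: u_def)
    also have "\<dots> = cyc3 \<Omega> (g x) (g y) (g z) (g u)"
      using u(1) assms Bij_mem[OF assms(1) u(1)] by (simp add: cyc3_def Bij_inj[OF assms(1)])
    finally show "compose \<Omega> (compose \<Omega> g (cyc3 \<Omega> x y z)) (m_inv (BijGroup \<Omega>) g) w
        = cyc3 \<Omega> (g x) (g y) (g z) w"
      by (simp add: u(2))
  qed (rule B)
qed

lemma inv_cyc3:
  assumes "finite \<Omega>" "x \<in> \<Omega>" "y \<in> \<Omega>" "z \<in> \<Omega>" "distinct [x, y, z]"
  shows "m_inv (BijGroup \<Omega>) (cyc3 \<Omega> x y z) = cyc3 \<Omega> x z y"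
proof (rule group.inv_equality[OF group_BijGroup])
  have B: "cyc3 \<Omega> x z y \<in> Bij \<Omega>" "cyc3 \<Omega> x y z \<in> Bij \<Omega>"
    using assms by (auto intro!: cyc3_Bij)
  show "cyc3 \<Omega> x y z \<in> carrier (BijGroup \<Omega>)" "cyc3 \<Omega> x z y \<in> carrier (BijGroup \<Omega>)"
    using B by (simp_all add: BijGroup_simps)
  show "cyc3 \<Omega> x z y \<otimes>\<^bsub>BijGroup \<Omega>\<^esub> cyc3 \<Omega> x y z = \<one>\<^bsub>BijGroup \<Omega>\<^esub>"
    unfolding BijGroup_simps(2) BijGroup_simps(3)[OF B]
    by (rule Bij_eqI[OF compose_Bij[OF B] id_Bij]) (use assms cyc3_cyc3[OF assms(2-5)] in \<open>simp add: compose_eq\<close>)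
qed

text \<open>Conjugating (a d e) by (a b c) gives (b d e), and (b d e)(a e d) = (a b d), the right
  factor acting first. A commutator of 3-cycles is thus again a 3-cycle.\<close>

lemma commutator_cyc3:
  assumes "finite \<Omega>" "{a, b, c, d, e} \<subseteq> \<Omega>" "distinct [a, b, c, d, e]"
  shows "cyc3 \<Omega> a b c \<otimes>\<^bsub>BijGroup \<Omega>\<^esub> cyc3 \<Omega> a d e \<otimes>\<^bsub>BijGroup \<Omega>\<^esub> m_inv (BijGroup \<Omega>) (cyc3 \<Omega> a b c)
     \<otimes>\<^bsub>BijGroup \<Omega>\<^esub> m_inv (BijGroup \<Omega>) (cyc3 \<Omega> a d e) = cyc3 \<Omega> a b d"
proof -
  have B: "cyc3 \<Omega> a b c \<in> Bij \<Omega>" "cyc3 \<Omega> b d e \<in> Bij \<Omega>" "cyc3 \<Omega> a e d \<in> Bij \<Omega>" "cyc3 \<Omega> a b d \<in> Bij \<Omega>"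
    using assms by (auto intro!: cyc3_Bij)
  have "cyc3 \<Omega> a b c a = b" "cyc3 \<Omega> a b c d = d" "cyc3 \<Omega> a b c e = e"
    using assms(2,3) by (auto simp: cyc3_def)
  then have "cyc3 \<Omega> a b c \<otimes>\<^bsub>BijGroup \<Omega>\<^esub> cyc3 \<Omega> a d e \<otimes>\<^bsub>BijGroup \<Omega>\<^esub> m_inv (BijGroup \<Omega>) (cyc3 \<Omega> a b c)
      = cyc3 \<Omega> b d e"
    using conj_cyc3[OF B(1) assms(1), of a d e] assms by simp
  moreover have "m_inv (BijGroup \<Omega>) (cyc3 \<Omega> a d e) = cyc3 \<Omega> a e d"
    using assms by (intro inv_cyc3) auto
  moreover have "compose \<Omega> (cyc3 \<Omega> b d e) (cyc3 \<Omega> a e d) = cyc3 \<Omega> a b d"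
  proof (rule Bij_eqI[OF compose_Bij[OF B(2,3)] B(4)])
    fix w assume w: "w \<in> \<Omega>"
    consider "w = a" | "w = b" | "w = d" | "w = e" | "w \<noteq> a" "w \<noteq> b" "w \<noteq> d" "w \<noteq> e"
      by blast
    then show "compose \<Omega> (cyc3 \<Omega> b d e) (cyc3 \<Omega> a e d) w = cyc3 \<Omega> a b d w"
      using assms(2,3) w by cases (auto simp: compose_eq cyc3_def)
  qed
  ultimately show ?thesis
    by (simp only: BijGroup_simps(3)[OF B(2,3)])
qed

locale rotation_example =
  fixes p :: nat
  assumes p: "Factorial_Ring.prime p" "p \<ge> 7"
begin

abbreviation "\<Omega> \<equiv> {..<p}"

abbreviation "BG \<equiv> BijGroup \<Omega>"

abbreviation "c3 \<equiv> cyc3 \<Omega>"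

text \<open>Since \<open>p\<close> is odd this is the alternating group on \<open>p\<close> letters.
  Its presentation by two generators is what gives four generators for the type-preserving
  group.\<close>

definition "rot3 = generate BG {c3 0 1 2, rot p 1}"

lemma rot_Bij: "rot p i \<in> Bij \<Omega>"
proof (rule Bij_finiteI)
  show "inj_on (rot p i) \<Omega>"
  proof (rule inj_onI)
    fix x y assume xy: "x \<in> \<Omega>" "y \<in> \<Omega>" "rot p i x = rot p i y"
    then have "(x + i) mod p = (y + i) mod p"
      by (simp add: rot_def)
    then have "x mod p = y mod p"
      using cong_add_rcancel_nat[of x i y p] by (simp add: cong_def)
    then show "x = y"
      using xy by simp
  qed
qed (use p in \<open>auto simp: rot_def\<close>)

lemma rot_apply: "x < p \<Longrightarrow> rot p i x = (x + i) mod p"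
  by (simp add: rot_def)

lemma rot_compose: "compose \<Omega> (rot p i) (rot p j) = rot p (i + j)"
  using p by (intro Bij_eqI[OF compose_Bij[OF rot_Bij rot_Bij] rot_Bij])
    (simp add: compose_eq rot_def mod_simps ac_simps)

lemma rot_mod: "rot p (i mod p) = rot p i"
  by (auto simp: rot_def mod_add_right_eq)

lemma rot_0: "rot p 0 = (\<lambda>x\<in>\<Omega>. x)"
  by (auto simp: rot_def)

lemma range_rot: "rot p i \<in> rot p ` \<Omega>"
  using p rot_mod[of i] by (intro image_eqI[of _ _ "i mod p"]) auto

lemma rots_subgroup: "subgroup (rot p ` \<Omega>) BG"
proof (rule group.subgroupI[OF group_BijGroup])
  show "rot p ` \<Omega> \<subseteq> carrier BG"
    using rot_Bij by (auto simp: BijGroup_simps)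
  show "rot p ` \<Omega> \<noteq> {}"
    using p by (auto simp: lessThan_empty_iff)
next
  fix a assume "a \<in> rot p ` \<Omega>"
  then obtain i where i: "i < p" "a = rot p i"
    by auto
  have "m_inv BG (rot p i) = rot p (p - i)"
  proof (rule group.inv_equality[OF group_BijGroup])
    have "rot p (p - i) \<otimes>\<^bsub>BG\<^esub> rot p i = rot p (p mod p)"
      using i by (simp only: BijGroup_simps(3)[OF rot_Bij rot_Bij] rot_compose rot_mod) simp
    then show "rot p (p - i) \<otimes>\<^bsub>BG\<^esub> rot p i = \<one>\<^bsub>BG\<^esub>"
      by (simp only: mod_self rot_0 BijGroup_simps(2))
  qed (simp_all add: BijGroup_simps rot_Bij)
  then show "m_inv BG a \<in> rot p ` \<Omega>"
    using range_rot i by simp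
next
  fix a b assume "a \<in> rot p ` \<Omega>" "b \<in> rot p ` \<Omega>"
  then show "a \<otimes>\<^bsub>BG\<^esub> b \<in> rot p ` \<Omega>"
    using range_rot by (auto simp: BijGroup_simps rot_Bij rot_compose)
qed

lemma rots_simply_transitive:
  assumes "a \<in> \<Omega>" "b \<in> \<Omega>"
  shows "\<exists>!f. f \<in> rot p ` \<Omega> \<and> f a = b"
proof (rule ex1I)
  have "(a + (p - a + b)) mod p = b"
    using assms by simp
  then show "rot p (p - a + b) \<in> rot p ` \<Omega> \<and> rot p (p - a + b) a = b"
    using range_rot assms by (simp add: rot_apply)
  fix f assume "f \<in> rot p ` \<Omega> \<and> f a = b"
  then obtain i where i: "i < p" "f = rot p i" "(a + i) mod p = b"
    using assms by (auto simp: rot_apply)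
  then have "(a + i) mod p = (a + (p - a + b)) mod p"
    using \<open>(a + (p - a + b)) mod p = b\<close> by simp
  then have "i mod p = (p - a + b) mod p"
    using cong_add_lcancel_nat[of a i "p - a + b" p] unfolding cong_def by blast
  then show "f = rot p (p - a + b)"
    using i rot_mod by metis
qed

lemma generators_Bij: "{c3 0 1 2, rot p 1} \<subseteq> carrier BG"
  using p rot_Bij by (auto simp: BijGroup_simps intro!: cyc3_Bij)

lemma rot3_subgroup: "subgroup rot3 BG"
  unfolding rot3_def by (rule group.generate_is_subgroup[OF group_BijGroup generators_Bij])

lemma rots_subset: "rot p ` \<Omega> \<subseteq> rot3"
proof -
  have "rot p i \<in> rot3" for i
  proof (induction i)
    case 0
    then show ?case
      using subgroup.one_closed[OF rot3_subgroup] by (simp only: rot_0 BijGroup_simps(2))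
  next
    case (Suc i)
    have "rot p 1 \<in> rot3"
      unfolding rot3_def by (rule generate.incl) simp
    then have "rot p 1 \<otimes>\<^bsub>BG\<^esub> rot p i \<in> rot3"
      using subgroup.m_closed[OF rot3_subgroup] Suc by blast
    then show ?case
      by (simp add: BijGroup_simps rot_Bij rot_compose)
  qed
  then show ?thesis
    by blast
qed

lemma conj_c3_rot3:
  assumes "g \<in> rot3" "c3 x y z \<in> rot3" "{x, y, z} \<subseteq> \<Omega>" "distinct [x, y, z]"
  shows "c3 (g x) (g y) (g z) \<in> rot3"
proof -
  have "g \<in> Bij \<Omega>"
    using subgroup.subset[OF rot3_subgroup] assms(1) by (auto simp: BijGroup_simps)
  then show ?thesis
    using conj_cyc3[of g \<Omega> x y z] assms subgroup.m_closed[OF rot3_subgroup] subgroup.m_inv_closed[OF rot3_subgroup]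
    by (metis finite_lessThan insert_subset)
qed

text \<open>The last two 3-cycles share only the point 0, and their commutator is (0 1 2). They are
  obtained by conjugating (0 1 2) with (1 2 3) and (2 3 4), its images under rotations.\<close>

lemma c3_rot3:
  "c3 0 1 2 \<in> rot3" "c3 0 1 3 \<in> rot3" "c3 0 2 4 \<in> rot3"
proof -
  show *: "c3 0 1 2 \<in> rot3"
    unfolding rot3_def by (rule generate.incl) simp
  have r: "rot p i \<in> rot3" for i
    using range_rot rots_subset by blast
  have 1: "c3 1 2 3 \<in> rot3"
    using conj_c3_rot3[OF r[of 1] *] p by (simp add: rot_apply flip: numeral_2_eq_2)
  have 2: "c3 2 3 4 \<in> rot3"
    using conj_c3_rot3[OF r[of 2] *] p by (simp add: rot_apply flip: numeral_2_eq_2)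
  show 3: "c3 0 1 3 \<in> rot3"
    using conj_c3_rot3[OF 2 *] p by (simp add: cyc3_def)
  have 4: "c3 0 1 4 \<in> rot3"
    using conj_c3_rot3[OF 2 3] p by (simp add: cyc3_def)
  show "c3 0 2 4 \<in> rot3"
    using conj_c3_rot3[OF 1 4] p by (simp add: cyc3_def)
qed

definition "stab_derived = generate BG (\<Union>a\<in>\<Omega>. derived BG {f \<in> rot3. f a = a})"

lemma stab_carrier: "(\<Union>a\<in>\<Omega>. derived BG {f \<in> rot3. f a = a}) \<subseteq> rot3"
  by (intro UN_least group.derived_incl[OF group_BijGroup _ rot3_subgroup]) (rule Collect_restrict)

lemma stab_derived_subgroup: "subgroup stab_derived BG"
  unfolding stab_derived_def
  by (rule group.generate_is_subgroup[OF group_BijGroup subset_trans[OF stab_carrier subgroup.subset[OF rot3_subgroup]]])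

text \<open>The rotated 3-cycles \<open>h\<close> and \<open>k\<close> move only the images of 0 to
  4, so both fix the image \<open>r 6\<close>. Their commutator, the wanted 3-cycle, lies in the
  derived subgroup of the stabiliser of that point. The bound on \<open>i\<close> prevents wrapping
  around.\<close>

lemma c3_stab_derived:
  assumes "i + 2 < p"
  shows "c3 i (i + 1) (i + 2) \<in> stab_derived"
proof -
  define r where "r = rot p i"
  have rF: "r \<in> rot3" and rB: "r \<in> Bij \<Omega>"
    using range_rot rots_subset rot_Bij by (auto simp: r_def)
  have inj: "r x = r y \<longleftrightarrow> x = y" if "x < p" "y < p" for x y
    using Bij_inj[OF rB] that by simp
  have mem: "r x < p" if "x < p" for x
    using Bij_mem[OF rB] that by simp
  define h k where "h = c3 (r 0) (r 1) (r 3)" and "k = c3 (r 0) (r 2) (r 4)"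
  have "h \<in> rot3" "k \<in> rot3"
    unfolding h_def k_def using p by (intro conj_c3_rot3[OF rF] c3_rot3; simp)+
  moreover have "h (r 6) = r 6" "k (r 6) = r 6"
    using p by (auto simp: h_def k_def cyc3_def mem inj)
  moreover have "r 6 \<in> \<Omega>"
    using mem p by simp
  ultimately have "h \<otimes>\<^bsub>BG\<^esub> k \<otimes>\<^bsub>BG\<^esub> m_inv BG h \<otimes>\<^bsub>BG\<^esub> m_inv BG k \<in> derived BG {f \<in> rot3. f (r 6) = r 6}"
    unfolding derived_def by (intro generate.incl) blast
  then have "h \<otimes>\<^bsub>BG\<^esub> k \<otimes>\<^bsub>BG\<^esub> m_inv BG h \<otimes>\<^bsub>BG\<^esub> m_inv BG k \<in> stab_derived"
    unfolding stab_derived_def using \<open>r 6 \<in> \<Omega>\<close> by (intro generate.incl UN_I)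
  moreover have "h \<otimes>\<^bsub>BG\<^esub> k \<otimes>\<^bsub>BG\<^esub> m_inv BG h \<otimes>\<^bsub>BG\<^esub> m_inv BG k = c3 (r 0) (r 1) (r 2)"
    unfolding h_def k_def using p by (intro commutator_cyc3) (auto simp: mem inj)
  moreover have "r 0 = i" "r 1 = i + 1" "r 2 = i + 2"
    using assms p by (simp_all add: r_def rot_apply)
  ultimately show ?thesis
    by simp
qed

text \<open>The \<open>p\<close>-cycle is a product of overlapping 3-cycles:
  \<open>(0 1 \<dots> 2k+2) = (0 1 \<dots> 2k) (2k 2k+1 2k+2)\<close>.\<close>

lemma rot_stab_derived: "rot p 1 \<in> stab_derived"
proof -
  define q where "q k = (\<lambda>j\<in>\<Omega>. if j < 2 * k then j + 1 else if j = 2 * k then 0 else j)" for k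
  have qB: "q k \<in> Bij \<Omega>" if "2 * k < p" for k
    using that by (intro Bij_finiteI) (auto simp: q_def inj_on_def split: if_splits)
  have "q k \<in> stab_derived" if "2 * k < p" for k
    using that
  proof (induction k)
    case 0
    have "q 0 = \<one>\<^bsub>BG\<^esub>"
      by (auto simp: q_def BijGroup_simps)
    then show ?case
      using subgroup.one_closed[OF stab_derived_subgroup] by simp
  next
    case (Suc k)
    have c: "c3 (2 * k) (2 * k + 1) (2 * k + 2) \<in> Bij \<Omega>"
      using Suc.prems by (intro cyc3_Bij) auto
    have k: "2 * k < p"
      using Suc.prems by simp
    have "compose \<Omega> (q k) (c3 (2 * k) (2 * k + 1) (2 * k + 2)) = q (Suc k)"
      by (rule Bij_eqI[OF compose_Bij[OF qB[OF k] c] qB[OF Suc.prems]])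
        (use Suc.prems in \<open>auto simp: compose_eq q_def cyc3_def\<close>)
    moreover have "q k \<otimes>\<^bsub>BG\<^esub> c3 (2 * k) (2 * k + 1) (2 * k + 2) \<in> stab_derived"
      using subgroup.m_closed[OF stab_derived_subgroup Suc.IH[OF k] c3_stab_derived] Suc.prems by simp
    ultimately show ?case
      by (simp only: BijGroup_simps(3)[OF qB[OF k] c])
  qed
  \<comment> \<open>Products of this kind reach only cycles of odd length, so \<open>p\<close> must
    be odd for the full rotation to occur, at \<open>m\<close> with
    \<open>p = 2 * m + 1\<close>.\<close>
  moreover have "odd p"
    using p prime_odd_nat by auto
  then obtain m where m: "p = 2 * m + 1"
    by (rule oddE)
  have "q m = rot p 1"
    by (rule Bij_eqI[OF qB rot_Bij]) (auto simp: m q_def rot_def mod_if)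
  ultimately show ?thesis
    using m by (metis less_add_one)
qed

lemma stab_derived_eq: "stab_derived = rot3"
proof
  show "stab_derived \<subseteq> rot3"
    unfolding stab_derived_def by (rule group.generate_subgroup_incl[OF group_BijGroup stab_carrier rot3_subgroup])
  have "c3 0 1 2 \<in> stab_derived"
    using c3_stab_derived[of 0] p by (simp flip: numeral_2_eq_2)
  then show "rot3 \<subseteq> stab_derived"
    unfolding rot3_def using rot_stab_derived
    by (intro group.generate_subgroup_incl[OF group_BijGroup _ stab_derived_subgroup]) simp
qed

end

section \<open>Infinitely many groups\<close>

lemma iso_torsion:
  assumes "group G" "group K" "G \<cong> K" "x \<in> carrier G" "x \<noteq> \<one>\<^bsub>G\<^esub>" "x [^]\<^bsub>G\<^esub> (n :: nat) = \<one>\<^bsub>G\<^esub>"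
  shows "\<exists>y\<in>carrier K. y \<noteq> \<one>\<^bsub>K\<^esub> \<and> y [^]\<^bsub>K\<^esub> n = \<one>\<^bsub>K\<^esub>"
proof -
  obtain \<phi> where \<phi>: "\<phi> \<in> iso G K"
    using assms(3) by (auto simp: is_iso_def)
  interpret \<phi>: group_hom G K \<phi>
    by (rule iso_group_hom[OF assms(1,2) \<phi>])
  have "inj_on \<phi> (carrier G)"
    using \<phi> by (simp add: iso_def bij_betw_def)
  then have "\<phi> x \<noteq> \<one>\<^bsub>K\<^esub>"
    using inj_onD[of \<phi> "carrier G" x "\<one>\<^bsub>G\<^esub>"] assms(4,5) by auto
  moreover have "\<phi> x [^]\<^bsub>K\<^esub> n = \<one>\<^bsub>K\<^esub>"
    using \<phi>.hom_nat_pow[OF assms(4), of n] assms(6) by simp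
  ultimately show ?thesis
    using assms(4) by (intro bexI[of _ "\<phi> x"]) auto
qed

context rotation_example
begin

sublocale A: local_action \<Omega> "rot p ` \<Omega>" rot3
  using p rots_simply_transitive
  by (intro local_action.intro rots_subgroup rot3_subgroup rots_subset ballI) auto

lemma K_rot_funpow: "A.K (rot p 1) ^^ n = A.K (rot p n)"
proof (induction n)
  case 0
  show ?case
    by (simp only: funpow.simps rot_0 A.K_id)
next
  case (Suc n)
  have "compose \<Omega> (rot p 1) (rot p n) = rot p (Suc n)"
    by (simp add: rot_compose)
  then show ?case
    using A.K_compose[OF rot_Bij rot_Bij, of 1 n] Suc by (simp only: funpow.simps)
qed

lemma exists_p_torsion:
  "\<exists>g\<in>A.H. g \<noteq> id \<and> g ^^ p = id"
proof (intro bexI conjI)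
  have "A.K (rot p 1) [0] = [1]"
    using p by (simp add: locperm_def rot_apply)
  then show "A.K (rot p 1) \<noteq> id"
    by auto
  have "rot p p = rot p 0"
    using rot_mod[of p] by simp
  then show "A.K (rot p 1) ^^ p = id"
    using A.K_id by (simp only: K_rot_funpow rot_0)
  show "A.K (rot p 1) \<in> A.H"
    using range_rot rots_subset by (intro A.H_K) blast
qed

lemma nat_group:
  "\<exists>K :: nat monoid. group K \<and> is_simple K \<and> fin_gen K \<and> asdim_one K
    \<and> (\<exists>x1 x2 x3 x4. {x1, x2, x3, x4} \<subseteq> carrier K \<and> generate K {x1, x2, x3, x4} = carrier K)
    \<and> (\<exists>x\<in>carrier K. x \<noteq> \<one>\<^bsub>K\<^esub> \<and> x [^]\<^bsub>K\<^esub> p = \<one>\<^bsub>K\<^esub>)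
    \<and> (\<forall>q x. Factorial_Ring.prime q \<longrightarrow> p < q \<longrightarrow> x \<in> carrier K \<longrightarrow> x [^]\<^bsub>K\<^esub> q = \<one>\<^bsub>K\<^esub> \<longrightarrow> x = \<one>\<^bsub>K\<^esub>)"
proof -
  obtain K :: "nat monoid" where K: "group K" "is_simple K \<and> fin_gen K \<and> asdim_one K"
    "\<exists>x1 x2 x3 x4. {x1, x2, x3, x4} \<subseteq> carrier K \<and> generate K {x1, x2, x3, x4} = carrier K"
    and iso: "perm_grp A.H \<cong> K"
    using A.nat_model[OF stab_derived_eq[unfolded stab_derived_def] rot3_def[symmetric]] by blast
  obtain g where g: "g \<in> A.H" "g \<noteq> id" "g ^^ p = id"
    using exists_p_torsion by blast
  have "\<exists>x\<in>carrier K. x \<noteq> \<one>\<^bsub>K\<^esub> \<and> x [^]\<^bsub>K\<^esub> p = \<one>\<^bsub>K\<^esub>"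
    using iso_torsion[OF A.group_H K(1) iso, of g p] g by (simp add: perm_grp_pow)
  moreover have "x = \<one>\<^bsub>K\<^esub>"
    if q: "Factorial_Ring.prime q" "p < q" and x: "x \<in> carrier K" "x [^]\<^bsub>K\<^esub> q = \<one>\<^bsub>K\<^esub>" for q x
  proof (rule ccontr)
    assume "x \<noteq> \<one>\<^bsub>K\<^esub>"
    then obtain h where "h \<in> A.H" "h \<noteq> id" "h ^^ q = id"
      using iso_torsion[OF K(1) A.group_H group.iso_sym[OF A.group_H iso] x(1) _ x(2)]
      by (auto simp: perm_grp_pow)
    then show False
      using A.H_prime_torsion[OF q(1)] q(2) by simp
  qed
  ultimately show ?thesis
    using K by blast
qed

end

lemma infinitely_many_groups:
  "\<exists>Gs :: nat \<Rightarrow> nat monoid.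
     (\<forall>i. is_simple (Gs i) \<and> fin_gen (Gs i) \<and> asdim_one (Gs i)
        \<and> (\<exists>x1 x2 x3 x4. {x1, x2, x3, x4} \<subseteq> carrier (Gs i)
              \<and> generate (Gs i) {x1, x2, x3, x4} = carrier (Gs i)))
     \<and> (\<forall>i j. i \<noteq> j \<longrightarrow> \<not> (Gs i \<cong> Gs j))"
proof -
  define A where "A = {p :: nat. Factorial_Ring.prime p \<and> 7 \<le> p}"
  have "{p :: nat. Factorial_Ring.prime p} \<subseteq> A \<union> {..<7}"
    by (auto simp: A_def)
  then have inf: "infinite A"
    using primes_infinite finite_subset by (metis finite_UnI finite_lessThan)
  define p where "p i = enumerate A i" for i
  have p: "rotation_example (p i)" for i
    using enumerate_in_set[OF inf, of i] by (simp add: p_def A_def rotation_example_def)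
  define Q where "Q i K \<longleftrightarrow> group K \<and> is_simple K \<and> fin_gen K \<and> asdim_one K
    \<and> (\<exists>x1 x2 x3 x4. {x1, x2, x3, x4} \<subseteq> carrier K \<and> generate K {x1, x2, x3, x4} = carrier K)
    \<and> (\<exists>x\<in>carrier K. x \<noteq> \<one>\<^bsub>K\<^esub> \<and> x [^]\<^bsub>K\<^esub> p i = \<one>\<^bsub>K\<^esub>)
    \<and> (\<forall>q x. Factorial_Ring.prime q \<longrightarrow> p i < q \<longrightarrow> x \<in> carrier K \<longrightarrow> x [^]\<^bsub>K\<^esub> q = \<one>\<^bsub>K\<^esub> \<longrightarrow> x = \<one>\<^bsub>K\<^esub>)"
    for i and K :: "nat monoid"
  have "\<forall>i. \<exists>K. Q i K"
    unfolding Q_def using rotation_example.nat_group[OF p] by blast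
  then obtain Gs where Gs: "\<And>i. Q i (Gs i)"
    using choice by metis
  \<comment> \<open>The group of the larger index has nontrivial \<open>p j\<close>-torsion, while
    the group of the smaller index has none for primes above \<open>p i\<close>. Symmetry of
    isomorphism reduces the general case to this one.\<close>
  have less: False if ij_less: "i < j" and ij_iso: "Gs j \<cong> Gs i" for i j
  proof -
    have ij: "p i < p j"
      unfolding p_def by (rule enumerate_mono[OF ij_less inf])
    have grp: "group (Gs i)" "group (Gs j)"
      using Gs unfolding Q_def by blast+
    obtain x where "x \<in> carrier (Gs j)" "x \<noteq> \<one>\<^bsub>Gs j\<^esub>" "x [^]\<^bsub>Gs j\<^esub> p j = \<one>\<^bsub>Gs j\<^esub>"
      using Gs[of j] unfolding Q_def by blast
    then obtain y where "y \<in> carrier (Gs i)" "y \<noteq> \<one>\<^bsub>Gs i\<^esub>" "y [^]\<^bsub>Gs i\<^esub> p j = \<one>\<^bsub>Gs i\<^esub>"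
      using iso_torsion[OF grp(2,1) ij_iso] by blast
    moreover have "Factorial_Ring.prime (p j)"
      using p[of j] by (simp add: rotation_example_def)
    ultimately show False
      using Gs[of i] ij unfolding Q_def by blast
  qed
  have "\<not> Gs i \<cong> Gs j" if "i \<noteq> j" for i j
  proof
    assume iso: "Gs i \<cong> Gs j"
    have "group (Gs i)"
      using Gs unfolding Q_def by blast
    then show False
      using that less iso group.iso_sym[of "Gs i" "Gs j"] by (cases i j rule: linorder_cases) blast+
  qed
  then show ?thesis
    using Gs unfolding Q_def by (intro exI[of _ Gs]) blast
qed

theorem theorem1p3:
  fixes \<Omega> :: "'a set" and F F' :: "('a \<Rightarrow> 'a) set"
  assumes "finite \<Omega>" and "card \<Omega> \<ge> 3"
    and "subgroup F (BijGroup \<Omega>)" and "subgroup F' (BijGroup \<Omega>)" and "F \<subseteq> F'"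
    and "\<forall>a\<in>\<Omega>. \<forall>b\<in>\<Omega>. \<exists>!f. f \<in> F \<and> f a = b"
    and "generate (BijGroup \<Omega>)
           (\<Union>a\<in>\<Omega>. derived (BijGroup \<Omega>) {f \<in> F'. f a = a}) = F'"
  shows "(card (rcosets\<^bsub>perm_grp (G2 \<Omega> F F')\<^esub> (star \<Omega> (G2 \<Omega> F F'))) = 2
       \<and> (\<forall>g\<in>star \<Omega> (G2 \<Omega> F F').
            openin (subtopology (Gtop \<Omega> F F') (star \<Omega> (G2 \<Omega> F F'))) {g})
       \<and> is_simple (perm_grp (star \<Omega> (G2 \<Omega> F F')))
       \<and> fin_gen (perm_grp (star \<Omega> (G2 \<Omega> F F')))
       \<and> asdim_one (perm_grp (star \<Omega> (G2 \<Omega> F F'))))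
    \<and> (\<exists>Gs :: nat \<Rightarrow> nat monoid.
           (\<forall>i. is_simple (Gs i) \<and> fin_gen (Gs i) \<and> asdim_one (Gs i)
                \<and> (\<exists>x1 x2 x3 x4. {x1, x2, x3, x4} \<subseteq> carrier (Gs i)
                      \<and> generate (Gs i) {x1, x2, x3, x4} = carrier (Gs i)))
         \<and> (\<forall>i j. i \<noteq> j \<longrightarrow> \<not> (Gs i \<cong> Gs j)))"
proof -
  interpret local_action \<Omega> F F'
    using assms(1-6) by (rule local_action.intro)
  show ?thesis
    using H_index H_discrete simple_H[OF assms(7)] fin_gen_H asdim_one_H infinitely_many_groups
    by blast
qed

end
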